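(* Let $p\ge0$ be a fixed integer and let $V:S^1\to\mathbb{R}$ be of class $C^{k-1,1}(S^1)$ for some $k\ge 2p+2$. For each $n$, let $\pi_n$ be the monic polynomial of degree $n$ orthogonal on the unit circle with respect to the weight $\phi(\theta)=e^{-nV(\theta)}$. If $\kappa'(\theta)>0$ for all $\theta$, then for each $\rho>1$ there is a constant $K_{p,\rho}>0$ such that \[ \sup_{|z|\ge\rho}\left|\frac{d^p}{dz^p}\left[\pi_n(z)z^{-n}e^{-nN(z)}-1\right]\right|\le K_{p,\rho}\frac{\log(n)}{n^{2(k-1)}} \] for all sufficiently large $n$.
   Context: $C^{k-1,1}(S^1)$: functions on the circle whose periodic extension has $k-1$ Lipschitz continuous derivatives. Orthogonality: $\langle \pi_n,z^j\rangle_\phi=0$ for $0\le j<n$, with $\langle f,g\rangle_\phi=\frac{1}{2\pi}\int_{-\pi}^{\pi}f(e^{i\theta})\overline{g(e^{i\theta})}\phi(\theta)d\theta$ (note the weight depends on $n$, the same $n$ as the degree). $V_j=\frac{1}{2\pi}\int_{-\pi}^\pi V(\theta)e^{-ij\theta}d\theta$, $N(z)=\sum_{j\ge1}V_{-j}z^{-j}$ for $|z|\ge1$, $\Omega(\theta)=2\,\mathrm{Im}\,N(e^{i\theta})$ and $\kappa(\theta)=\theta+\Omega(\theta)$. *)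

theory Defs
  imports "HOL-Analysis.Analysis" "HOL-Computational_Algebra.Polynomial"
begin

definition C_lip_circle :: "nat \<Rightarrow> (real \<Rightarrow> real) \<Rightarrow> bool" where
  "C_lip_circle m V \<longleftrightarrow>
     (\<forall>x. V (x + 2 * pi) = V x) \<and>
     (\<exists>D :: nat \<Rightarrow> real \<Rightarrow> real. D 0 = V \<and>
        (\<forall>i<m. \<forall>x. (D i has_real_derivative D (Suc i) x) (at x)) \<and>
        (\<exists>L. \<forall>x y. \<bar>D m x - D m y\<bar> \<le> L * \<bar>x - y\<bar>))"

definition fourier_coeff :: "(real \<Rightarrow> real) \<Rightarrow> int \<Rightarrow> complex" where
  "fourier_coeff V j = integral {-pi..pi}
      (\<lambda>\<theta>. complex_of_real (V \<theta>) * cis (- of_int j * \<theta>)) / complex_of_real (2 * pi)"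

definition Nfun :: "(real \<Rightarrow> real) \<Rightarrow> complex \<Rightarrow> complex" where
  "Nfun V z = (\<Sum>j. fourier_coeff V (- int (Suc j)) / z ^ Suc j)"

definition Omega :: "(real \<Rightarrow> real) \<Rightarrow> real \<Rightarrow> real" where
  "Omega V \<theta> = 2 * Im (Nfun V (cis \<theta>))"

definition kappa :: "(real \<Rightarrow> real) \<Rightarrow> real \<Rightarrow> real" where
  "kappa V \<theta> = \<theta> + Omega V \<theta>"

definition inner_phi :: "(real \<Rightarrow> real) \<Rightarrow> (complex \<Rightarrow> complex) \<Rightarrow> (complex \<Rightarrow> complex) \<Rightarrow> complex" where
  "inner_phi \<phi> f g = integral {-pi..pi}
      (\<lambda>\<theta>. f (cis \<theta>) * cnj (g (cis \<theta>)) * complex_of_real (\<phi> \<theta>)) / complex_of_real (2 * pi)"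

definition is_OPUC :: "(real \<Rightarrow> real) \<Rightarrow> nat \<Rightarrow> complex poly \<Rightarrow> bool" where
  "is_OPUC V n P \<longleftrightarrow> degree P = n \<and> lead_coeff P = 1 \<and>
     (\<forall>j<n. inner_phi (\<lambda>\<theta>. exp (- real n * V \<theta>)) (poly P) (\<lambda>z. z ^ j) = 0)"

end

theory Submission
  imports Defs "HOL-Complex_Analysis.Complex_Analysis"
begin

text \<open>
  Write \<open>S(w) = \<Sum>\<^sub>j\<^sub>\<ge>\<^sub>1 V\<^sub>j w\<^sup>j\<close>, so that \<open>V = V\<^sub>0 + S + cnj S\<close> on the circle, \<open>N(1/w) = cnj (S (cnj w))\<close>, and
  \<open>u = z\<^sup>n exp (n (cnj S - S)) = exp (i n \<kappa>)\<close>. Orthogonality says that \<open>F = \<pi>\<^sub>n z\<^sup>-\<^sup>n exp (-n (S + cnj S))\<close> has no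
  frequencies in \<open>[-n, -1]\<close>. Splitting \<open>F\<close> into its frequencies \<open>\<ge> 0\<close> and \<open>< -n\<close> and multiplying by \<open>exp (n S)\<close>
  gives, with \<open>cnj G = \<pi>\<^sub>n z\<^sup>-\<^sup>n exp (-n N)\<close>, the equations \<open>cnj G = v + cnj (u W)\<close> and \<open>u v + cnj W = Q\<close> on the circle, where
  \<open>G\<close>, \<open>v\<close>, \<open>W\<close>, \<open>Q\<close> extend analytically to the disk, \<open>G(0) = 1\<close> and \<open>W(0) = 0\<close>.

  Since \<open>\<kappa>' > 0\<close>, the function \<open>u\<close> has almost only frequencies of order \<open>n\<close>: the Hankel form \<open>\<langle>u y Y\<rangle>\<close> on the Hardy
  space has norm at most \<open>1/2\<close> for large \<open>n\<close>, and \<open>\<langle>u Y z\<^sup>-\<^sup>m\<rangle> = O(n\<^sup>1\<^sup>-\<^sup>k) |Y|\<close> for \<open>m \<le> c n\<close>. The first fact makes the system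
  uniquely solvable with \<open>|W| = O(|\<langle>u W\<rangle>| / |W|) = O(n\<^sup>1\<^sup>-\<^sup>k)\<close>, and the Taylor coefficients \<open>|G\<^sub>m| = |\<langle>u W z\<^sup>-\<^sup>m\<rangle>|\<close> are then
  of second order in \<open>n\<^sup>1\<^sup>-\<^sup>k\<close>. Derivatives in the exterior domain are controlled by Cauchy's inequality.

  Both facts on \<open>u\<close> follow by truncating the Fourier series of \<open>\<kappa>\<close> at \<open>T\<close> and shifting the contour to the radius
  \<open>exp (-A/T)\<close>, where the truncated \<open>u\<close> is bounded by \<open>exp (-c n/T)\<close>. No power of \<open>n\<close> is lost because the truncations
  \<open>T = T\<^sub>0 2\<^sup>i \<le> n\<close> are telescoped, each difference being \<open>O(n T\<^sup>-\<^sup>k)\<close> in \<open>L\<^sup>2\<close>.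
\<close>

section \<open>Means and square means over the circle\<close>

definition circ_mean :: "(real \<Rightarrow> complex) \<Rightarrow> complex" where
  "circ_mean f = integral {-pi..pi} f / complex_of_real (2 * pi)"

definition circ_l2 :: "(real \<Rightarrow> complex) \<Rightarrow> real" where
  "circ_l2 f = sqrt (integral {-pi..pi} (\<lambda>t. (norm (f t))\<^sup>2) / (2 * pi))"

text \<open>The companion of \<open>fourier_coeff\<close> for complex-valued functions;
  \<open>fourier_c_of_real\<close> identifies the two on real ones. It is also applied to difference
  quotients and to boundary values of analytic functions.\<close>

definition fourier_c :: "(real \<Rightarrow> complex) \<Rightarrow> int \<Rightarrow> complex" where
  "fourier_c f j = circ_mean (\<lambda>t. f t * cis (- of_int j * t))"

section \<open>Orthogonality of the exponentials and Bessel's inequality\<close>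

lemma has_vector_derivative_cis_mult [derivative_intros]:
  "((\<lambda>t. cis (a * t)) has_vector_derivative (\<i> * of_real a * cis (a * t))) (at t within S)"
proof -
  have "((\<lambda>t. exp (\<i> * of_real (a * t))) has_vector_derivative (\<i> * of_real a * exp (\<i> * of_real (a * t)))) (at t within S)"
    by (rule has_vector_derivative_eq_rhs[OF field_vector_diff_chain_within[where f="\<lambda>t. \<i> * of_real (a * t)" and g=exp and g'="exp (\<i> * of_real (a * t))" and f'="\<i> * of_real a", unfolded o_def]])
       (auto intro!: derivative_eq_intros simp: has_vector_derivative_def scaleR_conv_of_real)
  then show ?thesis by (simp add: cis_conv_exp)
qed

lemma continuous_on_cis_compose [continuous_intros]:
  "continuous_on S f \<Longrightarrow> continuous_on S (\<lambda>t. cis (f t))"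
  by (simp add: cis_conv_exp continuous_intros)

lemma has_integral_cis:
  fixes j :: int
  shows "((\<lambda>t. cis (of_int j * t)) has_integral (if j = 0 then 2 * pi else 0)) {-pi..pi}"
proof (cases "j = 0")
  case True
  show ?thesis using True has_integral_const_real[of "1::complex" "-pi" pi] by (simp add: scaleR_conv_of_real)
next
  case False
  have "((\<lambda>t. \<i> * of_real (of_int j) * cis (of_int j * t) / (\<i> * of_int j)) has_integral
          cis (of_int j * pi) / (\<i> * of_int j) - cis (of_int j * (-pi)) / (\<i> * of_int j)) {-pi..pi}"
    by (rule fundamental_theorem_of_calculus) (use pi_ge_zero in \<open>linarith\<close>, rule has_vector_derivative_divide[OF has_vector_derivative_cis_mult])
  moreover have "cis (of_int j * pi) = cis (of_int j * (-pi))"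
  proof -
    have "cis (of_int j * pi) = cis (of_int j * (-pi)) * cis (2 * pi * of_int j)"
      by (simp add: cis_mult algebra_simps)
    then show ?thesis by (simp add: cis_multiple_2pi)
  qed
  ultimately show ?thesis using False by simp
qed

lemma circ_mean_cis: "circ_mean (\<lambda>t. cis (of_int j * t)) = (if j = 0 then 1 else 0)"
  using has_integral_cis[of j, THEN integral_unique] by (simp add: circ_mean_def)

text \<open>Parseval for trigonometric polynomials: after multiplying out, orthogonality leaves only
  the diagonal terms.\<close>

lemma trig_poly_square_has_integral:
  fixes c :: "int \<Rightarrow> complex"
  assumes J: "finite J"
  shows "((\<lambda>t. (\<Sum>j\<in>J. c j * cis (of_int j * t)) * cnj (\<Sum>j\<in>J. c j * cis (of_int j * t))) has_integral
           complex_of_real (2 * pi * (\<Sum>j\<in>J. (norm (c j))\<^sup>2))) {-pi..pi}"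
proof -
  define s where "s t = (\<Sum>j\<in>J. c j * cis (of_int j * t))" for t
  define X where "X = (\<Sum>j\<in>J. (norm (c j))\<^sup>2)"
  have "((\<lambda>t. \<Sum>i\<in>J. \<Sum>j\<in>J. c i * cnj (c j) * cis (of_int (i - j) * t)) has_integral
     (\<Sum>i\<in>J. \<Sum>j\<in>J. c i * cnj (c j) * (if i - j = 0 then 2 * pi else 0))) {-pi..pi}"
    by (intro has_integral_sum J has_integral_mult_right has_integral_cis)
  moreover have "(\<Sum>i\<in>J. \<Sum>j\<in>J. c i * cnj (c j) * (if i - j = 0 then 2 * pi else 0)) = complex_of_real (2 * pi * X)"
  proof -
    have "(\<Sum>j\<in>J. c i * cnj (c j) * (if i - j = 0 then 2 * pi else 0)) = complex_of_real (2 * pi * (norm (c i))\<^sup>2)" if "i \<in> J" for i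
    proof -
      have "(\<Sum>j\<in>J. c i * cnj (c j) * (if i - j = 0 then 2 * pi else 0)) = (\<Sum>j\<in>J. if j = i then c i * cnj (c i) * (2 * pi) else 0)"
        by (intro sum.cong) auto
      also have "\<dots> = (c i * cnj (c i)) * (2 * pi)" using J that by simp
      finally show ?thesis by (simp only: complex_norm_square[symmetric]) simp
    qed
    then show ?thesis by (simp add: X_def sum_distrib_left)
  qed
  moreover have "(\<Sum>i\<in>J. \<Sum>j\<in>J. c i * cnj (c j) * cis (of_int (i - j) * t)) = s t * cnj (s t)" for t
    by (simp add: s_def sum_product cis_cnj left_diff_distrib cis_divide[symmetric] cis_mult[symmetric] field_simps
        flip: cis_inverse)
  ultimately have "((\<lambda>t. s t * cnj (s t)) has_integral complex_of_real (2 * pi * X)) {-pi..pi}"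
    by simp
  then show ?thesis by (simp only: s_def X_def)
qed

text \<open>The integral of \<open>|g - s|^2\<close> is nonnegative, where \<open>s\<close> is the
  partial Fourier sum over \<open>J\<close>; expanding it gives the claim. Only integrability is
  asked for, because \<open>lipschitz_fourier_sum\<close> applies this to a quotient that is bounded
  and measurable but possibly discontinuous.\<close>

lemma bessel_integrable:
  fixes g :: "real \<Rightarrow> complex" and J :: "int set"
  assumes int: "\<And>j::int. (\<lambda>t. g t * cis (of_int j * t)) integrable_on {-pi..pi}"
    and sq: "(\<lambda>t. (norm (g t))\<^sup>2) integrable_on {-pi..pi}" and J: "finite J"
  shows "(\<Sum>j\<in>J. (norm (fourier_c g j))\<^sup>2) \<le> (circ_l2 g)\<^sup>2"
proof -
  define c where "c = fourier_c g"
  define s where "s t = (\<Sum>j\<in>J. c j * cis (of_int j * t))" for t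
  define X where "X = (\<Sum>j\<in>J. (norm (c j))\<^sup>2)"
  have gj: "((\<lambda>t. g t * cis (- of_int j * t)) has_integral 2 * pi * c j) {-pi..pi}" for j
    using int[of "-j", THEN integrable_integral] by (simp add: c_def fourier_c_def circ_mean_def)
  have "((\<lambda>t. \<Sum>j\<in>J. cnj (c j) * (g t * cis (- of_int j * t))) has_integral (\<Sum>j\<in>J. cnj (c j) * (2 * pi * c j))) {-pi..pi}"
    by (intro has_integral_sum J has_integral_mult_right gj)
  moreover have "(\<Sum>j\<in>J. cnj (c j) * (2 * pi * c j)) = complex_of_real (2 * pi * X)"
  proof -
    have "cnj (c j) * (2 * pi * c j) = complex_of_real (2 * pi * (norm (c j))\<^sup>2)" for j
    proof -
      have "cnj (c j) * (2 * pi * c j) = 2 * pi * (c j * cnj (c j))" by simp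
      then show ?thesis by (simp only: complex_norm_square[symmetric]) simp
    qed
    then have "(\<Sum>j\<in>J. cnj (c j) * (2 * pi * c j)) = (\<Sum>j\<in>J. complex_of_real (2 * pi * (norm (c j))\<^sup>2))"
      by (intro sum.cong refl)
    then show ?thesis by (simp add: X_def sum_distrib_left)
  qed
  moreover have "(\<Sum>j\<in>J. cnj (c j) * (g t * cis (- of_int j * t))) = g t * cnj (s t)" for t
    by (simp add: s_def sum_distrib_left cis_cnj algebra_simps)
  ultimately have gs: "((\<lambda>t. g t * cnj (s t)) has_integral complex_of_real (2 * pi * X)) {-pi..pi}"
    by simp
  have ss: "((\<lambda>t. s t * cnj (s t)) has_integral complex_of_real (2 * pi * X)) {-pi..pi}"
    unfolding s_def X_def by (rule trig_poly_square_has_integral[OF J])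
  note Rgs = has_integral_linear[OF gs bounded_linear_Re, unfolded o_def]
  note Rss = has_integral_linear[OF ss bounded_linear_Re, unfolded o_def]
  have "((\<lambda>t. (norm (g t))\<^sup>2 - 2 * Re (g t * cnj (s t)) + Re (s t * cnj (s t))) has_integral
      integral {-pi..pi} (\<lambda>t. (norm (g t))\<^sup>2) - 2 * Re (complex_of_real (2 * pi * X)) + Re (complex_of_real (2 * pi * X))) {-pi..pi}"
    by (intro has_integral_add has_integral_diff has_integral_mult_right Rgs Rss integrable_integral sq)
  moreover have "(norm (g t))\<^sup>2 - 2 * Re (g t * cnj (s t)) + Re (s t * cnj (s t)) = (norm (g t - s t))\<^sup>2" for t
    unfolding cmod_power2 by (simp add: power2_eq_square algebra_simps)
  ultimately have "((\<lambda>t. (norm (g t - s t))\<^sup>2) has_integral integral {-pi..pi} (\<lambda>t. (norm (g t))\<^sup>2) - 2 * pi * X) {-pi..pi}"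
    by (simp add: mult.assoc)
  then have "0 \<le> integral {-pi..pi} (\<lambda>t. (norm (g t))\<^sup>2) - 2 * pi * X"
    by (rule has_integral_nonneg) simp
  moreover have "(circ_l2 g)\<^sup>2 = integral {-pi..pi} (\<lambda>t. (norm (g t))\<^sup>2) / (2 * pi)"
    unfolding circ_l2_def by (intro real_sqrt_pow2 divide_nonneg_nonneg integral_nonneg sq) auto
  ultimately have "2 * pi * X \<le> 2 * pi * (circ_l2 g)\<^sup>2" by simp
  then show ?thesis by (simp add: X_def c_def)
qed

section \<open>The square norm on continuous functions\<close>

lemma integrable_cont: "continuous_on {-pi..pi} f \<Longrightarrow> (f :: real \<Rightarrow> 'a::banach) integrable_on {-pi..pi}"
  by (rule integrable_continuous_interval)

lemma circ_l2_sq: 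
  "continuous_on {-pi..pi} f \<Longrightarrow> (circ_l2 f)\<^sup>2 = integral {-pi..pi} (\<lambda>t. (norm (f t))\<^sup>2) / (2 * pi)"
  unfolding circ_l2_def by (intro real_sqrt_pow2 divide_nonneg_nonneg integral_nonneg integrable_cont continuous_intros) auto

lemma circ_l2_nonneg: "continuous_on {-pi..pi} f \<Longrightarrow> 0 \<le> circ_l2 f"
  unfolding circ_l2_def by (intro real_sqrt_ge_zero divide_nonneg_nonneg integral_nonneg integrable_cont continuous_intros) auto

lemma bessel:
  fixes g :: "real \<Rightarrow> complex" and J :: "int set"
  assumes "continuous_on {-pi..pi} g" "finite J"
  shows "(\<Sum>j\<in>J. (norm (fourier_c g j))\<^sup>2) \<le> (circ_l2 g)\<^sup>2"
  by (rule bessel_integrable) (auto intro!: assms integrable_cont continuous_intros)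

lemma circ_l2_mono:
  assumes "continuous_on {-pi..pi} f" "continuous_on {-pi..pi} g"
    "\<And>t. t \<in> {-pi..pi} \<Longrightarrow> norm (f t) \<le> norm (g t)"
  shows "circ_l2 f \<le> circ_l2 g"
  unfolding circ_l2_def
  by (intro real_sqrt_le_mono divide_right_mono integral_le integrable_cont continuous_intros assms power_mono) auto

lemma circ_l2_cmult:
  "circ_l2 (\<lambda>t. c * f t) = norm c * circ_l2 f"
  unfolding circ_l2_def by (simp add: norm_mult power_mult_distrib real_sqrt_mult real_sqrt_divide)

lemma circ_l2_const: "circ_l2 (\<lambda>t. c) = norm c"
  unfolding circ_l2_def by simp

lemma circ_l2_bound:
  assumes "continuous_on {-pi..pi} f" "\<And>t. t \<in> {-pi..pi} \<Longrightarrow> norm (f t) \<le> B" "0 \<le> B"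
  shows "circ_l2 f \<le> B"
  using circ_l2_mono[OF assms(1), of "\<lambda>t. of_real B"] assms by (simp add: circ_l2_const)

lemma circ_mean_norm_le:
  assumes "continuous_on {-pi..pi} f" "continuous_on {-pi..pi} h" "\<And>t. t \<in> {-pi..pi} \<Longrightarrow> norm (f t) \<le> h t"
  shows "norm (circ_mean f) \<le> integral {-pi..pi} h / (2 * pi)"
proof -
  have "norm (integral {-pi..pi} f) \<le> integral {-pi..pi} h"
    by (rule integral_norm_bound_integral) (use assms in \<open>auto intro: integrable_cont\<close>)
  then show ?thesis by (simp add: circ_mean_def norm_divide divide_right_mono)
qed

text \<open>Cauchy-Schwarz, obtained by integrating a pointwise arithmetic-geometric inequality
  weighted by the two norms.\<close>

lemma integral_norm_mult_le:
  fixes f g :: "real \<Rightarrow> complex"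
  assumes [continuous_intros]: "continuous_on {-pi..pi} f" "continuous_on {-pi..pi} g"
  shows "integral {-pi..pi} (\<lambda>t. norm (f t) * norm (g t)) / (2 * pi) \<le> circ_l2 f * circ_l2 g"
proof -
  \<comment> \<open>Strict majorants \<open>a\<close>, \<open>b\<close> of the norms are positive,
    so they may be divided by even if a norm is zero; they are sent to the norms at the end.\<close>
  have *: "integral {-pi..pi} (\<lambda>t. norm (f t) * norm (g t)) / (2 * pi) \<le> a * b"
    if ab: "a > circ_l2 f" "b > circ_l2 g" for a b
  proof -
    have pos: "a > 0" "b > 0" using ab circ_l2_nonneg assms by (meson le_less_trans)+
    have "integral {-pi..pi} (\<lambda>t. norm (f t) * norm (g t)) \<le>
       integral {-pi..pi} (\<lambda>t. (b / (2 * a)) * (norm (f t))\<^sup>2 + (a / (2 * b)) * (norm (g t))\<^sup>2)"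
    proof (intro integral_le integrable_cont continuous_intros)
      fix t
      have "0 \<le> (b * norm (f t) - a * norm (g t))\<^sup>2 / (2 * a * b)" using pos by simp
      also have "\<dots> = (b / (2 * a)) * (norm (f t))\<^sup>2 + (a / (2 * b)) * (norm (g t))\<^sup>2 - norm (f t) * norm (g t)"
        using pos by (simp add: power2_eq_square field_simps)
      finally show "norm (f t) * norm (g t) \<le> (b / (2 * a)) * (norm (f t))\<^sup>2 + (a / (2 * b)) * (norm (g t))\<^sup>2" by simp
    qed
    also have "\<dots> = (b / (2 * a)) * integral {-pi..pi} (\<lambda>t. (norm (f t))\<^sup>2) + (a / (2 * b)) * integral {-pi..pi} (\<lambda>t. (norm (g t))\<^sup>2)"
      using pos by (subst integral_add) (auto intro!: integrable_cont continuous_intros)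
    also have "\<dots> = 2 * pi * ((b / (2 * a)) * (circ_l2 f)\<^sup>2 + (a / (2 * b)) * (circ_l2 g)\<^sup>2)"
      by (simp add: circ_l2_sq assms field_simps)
    finally have "integral {-pi..pi} (\<lambda>t. norm (f t) * norm (g t)) / (2 * pi) \<le> (b / (2 * a)) * (circ_l2 f)\<^sup>2 + (a / (2 * b)) * (circ_l2 g)\<^sup>2"
      by (simp add: field_simps)
    also have "\<dots> \<le> (b / (2 * a)) * a\<^sup>2 + (a / (2 * b)) * b\<^sup>2"
      using ab pos circ_l2_nonneg assms by (intro add_mono mult_left_mono power_mono) (auto intro: less_imp_le)
    also have "\<dots> = a * b" using pos by (simp add: power2_eq_square)
    finally show ?thesis .
  qed
  have "((\<lambda>e. (circ_l2 f + e) * (circ_l2 g + e)) \<longlongrightarrow> (circ_l2 f + 0) * (circ_l2 g + 0)) (at_right 0)"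
    by (intro tendsto_intros)
  moreover have "\<forall>\<^sub>F e in at_right 0. integral {-pi..pi} (\<lambda>t. norm (f t) * norm (g t)) / (2 * pi) \<le> (circ_l2 f + e) * (circ_l2 g + e)"
    using eventually_at_right_less[of 0] by eventually_elim (rule *, auto)
  ultimately show ?thesis
    using tendsto_lowerbound by (metis add.right_neutral trivial_limit_at_right_real)
qed

lemma circ_mean_mult_le:
  assumes [continuous_intros]: "continuous_on {-pi..pi} f" "continuous_on {-pi..pi} g"
  shows "norm (circ_mean (\<lambda>t. f t * g t)) \<le> circ_l2 f * circ_l2 g"
  by (rule order_trans[OF circ_mean_norm_le integral_norm_mult_le])
     (auto intro!: continuous_intros simp: norm_mult assms)

lemma circ_l2_triangle:
  assumes [continuous_intros]: "continuous_on {-pi..pi} f" "continuous_on {-pi..pi} g"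
  shows "circ_l2 (\<lambda>t. f t + g t) \<le> circ_l2 f + circ_l2 g"
proof -
  have "integral {-pi..pi} (\<lambda>t. (norm (f t + g t))\<^sup>2) \<le> 
    integral {-pi..pi} (\<lambda>t. (norm (f t))\<^sup>2 + (2 * (norm (f t) * norm (g t)) + (norm (g t))\<^sup>2))"
  proof (intro integral_le integrable_cont continuous_intros)
    fix t
    have "(norm (f t + g t))\<^sup>2 \<le> (norm (f t) + norm (g t))\<^sup>2"
      by (intro power_mono norm_triangle_ineq norm_ge_zero)
    then show "(norm (f t + g t))\<^sup>2 \<le> (norm (f t))\<^sup>2 + (2 * (norm (f t) * norm (g t)) + (norm (g t))\<^sup>2)"
      by (simp add: power2_eq_square algebra_simps)
  qed
  also have "\<dots> = integral {-pi..pi} (\<lambda>t. (norm (f t))\<^sup>2) + (2 * integral {-pi..pi} (\<lambda>t. norm (f t) * norm (g t)) + integral {-pi..pi} (\<lambda>t. (norm (g t))\<^sup>2))"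
    by (simp only: integral_add[where f="\<lambda>t. (norm (f t))\<^sup>2"] integral_add[where g="\<lambda>t. (norm (g t))\<^sup>2"] integral_mult_right
        integrable_cont continuous_intros)
  finally have "(circ_l2 (\<lambda>t. f t + g t))\<^sup>2 \<le> (circ_l2 f)\<^sup>2 + (2 * (integral {-pi..pi} (\<lambda>t. norm (f t) * norm (g t)) / (2 * pi)) + (circ_l2 g)\<^sup>2)"
    by (simp add: circ_l2_sq assms continuous_intros field_simps)
  also have "\<dots> \<le> (circ_l2 f)\<^sup>2 + (2 * (circ_l2 f * circ_l2 g) + (circ_l2 g)\<^sup>2)"
    by (intro add_mono mult_left_mono integral_norm_mult_le assms) auto
  also have "\<dots> = (circ_l2 f + circ_l2 g)\<^sup>2" by (simp add: power2_eq_square algebra_simps)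
  finally show ?thesis using circ_l2_nonneg assms by (meson add_nonneg_nonneg power2_le_imp_le)
qed

lemma circ_mean_add:
  assumes "continuous_on {-pi..pi} f" "continuous_on {-pi..pi} g"
  shows "circ_mean (\<lambda>t. f t + g t) = circ_mean f + circ_mean g"
  unfolding circ_mean_def by (subst integral_add) (auto simp: assms integrable_cont add_divide_distrib)

lemma circ_mean_diff:
  assumes "continuous_on {-pi..pi} f" "continuous_on {-pi..pi} g"
  shows "circ_mean (\<lambda>t. f t - g t) = circ_mean f - circ_mean g"
  unfolding circ_mean_def by (subst integral_diff) (auto simp: assms integrable_cont diff_divide_distrib)

lemma circ_mean_cmult: "circ_mean (\<lambda>t. c * f t) = c * circ_mean f"
  unfolding circ_mean_def by simp

lemma circ_mean_cnj: "circ_mean (\<lambda>t. cnj (f t)) = cnj (circ_mean f)"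
  unfolding circ_mean_def by (simp add: integral_cnj)

lemma circ_l2_square_eq_mean:
  assumes "continuous_on {-pi..pi} f"
  shows "circ_mean (\<lambda>t. f t * cnj (f t)) = of_real ((circ_l2 f)\<^sup>2)"
proof -
  have "integral {-pi..pi} (\<lambda>t. f t * cnj (f t)) = integral {-pi..pi} (\<lambda>t. complex_of_real ((norm (f t))\<^sup>2))"
    by (simp only: complex_norm_square)
  also have "\<dots> = of_real (integral {-pi..pi} (\<lambda>t. (norm (f t))\<^sup>2))"
    by (rule integral_unique, rule has_integral_of_real, rule integrable_integral)
       (auto intro!: integrable_cont continuous_intros assms)
  finally show ?thesis by (simp add: circ_mean_def circ_l2_sq assms)
qed

section \<open>Fourier series of Lipschitz functions\<close>

text \<open>With an antiderivative \<open>F\<close> on \<open>[-pi, 3 pi]\<close>, the integral over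
  the shifted window is \<open>F (pi + c) - F (-pi + c)\<close>, whose derivative in
  \<open>c\<close> vanishes by periodicity.\<close>

lemma circ_mean_shift:
  fixes f :: "real \<Rightarrow> complex"
  assumes cont: "continuous_on UNIV f" and per: "\<And>x. f (x + 2 * pi) = f x" and h: "0 \<le> h" "h \<le> 2 * pi"
  shows "circ_mean (\<lambda>t. f (t + h)) = circ_mean f"
proof -
  obtain F where F: "\<And>x. x \<in> {-pi..3*pi} \<Longrightarrow> (F has_vector_derivative f x) (at x within {-pi..3*pi})"
    using antiderivative_continuous[of "-pi" "3*pi" f] cont continuous_on_subset by blast
  have sh: "((\<lambda>x. F (x + c)) has_vector_derivative f (x + c)) (at x within {a..b})"
    if "x \<in> {a..b}" "a + c \<ge> -pi" "b + c \<le> 3 * pi" for x a b c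
  proof -
    have "(F has_vector_derivative f (x + c)) (at (x + c) within (\<lambda>x. x + c) ` {a..b})"
      by (rule has_vector_derivative_within_subset[OF F]) (use that in auto)
    then have "((F \<circ> (\<lambda>x. x + c)) has_vector_derivative 1 *\<^sub>R f (x + c)) (at x within {a..b})"
      by (intro vector_diff_chain_within) (auto intro!: derivative_eq_intros)
    then show ?thesis by (simp add: o_def)
  qed
  have I: "integral {-pi..pi} (\<lambda>t. f (t + c)) = F (pi + c) - F (-pi + c)" if "0 \<le> c" "c \<le> 2 * pi" for c
    by (rule integral_unique, rule fundamental_theorem_of_calculus)
       (use that pi_ge_zero in \<open>auto intro!: sh\<close>)
  have "((\<lambda>c. F (c + pi) - F (c + (-pi))) has_vector_derivative f (c + pi) - f (c + (- pi))) (at c within {0..2*pi})"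
    if "c \<in> {0..2*pi}" for c
    by (intro has_vector_derivative_diff sh) (use that in auto)
  moreover have "f (c + pi) = f (c + (- pi))" for c using per[of "c + (- pi)"] by (simp add: add.commute)
  ultimately have "((\<lambda>c. F (c + pi) - F (c + (-pi))) has_vector_derivative 0) (at c within {0..2*pi})"
    if "c \<in> {0..2*pi}" for c using that by simp
  then obtain k where "\<And>c. c \<in> {0..2*pi} \<Longrightarrow> F (c + pi) - F (c + (-pi)) = k"
    using has_vector_derivative_zero_constant[of "{0..2*pi}" "\<lambda>c. F (c + pi) - F (c + (-pi))"] by auto
  from this[of 0] this[of h] I[of h] I[of 0] h show ?thesis by (simp add: circ_mean_def add.commute)
qed

lemma lipschitz_imp_continuous:
  fixes f :: "real \<Rightarrow> complex"
  assumes "\<And>x y. norm (f x - f y) \<le> L * \<bar>x - y\<bar>"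
  shows "continuous_on S f"
proof -
  have "\<bar>L\<bar>-lipschitz_on S f"
    by (rule lipschitz_onI)
       (use assms in \<open>auto simp: dist_norm intro: order_trans mult_right_mono\<close>, meson abs_ge_self abs_ge_zero assms dual_order.trans mult_right_mono)
  then show ?thesis by (rule lipschitz_on_continuous_on)
qed

text \<open>Bessel's inequality for the difference quotients \<open>(f (t + h) - f t) / h\<close>, as \<open>h \<rightarrow> 0\<close>.\<close>
lemma lipschitz_fourier_bound:
  fixes f :: "real \<Rightarrow> complex"
  assumes per: "\<And>x. f (x + 2 * pi) = f x" and lip: "\<And>x y. norm (f x - f y) \<le> L * \<bar>x - y\<bar>"
    and J: "finite J"
  shows "(\<Sum>j\<in>J. (\<bar>of_int j\<bar> * norm (fourier_c f j))\<^sup>2) \<le> L\<^sup>2"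
proof -
  note cont = lipschitz_imp_continuous[of f, OF lip]
  have cont2 [continuous_intros]: "continuous_on S (\<lambda>t. f (t + h))" for h S
    by (rule continuous_on_compose2[OF cont[of UNIV]]) (auto intro!: continuous_intros)
  have L: "L \<ge> 0" using order_trans[OF norm_ge_zero lip[of 0 1]] by simp
  \<comment> \<open>Translation by \<open>h\<close> multiplies the coefficient at \<open>j\<close>
    by \<open>cis (j h)\<close>, since \<open>circ_mean_shift\<close> moves the window back.\<close>
  have coeff: "fourier_c (\<lambda>t. f (t + h) - f t) j = (cis (of_int j * h) - 1) * fourier_c f j"
    if h: "0 \<le> h" "h \<le> 2 * pi" for h j
  proof -
    define F where "F t = f t * cis (- of_int j * t)" for t
    have "cis (- of_int j * (x + 2 * pi)) = cis (- of_int j * x) * cis (2 * pi * of_int (- j))" for x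
      by (simp add: cis_mult algebra_simps)
    then have per': "F (x + 2 * pi) = F x" for x by (simp add: F_def per cis_multiple_2pi del: of_int_minus)
    have "fourier_c (\<lambda>t. f (t + h) - f t) j = circ_mean (\<lambda>t. cis (of_int j * h) * F (t + h) - F t)"
      by (simp add: fourier_c_def F_def algebra_simps cis_mult)
    also have "\<dots> = cis (of_int j * h) * circ_mean (\<lambda>t. F (t + h)) - circ_mean F"
      unfolding F_def by (subst circ_mean_diff) (auto intro!: continuous_intros cont simp: circ_mean_cmult)
    also have "circ_mean (\<lambda>t. F (t + h)) = circ_mean F"
      by (rule circ_mean_shift[of F, OF _ per' h]) (auto simp: F_def intro!: continuous_intros cont)
    also have "circ_mean F = fourier_c f j" by (simp add: F_def[abs_def] fourier_c_def)
    finally show ?thesis by (simp add: left_diff_distrib)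
  qed
  have ineq: "(\<Sum>j\<in>J. (norm ((cis (of_int j * h) - 1) /\<^sub>R h) * norm (fourier_c f j))\<^sup>2) \<le> L\<^sup>2"
    if h: "0 < h" "h \<le> 2 * pi" for h
  proof -
    have "(\<Sum>j\<in>J. (norm (fourier_c (\<lambda>t. f (t + h) - f t) j))\<^sup>2) \<le> (circ_l2 (\<lambda>t. f (t + h) - f t))\<^sup>2"
      by (intro bessel J continuous_intros cont)
    also have "\<dots> \<le> (L * h)\<^sup>2"
    proof (intro power_mono circ_l2_bound circ_l2_nonneg continuous_intros cont)
      show "norm (f (t + h) - f t) \<le> L * h" for t using lip[of "t + h" t] h by simp
    qed (use h L in auto)
    finally have "(\<Sum>j\<in>J. (norm (cis (of_int j * h) - 1) * norm (fourier_c f j))\<^sup>2) \<le> (L * h)\<^sup>2"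
      using h by (simp add: coeff norm_mult)
    then have "(\<Sum>j\<in>J. (norm (cis (of_int j * h) - 1) * norm (fourier_c f j))\<^sup>2) / h\<^sup>2 \<le> L\<^sup>2"
      using h by (simp add: divide_le_eq power_mult_distrib)
    moreover have "norm ((cis (of_int j * h) - 1) /\<^sub>R h) = norm (cis (of_int j * h) - 1) / h" for j
      using h by (simp only: norm_scaleR) (simp add: field_simps)
    ultimately show ?thesis by (simp add: sum_divide_distrib power_mult_distrib power_divide)
  qed
  \<comment> \<open>The multiplier divided by \<open>h\<close> tends to a number of modulus
    \<open>|j|\<close>; this is where the weight comes from. As \<open>J\<close> is finite, the
    limit passes through the sum.\<close>
  have lim: "((\<lambda>h. (cis (of_int j * h) - 1) /\<^sub>R h) \<longlongrightarrow> \<i> * of_real (of_int j) * cis (of_int j * 0)) (at_right 0)" for j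
  proof -
    have "((\<lambda>z::complex. exp (\<i> * of_int j * z)) has_field_derivative (\<i> * of_int j)) (at 0)"
      by (auto intro!: derivative_eq_intros)
    then have 1: "((\<lambda>z::complex. (exp (\<i> * of_int j * z) - 1) / z) \<longlongrightarrow> \<i> * of_int j) (at 0)"
      by (simp add: has_field_derivative_iff)
    have 2: "filterlim complex_of_real (at 0) (at_right 0)"
      unfolding filterlim_at using eventually_at_right_less[of "0::real"]
      by (auto elim!: eventually_mono intro!: tendsto_eq_intros)
    show ?thesis using filterlim_compose[OF 1 2]
      by (simp add: cis_conv_exp scaleR_conv_of_real divide_inverse mult_ac)
  qed
  have "((\<lambda>h. \<Sum>j\<in>J. (norm ((cis (of_int j * h) - 1) /\<^sub>R h) * norm (fourier_c f j))\<^sup>2) \<longlongrightarrow> 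
     (\<Sum>j\<in>J. (norm (\<i> * of_real (of_int j) * cis (of_int j * 0)) * norm (fourier_c f j))\<^sup>2)) (at_right 0)"
    by (intro tendsto_intros lim)
  moreover have "\<forall>\<^sub>F h in at_right 0. (\<Sum>j\<in>J. (norm ((cis (of_int j * h) - 1) /\<^sub>R h) * norm (fourier_c f j))\<^sup>2) \<le> L\<^sup>2"
    using eventually_at_right_real[OF pi_gt_zero] by eventually_elim (use pi_gt_zero in \<open>auto simp del: norm_scaleR intro!: ineq\<close>)
  ultimately have "(\<Sum>j\<in>J. (norm (\<i> * of_real (of_int j) * cis (of_int j * 0)) * norm (fourier_c f j))\<^sup>2) \<le> L\<^sup>2"
    by (intro tendsto_upperbound) auto
  then show ?thesis by (simp add: norm_mult)
qed

text \<open>With \<open>c = j + 1\<close>, \<open>2 b <= (c b)^2 + 1/c^2\<close>, and both terms on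
  the right are summable.\<close>

lemma summable_of_square_bound:
  fixes b :: "nat \<Rightarrow> real"
  assumes "\<And>j. b j \<ge> 0" and bd: "\<And>M. (\<Sum>j<M. (real (Suc j) * b j)\<^sup>2) \<le> B"
  shows "summable b"
proof (rule summable_comparison_test')
  show "summable (\<lambda>j. (real (Suc j) * b j)\<^sup>2 + 1 / (real (Suc j))\<^sup>2)"
  proof (rule summable_add)
    show "summable (\<lambda>j. (real (Suc j) * b j)\<^sup>2)"
      by (rule bounded_imp_summable[where B=B]) (use bd[of "Suc _"] in \<open>auto simp: lessThan_Suc_atMost\<close>)
    have "summable (\<lambda>n. inverse ((real n)\<^sup>2))"
      by (rule inverse_power_summable) simp
    then show "summable (\<lambda>j. 1 / (real (Suc j))\<^sup>2)"
      by (subst (asm) summable_Suc_iff[symmetric]) (simp add: field_simps)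
  qed
  show "norm (b j) \<le> (real (Suc j) * b j)\<^sup>2 + 1 / (real (Suc j))\<^sup>2" for j
  proof -
    have "0 \<le> (real (Suc j) * b j - 1 / real (Suc j))\<^sup>2" by simp
    also have "\<dots> = (real (Suc j) * b j)\<^sup>2 + 1 / (real (Suc j))\<^sup>2 - 2 * b j"
      by (simp add: power2_diff power_divide del: of_nat_Suc)
    finally show ?thesis using assms(1)[of j] by simp
  qed
qed

lemma lipschitz_fourier_summable:
  fixes f :: "real \<Rightarrow> complex"
  assumes per: "\<And>x. f (x + 2 * pi) = f x" and lip: "\<And>x y. norm (f x - f y) \<le> L * \<bar>x - y\<bar>"
  shows "summable (\<lambda>j. norm (fourier_c f (int j)))" "summable (\<lambda>j. norm (fourier_c f (- int (Suc j))))"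
proof -
  have inj: "inj_on (\<lambda>j. int (Suc j)) A" "inj_on (\<lambda>j. - int (Suc j)) A" for A by (auto simp: inj_on_def)
  have "(\<Sum>j<M. (real (Suc j) * norm (fourier_c f (int (Suc j))))\<^sup>2) \<le> L\<^sup>2" for M
    using lipschitz_fourier_bound[OF per lip, of "(\<lambda>j. int (Suc j)) ` {..<M}"]
    by (simp add: sum.reindex[OF inj(1)] o_def del: of_nat_Suc)
  then have "summable (\<lambda>j. norm (fourier_c f (int (Suc j))))" by (rule summable_of_square_bound[rotated]) simp
  then show "summable (\<lambda>j. norm (fourier_c f (int j)))" by (subst (asm) summable_Suc_iff)
  have "(\<Sum>j<M. (real (Suc j) * norm (fourier_c f (- int (Suc j))))\<^sup>2) \<le> L\<^sup>2" for M
    using lipschitz_fourier_bound[OF per lip, of "(\<lambda>j. - int (Suc j)) ` {..<M}"]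
    by (simp add: sum.reindex[OF inj(2)] o_def del: of_nat_Suc)
  then show "summable (\<lambda>j. norm (fourier_c f (- int (Suc j))))" by (rule summable_of_square_bound[rotated]) simp
qed

section \<open>Pointwise convergence of Fourier series of Lipschitz functions\<close>

lemma abs_le_norm_cis_minus_1: "\<exists>K>0. \<forall>t. \<bar>t\<bar> \<le> pi \<longrightarrow> \<bar>t\<bar> \<le> K * norm (cis t - 1)"
proof -
  have c1: "cos (1::real) < 1" using cos_monotone_0_pi[of 0 1] pi_gt3 by simp
  have c2: "cos (1::real) > 0" using cos_gt_zero_pi[of 1] pi_gt3 by simp
  \<comment> \<open>For \<open>|t| <= 1\<close> the chord is at least
    \<open>|sin t| >= |t| cos 1\<close>; for \<open>1 <= |t| <= pi\<close> it is at least
    \<open>1 - cos 1\<close>. \<open>K\<close> serves both ranges.\<close>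
  define K where "K = max (1 / cos 1) (pi / (1 - cos 1))"
  have K: "K > 0" "K * cos 1 \<ge> 1" "K * (1 - cos 1) \<ge> pi" using c1 c2 by (auto simp: K_def max_def field_simps)
  have s: "x * cos 1 \<le> sin x" if x: "0 < x" "x \<le> 1" for x :: real
  proof -
    obtain y where y: "0 < y" "y < x" "sin x - sin 0 = (x - 0) * cos y"
      using MVT2[of 0 x sin cos] x by (auto intro: DERIV_sin)
    have "cos 1 \<le> cos y" using y x pi_gt3 by (intro cos_monotone_0_pi_le) auto
    then show ?thesis using y x by (simp add: mult_left_mono)
  qed
  have "\<bar>t\<bar> \<le> K * norm (cis t - 1)" if t: "\<bar>t\<bar> \<le> pi" for t
  proof (cases "\<bar>t\<bar> \<le> 1")
    case True
    have "\<bar>t\<bar> * cos 1 \<le> \<bar>sin t\<bar>"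
    proof (cases "t = 0")
      case False
      then show ?thesis using s[of "\<bar>t\<bar>"] True by (cases "t > 0") auto
    qed simp
    also have "\<dots> = \<bar>Im (cis t - 1)\<bar>" by simp
    also have "\<dots> \<le> norm (cis t - 1)" by (rule abs_Im_le_cmod)
    finally have "K * (\<bar>t\<bar> * cos 1) \<le> K * norm (cis t - 1)" using K by (intro mult_left_mono) auto
    moreover have "\<bar>t\<bar> * 1 \<le> \<bar>t\<bar> * (K * cos 1)" using K by (intro mult_left_mono) auto
    ultimately show ?thesis by (simp add: mult_ac)
  next
    case False
    then have "cos \<bar>t\<bar> \<le> cos 1" using t by (intro cos_monotone_0_pi_le) auto
    then have "1 - cos 1 \<le> \<bar>Re (cis t - 1)\<bar>" by simp
    also have "\<dots> \<le> norm (cis t - 1)" by (rule abs_Re_le_cmod)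
    finally have "K * (1 - cos 1) \<le> K * norm (cis t - 1)" using K by (intro mult_left_mono) auto
    then show ?thesis using K(3) t by linarith
  qed
  then show ?thesis using K(1) by (intro exI[of _ K]) auto
qed

lemma periodic_int:
  fixes f :: "real \<Rightarrow> 'a"
  assumes "\<And>x. f (x + 2 * pi) = f x"
  shows "f (x + 2 * pi * of_int l) = f x"
proof -
  have 1: "f (x + 2 * pi * of_nat n) = f x" for n x
    by (induction n) (use assms[of "x + 2 * pi * of_nat _"] in \<open>auto simp: algebra_simps\<close>)
  show ?thesis
  proof (cases l rule: int_cases2)
    case (nonneg n) then show ?thesis using 1 by simp
  next
    case (nonpos n) then show ?thesis using 1[of "x - 2 * pi * of_nat n" n] by simp
  qed
qed

text \<open>Periodicity reduces \<open>t - x\<close> to \<open>[-pi, pi]\<close>, where arc and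
  chord are comparable. This bounds the quotient \<open>g\<close> in
  \<open>lipschitz_fourier_sum\<close>.\<close>

lemma lipschitz_periodic_le_cis:
  fixes f :: "real \<Rightarrow> complex"
  assumes per: "\<And>x. f (x + 2 * pi) = f x" and lip: "\<And>x y. norm (f x - f y) \<le> L * \<bar>x - y\<bar>"
  shows "\<exists>C\<ge>0. \<forall>t x. norm (f t - f x) \<le> C * norm (cis (t - x) - 1)"
proof -
  obtain K where K: "K > 0" "\<And>t. \<bar>t\<bar> \<le> pi \<Longrightarrow> \<bar>t\<bar> \<le> K * norm (cis t - 1)"
    using abs_le_norm_cis_minus_1 by blast
  have L: "L \<ge> 0" using order_trans[OF norm_ge_zero lip[of 0 1]] by simp
  have "norm (f t - f x) \<le> (L * K) * norm (cis (t - x) - 1)" for t x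
  proof -
    define l where "l = round ((t - x) / (2 * pi))"
    define d where "d = t - x - 2 * pi * of_int l"
    have "\<bar>of_int l - (t - x) / (2 * pi)\<bar> \<le> 1 / 2" unfolding l_def by (rule of_int_round_abs_le)
    then have "2 * pi * \<bar>of_int l - (t - x) / (2 * pi)\<bar> \<le> 2 * pi * (1 / 2)" by (intro mult_left_mono) auto
    moreover have "2 * pi * \<bar>of_int l - (t - x) / (2 * pi)\<bar> = \<bar>d\<bar>"
    proof -
      have "2 * pi * \<bar>of_int l - (t - x) / (2 * pi)\<bar> = \<bar>2 * pi * (of_int l - (t - x) / (2 * pi))\<bar>"
        by (simp add: abs_mult)
      also have "2 * pi * (of_int l - (t - x) / (2 * pi)) = - d" by (simp add: d_def field_simps)
      finally show ?thesis by simp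
    qed
    ultimately have d: "\<bar>d\<bar> \<le> pi" by simp
    have t: "t = (x + d) + 2 * pi * of_int l" by (simp add: d_def)
    have "f t = f (x + d)" by (subst t) (rule periodic_int[of f, OF per])
    moreover have "cis (t - x) = cis d"
    proof -
      have "cis (t - x) = cis d * cis (2 * pi * of_int l)" by (simp only: cis_mult) (simp add: d_def)
      then show ?thesis by (simp add: cis_multiple_2pi)
    qed
    moreover have "norm (f (x + d) - f x) \<le> L * (K * norm (cis d - 1))"
      using lip[of "x + d" x] K(2)[OF d] L by (smt (verit) mult_left_mono)
    ultimately show ?thesis by (simp add: mult.assoc)
  qed
  then show ?thesis using L K by (intro exI[of _ "L * K"]) auto
qed

lemma bounded_measurable_integrable:
  fixes h :: "real \<Rightarrow> 'b::euclidean_space"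
  assumes "h \<in> borel_measurable borel" "\<And>t. norm (h t) \<le> D"
  shows "h integrable_on {a..b}"
  by (rule measurable_bounded_by_integrable_imp_integrable[where g="\<lambda>_. D"])
     (use assms in \<open>auto intro!: measurable_restrict_space1 measurable_completion\<close>)

text \<open>Dividing \<open>f t - f x\<close> by \<open>cis (t - x) - 1\<close> gives a bounded function whose Fourier coefficients make the
  partial sums of \<open>f\<close> at \<open>x\<close> telescope.\<close>
lemma lipschitz_fourier_sum:
  fixes f :: "real \<Rightarrow> complex"
  assumes per: "\<And>x. f (x + 2 * pi) = f x" and lip: "\<And>x y. norm (f x - f y) \<le> L * \<bar>x - y\<bar>"
  shows "f x = (\<Sum>j. fourier_c f (int j) * cis (real j * x)) +
               (\<Sum>j. fourier_c f (- int (Suc j)) * cis (- real (Suc j) * x))"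
proof -
  note cont = lipschitz_imp_continuous[of f, OF lip]
  obtain C where C: "C \<ge> 0" "\<And>t x. norm (f t - f x) \<le> C * norm (cis (t - x) - 1)"
    using lipschitz_periodic_le_cis[OF per lip] by blast
  \<comment> \<open>Where \<open>cis (t - x) = 1\<close>, division by zero gives
    \<open>g t = 0\<close>; the product formula below still holds there because
    \<open>f t = f x\<close> at such points.\<close>
  define g where "g t = (f t - f x) / (cis (t - x) - 1)" for t
  have g: "f t - f x = (cis (t - x) - 1) * g t" for t
    using C(2)[of t x] by (cases "cis (t - x) = 1") (auto simp: g_def)
  have gC: "norm (g t) \<le> C" for t
    using C(2)[of t x] C(1) by (cases "cis (t - x) = 1") (auto simp: g_def norm_divide field_simps)
  have [measurable]: "f \<in> borel_measurable borel" "(\<lambda>t. cis (a * t + b)) \<in> borel_measurable borel"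
    "(\<lambda>t. cis (t - a)) \<in> borel_measurable borel" for a b
    by (auto intro!: borel_measurable_continuous_onI continuous_intros cont)
  have gm: "(\<lambda>t. g t * cis (a * t + b)) \<in> borel_measurable borel" for a b
    unfolding g_def by measurable
  have gi: "(\<lambda>t. g t * cis (a * t + b)) integrable_on {-pi..pi}" for a b
    by (rule bounded_measurable_integrable[where D=C, OF gm]) (use gC in \<open>simp add: norm_mult\<close>)
  have gi2: "(\<lambda>t. (norm (g t))\<^sup>2) integrable_on {-pi..pi}"
  proof (rule bounded_measurable_integrable[where D="C\<^sup>2"])
    have "g \<in> borel_measurable borel" using gm[of 0 0] by simp
    then show "(\<lambda>t. (norm (g t))\<^sup>2) \<in> borel_measurable borel" by measurable
    show "norm ((norm (g t))\<^sup>2) \<le> C\<^sup>2" for t using gC[of t] by (simp add: power_mono)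
  qed
  have bes: "(\<Sum>j\<in>J. (norm (fourier_c g j))\<^sup>2) \<le> (circ_l2 g)\<^sup>2" if "finite J" for J
    by (rule bessel_integrable) (use gi[of _ 0] gi2 that in auto)
  define d where "d j = cis (of_int j * x) * fourier_c g j" for j
  \<comment> \<open>A Riemann-Lebesgue statement: by Bessel, the squared coefficients of
    \<open>g\<close> are summable along any sequence of distinct frequencies.\<close>
  have zero: "(\<lambda>n. d (h n)) \<longlonglongrightarrow> 0" if inj: "inj h" for h :: "nat \<Rightarrow> int"
  proof -
    have "summable (\<lambda>n. (norm (fourier_c g (h n)))\<^sup>2)"
    proof (rule bounded_imp_summable)
      show "(\<Sum>n\<le>M. (norm (fourier_c g (h n)))\<^sup>2) \<le> (circ_l2 g)\<^sup>2" for M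
        using bes[of "h ` {..M}"] inj by (simp add: sum.reindex inj_on_subset o_def)
    qed auto
    then have "(\<lambda>n. (norm (fourier_c g (h n)))\<^sup>2) \<longlonglongrightarrow> 0" by (rule summable_LIMSEQ_zero)
    then have "(\<lambda>n. sqrt ((norm (fourier_c g (h n)))\<^sup>2)) \<longlonglongrightarrow> sqrt 0" by (rule tendsto_real_sqrt)
    then have "(\<lambda>n. norm (d (h n))) \<longlonglongrightarrow> 0" by (simp add: d_def norm_mult)
    then show ?thesis by (rule tendsto_norm_zero_cancel)
  qed
  \<comment> \<open>Multiplying \<open>g\<close> by \<open>cis (t - x)\<close> shifts its
    frequencies by one, so each term of the series of \<open>f - f x\<close> at \<open>x\<close> is
    a difference of neighbouring values of \<open>d\<close>.\<close>
  have coeff: "fourier_c f j * cis (of_int j * x) - (if j = 0 then f x else 0) = d (j - 1) - d j" for j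
  proof -
    have e: "(f t - f x) * cis (- of_int j * t) = g t * cis (- of_int (j - 1) * t + (- x)) - g t * cis (- of_int j * t + 0)" for t
      unfolding g by (simp add: algebra_simps cis_mult)
    have "integral {-pi..pi} (\<lambda>t. (f t - f x) * cis (- of_int j * t)) =
        integral {-pi..pi} (\<lambda>t. g t * cis (- of_int (j - 1) * t + (- x))) - integral {-pi..pi} (\<lambda>t. g t * cis (- of_int j * t + 0))"
      unfolding e by (rule integral_diff) (rule gi)+
    also have "(\<lambda>t. g t * cis (- of_int (j - 1) * t + (- x))) = (\<lambda>t. cis (- x) * (g t * cis (- of_int (j - 1) * t)))"
      by (intro ext) (simp only: cis_mult[symmetric] mult_ac)
    finally have "circ_mean (\<lambda>t. (f t - f x) * cis (- of_int j * t)) = cis (- x) * fourier_c g (j - 1) - fourier_c g j"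
      by (simp add: circ_mean_def fourier_c_def diff_divide_distrib)
    moreover have "circ_mean (\<lambda>t. (f t - f x) * cis (- of_int j * t)) = 
        circ_mean (\<lambda>t. f t * cis (- of_int j * t)) - circ_mean (\<lambda>t. f x * cis (of_int (- j) * t))"
      by (subst circ_mean_diff[symmetric]) (auto intro!: continuous_intros cont simp: left_diff_distrib)
    ultimately have "fourier_c f j - (if j = 0 then f x else 0) = cis (- x) * fourier_c g (j - 1) - fourier_c g j"
      by (simp add: circ_mean_cmult circ_mean_cis fourier_c_def[of f] del: of_int_minus split: if_splits)
    then have "cis (of_int j * x) * (fourier_c f j - (if j = 0 then f x else 0)) = cis (of_int j * x) * cis (- x) * fourier_c g (j - 1) - d j"
      by (simp only: d_def right_diff_distrib mult.assoc)
    also have "cis (of_int j * x) * cis (- x) = cis (of_int (j - 1) * x)" by (simp add: cis_mult algebra_simps)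
    finally show ?thesis by (auto simp: d_def algebra_simps split: if_splits)
  qed
  define S1 where "S1 M = (\<Sum>j<M. fourier_c f (int j) * cis (real j * x))" for M
  define S2 where "S2 M = (\<Sum>j<M. fourier_c f (- int (Suc j)) * cis (- real (Suc j) * x))" for M
  \<comment> \<open>The index shift makes the frequencies run exactly over
    \<open>-M, ..., M\<close>; only two boundary values of \<open>d\<close> remain, and both tend to
    zero.\<close>
  have tel: "S1 (Suc M) + S2 M = f x + d (- int M - 1) - d (int M)" for M
  proof (induction M)
    case 0 then show ?case using coeff[of 0] by (simp add: S1_def S2_def algebra_simps)
  next
    case (Suc M)
    have "S1 (Suc (Suc M)) + S2 (Suc M) = S1 (Suc M) + S2 M + fourier_c f (int (Suc M)) * cis (real (Suc M) * x) +
       fourier_c f (- int (Suc M)) * cis (- real (Suc M) * x)" by (simp add: S1_def S2_def)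
    also have "fourier_c f (int (Suc M)) * cis (real (Suc M) * x) = d (int M) - d (int (Suc M))"
      using coeff[of "int (Suc M)"] by simp
    also have "fourier_c f (- int (Suc M)) * cis (- real (Suc M) * x) = d (- int (Suc M) - 1) - d (- int M - 1)"
    proof -
      have "- int M - 1 = - int (Suc M)" by simp
      then have "d (- int M - 1) = d (- int (Suc M))" by (rule arg_cong)
      then show ?thesis using coeff[of "- int (Suc M)"] by (simp del: of_nat_Suc)
    qed
    finally show ?case using Suc by simp
  qed
  have "(\<lambda>M. f x + d (- int M - 1) - d (int M)) \<longlonglongrightarrow> f x + 0 - 0"
    by (intro tendsto_intros zero) (auto simp: inj_on_def)
  then have l1: "(\<lambda>M. S1 (Suc M) + S2 M) \<longlonglongrightarrow> f x" by (simp add: tel)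
  have sm: "summable (\<lambda>j. fourier_c f (int j) * cis (real j * x))"
      "summable (\<lambda>j. fourier_c f (- int (Suc j)) * cis (- real (Suc j) * x))"
    by (rule summable_norm_cancel, use lipschitz_fourier_summable[OF per lip] in \<open>simp add: norm_mult\<close>)+
  have "(\<lambda>M. S1 (Suc M) + S2 M) \<longlonglongrightarrow> (\<Sum>j. fourier_c f (int j) * cis (real j * x)) + (\<Sum>j. fourier_c f (- int (Suc j)) * cis (- real (Suc j) * x))"
    unfolding S1_def S2_def by (intro tendsto_add LIMSEQ_Suc summable_LIMSEQ sm)
  with l1 show ?thesis using LIMSEQ_unique by blast
qed

section \<open>The disk algebra\<close>

lemma circ_mean_uniform_limit:
  assumes "uniform_limit {-pi..pi} p F sequentially" "\<And>M. continuous_on {-pi..pi} (p M)"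
  shows "(\<lambda>M. circ_mean (p M)) \<longlonglongrightarrow> circ_mean F"
proof -
  obtain I J where I: "\<And>n. (p n has_integral I n) {-pi..pi}" and J: "(F has_integral J) {-pi..pi}"
    and lim: "I \<longlonglongrightarrow> J"
    using uniform_limit_integral[OF assms] by auto
  have "(\<lambda>n. I n / complex_of_real (2 * pi)) \<longlonglongrightarrow> J / complex_of_real (2 * pi)"
    by (intro tendsto_divide lim tendsto_const) auto
  then show ?thesis by (simp add: circ_mean_def integral_unique[OF I] integral_unique[OF J])
qed

lemma circ_l2_trig_poly:
  assumes J: "finite J"
  shows "(circ_l2 (\<lambda>t. \<Sum>j\<in>J. c j * cis (of_int j * t)))\<^sup>2 = (\<Sum>j\<in>J. (norm (c j))\<^sup>2)"
proof -
  have "complex_of_real ((circ_l2 (\<lambda>t. \<Sum>j\<in>J. c j * cis (of_int j * t)))\<^sup>2) = complex_of_real (\<Sum>j\<in>J. (norm (c j))\<^sup>2)"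
    by (subst circ_l2_square_eq_mean[symmetric], intro continuous_intros)
       (simp only: circ_mean_def integral_unique[OF trig_poly_square_has_integral[OF J]], simp)
  then show ?thesis by (simp only: of_real_eq_iff)
qed

lemma circ_l2_power_poly:
  "(circ_l2 (\<lambda>t. \<Sum>j<M. c j * cis (real j * t)))\<^sup>2 = (\<Sum>j<M. (norm (c j))\<^sup>2)"
  using circ_l2_trig_poly[of "int ` {..<M}" "\<lambda>j. c (nat j)"] by (simp add: sum.reindex)

section \<open>Absolutely convergent power series on the circle\<close>

lemma power_series_circle_uniform:
  assumes "summable (\<lambda>j. norm (c j))"
  shows "uniform_limit S (\<lambda>M t. \<Sum>j<M. c j * cis (real j * t)) (\<lambda>t. \<Sum>j. c j * cis (real j * t)) sequentially"
  by (rule Weierstrass_m_test[OF _ assms]) (simp add: norm_mult)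

lemma power_series_circle_cont:
  assumes "summable (\<lambda>j. norm (c j))"
  shows "continuous_on S (\<lambda>t. \<Sum>j. c j * cis (real j * t))"
  by (rule uniform_limit_theorem[OF _ power_series_circle_uniform[OF assms]])
     (auto intro!: always_eventually continuous_intros)

lemma power_series_fourier:
  assumes c: "summable (\<lambda>j. norm (c j))"
  shows "fourier_c (\<lambda>t. \<Sum>j. c j * cis (real j * t)) (int m) = c m"
proof -
  define F where "F t = (\<Sum>j. c j * cis (real j * t))" for t
  have "uniform_limit {-pi..pi} (\<lambda>M t. \<Sum>j<M. c j * cis (real j * t) * cis (- of_int (int m) * t)) (\<lambda>t. \<Sum>j. c j * cis (real j * t) * cis (- of_int (int m) * t)) sequentially"
    by (rule Weierstrass_m_test[OF _ c]) (simp add: norm_mult)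
  also have "(\<lambda>t. \<Sum>j. c j * cis (real j * t) * cis (- of_int (int m) * t)) = (\<lambda>t. F t * cis (- of_int (int m) * t))"
  proof
    fix t
    have "summable (\<lambda>j. c j * cis (real j * t))"
      by (rule summable_norm_cancel) (use c in \<open>simp add: norm_mult\<close>)
    then show "(\<Sum>j. c j * cis (real j * t) * cis (- of_int (int m) * t)) = F t * cis (- of_int (int m) * t)"
      unfolding F_def by (rule suminf_mult2[symmetric])
  qed
  finally have "(\<lambda>M. circ_mean (\<lambda>t. \<Sum>j<M. c j * cis (real j * t) * cis (- of_int (int m) * t))) \<longlonglongrightarrow> fourier_c F (int m)"
    unfolding fourier_c_def by (rule circ_mean_uniform_limit) (auto intro!: continuous_intros)
  moreover have "circ_mean (\<lambda>t. \<Sum>j<M. c j * cis (real j * t) * cis (- of_int (int m) * t)) = c m" if "M > m" for M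
  proof -
    have e: "c j * cis (real j * t) * cis (- of_int (int m) * t) = c j * cis (of_int (int j - int m) * t)" for j t
      by (simp add: cis_mult algebra_simps)
    have "((\<lambda>t. \<Sum>j<M. c j * cis (of_int (int j - int m) * t)) has_integral (\<Sum>j<M. c j * (if int j - int m = 0 then 2 * pi else 0))) {-pi..pi}"
      by (intro has_integral_sum has_integral_mult_right has_integral_cis) auto
    also have "(\<Sum>j<M. c j * (if int j - int m = 0 then 2 * pi else 0)) = (\<Sum>j<M. if j = m then c m * (2 * pi) else 0)"
      by (intro sum.cong) auto
    finally show ?thesis unfolding e using that by (simp add: circ_mean_def integral_unique)
  qed
  then have "\<forall>\<^sub>F M in sequentially. circ_mean (\<lambda>t. \<Sum>j<M. c j * cis (real j * t) * cis (- of_int (int m) * t)) = c m"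
    using eventually_gt_at_top[of m] by (rule eventually_mono[rotated])
  ultimately have "(\<lambda>M. c m) \<longlonglongrightarrow> fourier_c F (int m)" by (rule Lim_transform_eventually)
  then show ?thesis unfolding F_def by (simp add: LIMSEQ_const_iff)
qed

text \<open>Parseval bounds the partial sums by \<open>B\<close>, and uniform convergence carries
  the bound to the limit.\<close>

lemma power_series_l2_le:
  assumes c: "summable (\<lambda>j. norm (c j))" and B: "\<And>M. (\<Sum>j<M. (norm (c j))\<^sup>2) \<le> B\<^sup>2" "0 \<le> B"
  shows "circ_l2 (\<lambda>t. \<Sum>j. c j * cis (real j * t)) \<le> B"
proof -
  define F where "F t = (\<Sum>j. c j * cis (real j * t))" for t
  define p where "p M t = (\<Sum>j<M. c j * cis (real j * t))" for M t
  have ul: "uniform_limit {-pi..pi} p F sequentially"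
    unfolding p_def F_def by (rule power_series_circle_uniform[OF c])
  have pc: "continuous_on {-pi..pi} (p M)" for M unfolding p_def by (intro continuous_intros)
  have Fc: "continuous_on {-pi..pi} F" unfolding F_def by (rule power_series_circle_cont[OF c])
  have pB: "circ_l2 (p M) \<le> B" for M
    using B(1)[of M] B(2) unfolding p_def by (intro power2_le_imp_le[OF _ B(2)]) (simp add: circ_l2_power_poly)
  have "circ_l2 F \<le> B + e" if e: "e > 0" for e
  proof -
    obtain M where M: "\<forall>t\<in>{-pi..pi}. dist (p M t) (F t) < e"
      using uniform_limitD[OF ul e] eventually_happens'[OF sequentially_bot] by blast
    have "circ_l2 F = circ_l2 (\<lambda>t. p M t + (F t - p M t))" by simp
    also have "\<dots> \<le> circ_l2 (p M) + circ_l2 (\<lambda>t. F t - p M t)"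
      by (intro circ_l2_triangle continuous_intros pc Fc)
    also have "circ_l2 (\<lambda>t. F t - p M t) \<le> e"
      by (rule circ_l2_bound) (use M e in \<open>auto intro!: continuous_intros pc Fc less_imp_le simp: dist_norm norm_minus_commute\<close>)
    finally show ?thesis using pB[of M] by simp
  qed
  then show ?thesis unfolding F_def by (rule field_le_epsilon)
qed

section \<open>Analytic functions in the disk and their boundary values\<close>

definition disk_alg :: "(complex \<Rightarrow> complex) \<Rightarrow> bool" where
  "disk_alg f \<longleftrightarrow> continuous_on (cball 0 1) f \<and> f holomorphic_on ball 0 1"

lemma disk_alg_const: "disk_alg (\<lambda>z. c)"
  and disk_alg_ident: "disk_alg (\<lambda>z. z)"
  by (auto simp: disk_alg_def)

lemma disk_alg_mult: "disk_alg f \<Longrightarrow> disk_alg g \<Longrightarrow> disk_alg (\<lambda>z. f z * g z)"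
  and disk_alg_diff: "disk_alg f \<Longrightarrow> disk_alg g \<Longrightarrow> disk_alg (\<lambda>z. f z - g z)"
  and disk_alg_power: "disk_alg f \<Longrightarrow> disk_alg (\<lambda>z. f z ^ n)"
  and disk_alg_exp: "disk_alg f \<Longrightarrow> disk_alg (\<lambda>z. exp (f z))"
  by (auto simp: disk_alg_def intro!: continuous_intros holomorphic_intros)

lemma disk_alg_poly: "disk_alg (poly p)"
  by (auto simp: disk_alg_def intro!: continuous_intros holomorphic_intros)

lemmas disk_alg_intros = disk_alg_const disk_alg_ident disk_alg_mult disk_alg_diff disk_alg_power disk_alg_exp disk_alg_poly

lemma disk_alg_cont_circle:
  assumes "disk_alg f" "0 \<le> r" "r \<le> 1"
  shows "continuous_on S (\<lambda>t. f (of_real r * cis t))"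
  by (rule continuous_on_compose2[of "cball 0 1" f])
     (use assms in \<open>auto simp: disk_alg_def norm_mult intro!: continuous_intros\<close>)

lemma disk_alg_cont: "disk_alg f \<Longrightarrow> continuous_on S (\<lambda>t. f (cis t))"
  using disk_alg_cont_circle[of f 1 S] by simp

text \<open>The derivative of the mean with respect to the radius is the integral of a tangential derivative, hence zero.\<close>
lemma circle_shift:
  assumes a: "0 \<le> a" "a < 1" and cont: "continuous_on {z. a \<le> norm z \<and> norm z \<le> 1} H"
    and hol: "H holomorphic_on {z. a < norm z \<and> norm z < 1}"
  shows "circ_mean (\<lambda>t. H (of_real a * cis t)) = circ_mean (\<lambda>t. H (cis t))"
proof -
  define I where "I r = integral (cbox (-pi) pi) (\<lambda>t. H (complex_of_real r * cis t))" for r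
  have "{z::complex. a < norm z \<and> norm z < 1} = ball 0 1 - cball 0 a" by auto
  then have op: "open {z::complex. a < norm z \<and> norm z < 1}" by (auto intro: open_Diff)
  have ci: "continuous_on {a..1} I"
    unfolding I_def
  proof (rule integral_continuous_on_param)
    show "continuous_on ({a..1} \<times> cbox (- pi) pi) (\<lambda>(r, t). H (complex_of_real r * cis t))"
      unfolding split_beta
      by (rule continuous_on_compose2[OF cont]) (use a in \<open>auto intro!: continuous_intros simp: norm_mult\<close>)
  qed
  have dH: "(H has_field_derivative deriv H z) (at z)" if "a < norm z" "norm z < 1" for z
    using holomorphic_derivI[OF hol op] that by auto
  have dHc: "continuous_on {z. a < norm z \<and> norm z < 1} (deriv H)"
    by (intro holomorphic_on_imp_continuous_on holomorphic_deriv hol op)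
  have cp: "cis (-pi) = cis pi" by (simp add: complex_eq_iff)
  have zero: "integral (cbox (-pi) pi) (\<lambda>t. deriv H (of_real r * cis t) * cis t) = 0" if r: "a < r" "r < 1" for r
  proof -
    have d: "((\<lambda>t. H (of_real r * cis t)) has_vector_derivative (\<i> * of_real r) * (deriv H (of_real r * cis t) * cis t)) (at t within {-pi..pi})" for t
    proof -
      have "((\<lambda>t. of_real r * cis (1 * t)) has_vector_derivative of_real r * (\<i> * of_real 1 * cis (1 * t))) (at t within {-pi..pi})"
        by (intro derivative_intros)
      then have "((H \<circ> (\<lambda>t. of_real r * cis t)) has_vector_derivative (of_real r * (\<i> * cis t)) * deriv H (of_real r * cis t)) (at t within {-pi..pi})"
        by (intro field_vector_diff_chain_within has_field_derivative_at_within[OF dH]) (use r a in \<open>auto simp: norm_mult\<close>)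
      then show ?thesis by (simp add: o_def mult_ac)
    qed
    have "((\<lambda>t. (\<i> * of_real r) * (deriv H (of_real r * cis t) * cis t)) has_integral H (of_real r * cis pi) - H (of_real r * cis (-pi))) {-pi..pi}"
      by (rule fundamental_theorem_of_calculus[OF _ d]) simp
    then have "((\<lambda>t. (\<i> * of_real r) * (deriv H (of_real r * cis t) * cis t)) has_integral 0) {-pi..pi}"
      using cp by simp
    then have "integral {-pi..pi} (\<lambda>t. (\<i> * of_real r) * (deriv H (of_real r * cis t) * cis t)) = 0"
      by (rule integral_unique)
    then show ?thesis using r a by simp
  qed
  have dI: "(I has_derivative (\<lambda>h. 0)) (at r within {a..1})" if r: "r \<in> {a..1} - {a, 1}" for r
  proof -
    have r': "r \<in> {a<..<1}" using r by auto
    have "(I has_vector_derivative integral (cbox (-pi) pi) (\<lambda>t. deriv H (of_real r * cis t) * cis t)) (at r within {a<..<1})"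
      unfolding I_def
    proof (rule leibniz_rule_vector_derivative)
      fix x t assume x: "x \<in> {a<..<1}"
      have "((\<lambda>x. of_real x * cis t) has_vector_derivative cis t) (at x within {a<..<1})"
        by (auto intro!: derivative_eq_intros simp: has_vector_derivative_def scaleR_conv_of_real)
      then have "((H \<circ> (\<lambda>x. of_real x * cis t)) has_vector_derivative cis t * deriv H (of_real x * cis t)) (at x within {a<..<1})"
        by (intro field_vector_diff_chain_within has_field_derivative_at_within[OF dH]) (use x a in \<open>auto simp: norm_mult\<close>)
      then show "((\<lambda>x. H (of_real x * cis t)) has_vector_derivative deriv H (of_real x * cis t) * cis t) (at x within {a<..<1})"
        by (simp add: o_def mult.commute)
    next
      fix x assume x: "x \<in> {a<..<1}"
      show "(\<lambda>t. H (complex_of_real x * cis t)) integrable_on cbox (- pi) pi"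
        by (rule integrable_continuous, rule continuous_on_compose2[OF cont]) (use x a in \<open>auto intro!: continuous_intros simp: norm_mult\<close>)
    next
      show "continuous_on ({a<..<1} \<times> cbox (- pi) pi) (\<lambda>(x, t). deriv H (complex_of_real x * cis t) * cis t)"
        unfolding split_beta
        by (intro continuous_intros continuous_on_compose2[OF dHc]) (use a in \<open>auto intro!: continuous_intros simp: norm_mult\<close>)
    qed (use r' in auto)
    then have "(I has_vector_derivative 0) (at r)"
      using zero[of r] r' at_within_open[OF r'] by auto
    then show ?thesis by (simp add: has_vector_derivative_def has_derivative_at_withinI)
  qed
  \<comment> \<open>At the two end radii only continuity of \<open>I\<close> is known, so they form
    the exceptional set of the zero-derivative criterion.\<close>
  have "I 1 = I a"
    by (rule has_derivative_zero_unique_strong_convex[of "{a..1}" "{a,1}" I a]) (use a ci dI in auto)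
  then show ?thesis by (simp add: I_def circ_mean_def cbox_interval)
qed

text \<open>The contour shift down to radius 0, where the circle degenerates to its centre.\<close>

lemma disk_alg_mean:
  assumes "disk_alg f"
  shows "circ_mean (\<lambda>t. f (cis t)) = f 0"
proof -
  have "circ_mean (\<lambda>t. f (of_real 0 * cis t)) = circ_mean (\<lambda>t. f (cis t))"
    by (rule circle_shift) (use assms in \<open>auto simp: disk_alg_def elim!: continuous_on_subset holomorphic_on_subset\<close>)
  then show ?thesis by (simp add: circ_mean_def scaleR_conv_of_real)
qed

lemma disk_alg_mean_cis:
  assumes "disk_alg f" "m \<ge> 1"
  shows "circ_mean (\<lambda>t. f (cis t) * cis (real m * t)) = 0"
  using disk_alg_mean[of "\<lambda>z. f z * z ^ m"] assms
  by (simp add: disk_alg_intros Complex.DeMoivre)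

lemma disk_alg_power_series:
  assumes c: "summable (\<lambda>j. norm (c j))"
  shows "disk_alg (\<lambda>z. \<Sum>j. c j * z ^ j)"
  unfolding disk_alg_def
proof
  have bd: "norm (c j * z ^ j) \<le> norm (c j)" if "z \<in> cball 0 1" for z j
    using that by (simp add: norm_mult norm_power mult_left_le power_le_one)
  show "continuous_on (cball 0 1) (\<lambda>z. \<Sum>j. c j * z ^ j)"
    by (rule uniform_limit_theorem[OF _ Weierstrass_m_test[OF bd c]]) (auto intro!: always_eventually continuous_intros)
  show "(\<lambda>z. \<Sum>j. c j * z ^ j) holomorphic_on ball 0 1"
  proof (rule power_series_holomorphic)
    fix w :: complex assume w: "w \<in> ball 0 1"
    have "summable (\<lambda>j. c j * w ^ j)"
      by (rule summable_comparison_test'[OF c, of 0]) (use bd[of w] w in auto)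
    then show "(\<lambda>j. c j * (w - 0) ^ j) sums (\<Sum>j. c j * w ^ j)" by (simp add: summable_sums)
  qed
qed

text \<open>On the circle of radius \<open>r\<close> the Taylor coefficients are read off from
  uniform convergence; moving the contour of \<open>f z / z ^ m\<close> out to radius 1 identifies
  them with the Fourier coefficients of the boundary values.\<close>

lemma disk_alg_taylor_coeffs:
  assumes f: "disk_alg f" and r: "0 < r" "r < 1"
  defines "c \<equiv> \<lambda>m. fourier_c (\<lambda>t. f (cis t)) (int m)"
  shows "\<And>w. norm w < 1 \<Longrightarrow> (\<lambda>m. c m * w ^ m) sums f w" and "summable (\<lambda>m. norm (c m * of_real r ^ m))"
proof -
  define b where "b m = (deriv ^^ m) f 0 / fact m" for m
  have b: "(\<lambda>m. b m * w ^ m) sums f w" if "norm w < 1" for w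
    using holomorphic_power_series[of f 0 1 w] that f by (auto simp: b_def disk_alg_def)
  have sm: "summable (\<lambda>m. norm (b m * of_real r ^ m))"
  proof -
    define x where "x = (1 + r) / 2"
    have x: "x < 1" "r < x" "0 < x" using r by (auto simp: x_def)
    show ?thesis
      by (rule powser_insidea[of b "of_real x"]) (use b[of "of_real x"] x r in \<open>auto simp: sums_iff\<close>)
  qed
  have "b m = c m" for m
  proof -
    have e: "f (of_real r * cis t) = (\<Sum>j. (b j * of_real r ^ j) * cis (real j * t))" for t
      using b[of "of_real r * cis t"] r by (simp add: norm_mult sums_iff power_mult_distrib Complex.DeMoivre mult.assoc)
    have "fourier_c (\<lambda>t. f (of_real r * cis t)) (int m) = b m * of_real r ^ m"
      unfolding e by (rule power_series_fourier[OF sm])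
    moreover have "(\<lambda>t. f (of_real r * cis t) / (of_real r * cis t) ^ m) = (\<lambda>t. inverse (of_real r ^ m) * (f (of_real r * cis t) * cis (- of_int (int m) * t)))"
      by (intro ext) (simp add: power_mult_distrib Complex.DeMoivre divide_inverse cis_inverse)
    ultimately have 1: "circ_mean (\<lambda>t. f (of_real r * cis t) / (of_real r * cis t) ^ m) = b m"
      using r by (simp only: circ_mean_cmult fourier_c_def[symmetric]) simp
    have "circ_mean (\<lambda>t. f (of_real r * cis t) / (of_real r * cis t) ^ m) = circ_mean (\<lambda>t. f (cis t) / cis t ^ m)"
    proof (rule circle_shift[where H="\<lambda>z. f z / z ^ m"])
      show "continuous_on {z. r \<le> norm z \<and> norm z \<le> 1} (\<lambda>z. f z / z ^ m)"
        using f r by (auto intro!: continuous_intros elim: continuous_on_subset simp: disk_alg_def)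
      show "(\<lambda>z. f z / z ^ m) holomorphic_on {z. r < norm z \<and> norm z < 1}"
        using f r by (auto intro!: holomorphic_intros elim: holomorphic_on_subset simp: disk_alg_def)
    qed (use r in auto)
    also have "\<dots> = c m"
      by (simp add: c_def fourier_c_def Complex.DeMoivre divide_inverse cis_inverse)
    finally show ?thesis using 1 by simp
  qed
  then show "\<And>w. norm w < 1 \<Longrightarrow> (\<lambda>m. c m * w ^ m) sums f w" "summable (\<lambda>m. norm (c m * of_real r ^ m))"
    using b sm by auto
qed

text \<open>Dilation multiplies the coefficient at \<open>m\<close> by \<open>r ^ m <= 1\<close>,
  and Bessel bounds the undamped coefficients.\<close>

lemma disk_alg_l2_dilate:
  assumes f: "disk_alg f" and r: "0 < r" "r < 1"
  shows "circ_l2 (\<lambda>t. f (of_real r * cis t)) \<le> circ_l2 (\<lambda>t. f (cis t))"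
proof -
  define c where "c m = fourier_c (\<lambda>t. f (cis t)) (int m)" for m
  note T = disk_alg_taylor_coeffs[OF f r, folded c_def]
  have e: "f (of_real r * cis t) = (\<Sum>j. (c j * of_real r ^ j) * cis (real j * t))" for t
    using T(1)[of "of_real r * cis t"] r by (simp add: norm_mult sums_iff power_mult_distrib Complex.DeMoivre mult.assoc)
  show ?thesis unfolding e
  proof (rule power_series_l2_le[OF T(2)])
    fix M
    have "(\<Sum>j<M. (norm (c j * of_real r ^ j))\<^sup>2) \<le> (\<Sum>j<M. (norm (c j))\<^sup>2)"
      using r by (intro sum_mono power_mono) (auto simp: norm_mult norm_power mult_left_le power_le_one)
    also have "\<dots> = (\<Sum>j\<in>int ` {..<M}. (norm (fourier_c (\<lambda>t. f (cis t)) j))\<^sup>2)"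
      by (simp add: sum.reindex c_def)
    also have "\<dots> \<le> (circ_l2 (\<lambda>t. f (cis t)))\<^sup>2"
      by (intro bessel disk_alg_cont f) auto
    finally show "(\<Sum>j<M. (norm (c j * of_real r ^ j))\<^sup>2) \<le> (circ_l2 (\<lambda>t. f (cis t)))\<^sup>2" .
  qed (intro circ_l2_nonneg disk_alg_cont f)
qed

section \<open>Truncated phases and contour shifts\<close>

lemma power_le_fact_exp:
  fixes x :: real
  assumes "0 \<le> x"
  shows "x ^ m \<le> fact m * exp x"
proof -
  have "(\<Sum>n\<in>{m}. x ^ n /\<^sub>R fact n) \<le> (\<Sum>n. x ^ n /\<^sub>R fact n)"
    by (rule sum_le_suminf[OF summable_exp_generic]) (use assms in auto)
  then have "x ^ m / fact m \<le> exp x" by (simp add: exp_def divide_inverse mult.commute)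
  then show ?thesis by (simp add: field_simps)
qed

lemma exp_minus_le:
  fixes x :: real
  assumes "0 < x"
  shows "exp (- x) \<le> fact m / x ^ m"
  using power_le_fact_exp[of x m] assms by (simp add: exp_minus field_simps)

text \<open>Both points lie in the half-plane on which \<open>exp\<close> has modulus at most
  \<open>M\<close>; it is convex, so the mean value inequality applies.\<close>

lemma norm_exp_diff_le:
  fixes a b :: complex
  assumes "exp (Re a) \<le> M" "exp (Re b) \<le> M"
  shows "norm (exp a - exp b) \<le> M * norm (a - b)"
proof (rule field_differentiable_bound[of "{z. exp (Re z) \<le> M}" exp exp])
  have "0 < M" using assms(1) exp_gt_zero[of "Re a"] by linarith
  then have "{z. exp (Re z) \<le> M} = {z. Re z \<le> ln M}" by (auto simp: ln_ge_iff)
  then show "convex {z. exp (Re z) \<le> M}" by (simp add: convex_halfspace_Re_le)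
qed (use assms in \<open>auto intro!: derivative_eq_intros\<close>)

lemma sinh_bounds:
  fixes x :: real
  assumes x: "0 \<le> x" "x \<le> 1"
  shows "\<bar>exp x - exp (- x) - 2 * x\<bar> \<le> x\<^sup>2"
proof -
  have 1: "exp x \<le> 1 + x + x\<^sup>2" by (rule exp_bound) (use x in auto)
  have 2: "1 + x \<le> exp x" "1 - x \<le> exp (- x)" using exp_ge_add_one_self[of x] exp_ge_add_one_self[of "-x"] by auto
  have "exp (- x) \<le> 1 / (1 + x)" using 2(1) x by (simp add: exp_minus field_simps)
  also have "\<dots> \<le> 1 - x + x\<^sup>2"
  proof -
    have "(1 - x + x\<^sup>2) * (1 + x) = 1 + x * x * x" by (simp add: algebra_simps power2_eq_square)
    then show ?thesis using x by (simp add: pos_divide_le_eq)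
  qed
  finally show ?thesis using 1 2 by linarith
qed

lemma circ_mean_bounded_mult_le:
  assumes [continuous_intros]: "continuous_on {-pi..pi} p" "continuous_on {-pi..pi} f" "continuous_on {-pi..pi} g"
    and M: "\<And>t. norm (p t) \<le> M"
  shows "norm (circ_mean (\<lambda>t. p t * (f t * g t))) \<le> M * (circ_l2 f * circ_l2 g)"
proof -
  have M0: "0 \<le> M" using M[of 0] norm_ge_zero order_trans by blast
  have "norm (circ_mean (\<lambda>t. p t * (f t * g t))) \<le> integral {-pi..pi} (\<lambda>t. M * (norm (f t) * norm (g t))) / (2 * pi)"
    by (rule circ_mean_norm_le) (auto intro!: continuous_intros mult_right_mono M simp: norm_mult)
  also have "\<dots> = M * (integral {-pi..pi} (\<lambda>t. norm (f t) * norm (g t)) / (2 * pi))" by simp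
  also have "\<dots> \<le> M * (circ_l2 f * circ_l2 g)"
    by (intro mult_left_mono integral_norm_mult_le M0 assms)
  finally show ?thesis .
qed

section \<open>Moving a mean to a smaller circle\<close>

lemma cont_punctured_circle:
  assumes "X holomorphic_on - {0}" "r \<noteq> 0"
  shows "continuous_on S (\<lambda>t. X (of_real r * cis t))"
  by (rule continuous_on_compose2[of "-{0}" X])
     (use assms in \<open>auto intro!: continuous_intros holomorphic_on_imp_continuous_on\<close>)

text \<open>The contour shift for \<open>X z * Y z / z ^ m\<close>, which is analytic in the annulus
  between \<open>r\<close> and 1. The division by \<open>r ^ m\<close> is the price of the frequency
  \<open>-m\<close>.\<close>

lemma shift_disk_alg:
  assumes X: "X holomorphic_on - {0}" and Y: "disk_alg Y" and r: "0 < r" "r < 1"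
  shows "circ_mean (\<lambda>t. X (cis t) * Y (cis t) * cis (- real m * t)) =
         circ_mean (\<lambda>t. X (of_real r * cis t) * Y (of_real r * cis t) * cis (- real m * t)) / of_real r ^ m"
proof -
  have "circ_mean (\<lambda>t. X (of_real r * cis t) * Y (of_real r * cis t) / (of_real r * cis t) ^ m) = circ_mean (\<lambda>t. X (cis t) * Y (cis t) / cis t ^ m)"
  proof (rule circle_shift[where H="\<lambda>z. X z * Y z / z ^ m"])
    have XY: "continuous_on {z. r \<le> norm z \<and> norm z \<le> 1} X" "X holomorphic_on {z. r < norm z \<and> norm z < 1}"
      "continuous_on {z. r \<le> norm z \<and> norm z \<le> 1} Y" "Y holomorphic_on {z. r < norm z \<and> norm z < 1}"
      using X Y r unfolding disk_alg_def
      by (auto elim!: continuous_on_subset[OF holomorphic_on_imp_continuous_on] holomorphic_on_subset continuous_on_subset)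
    show "continuous_on {z. r \<le> norm z \<and> norm z \<le> 1} (\<lambda>z. X z * Y z / z ^ m)"
      using XY r by (auto intro!: continuous_intros)
    show "(\<lambda>z. X z * Y z / z ^ m) holomorphic_on {z. r < norm z \<and> norm z < 1}"
      using XY r by (auto intro!: holomorphic_intros)
  qed (use r in auto)
  moreover have "(\<lambda>t. X (cis t) * Y (cis t) / cis t ^ m) = (\<lambda>t. X (cis t) * Y (cis t) * cis (- real m * t))"
    by (intro ext) (simp add: Complex.DeMoivre divide_inverse cis_inverse)
  moreover have "(\<lambda>t. X (of_real r * cis t) * Y (of_real r * cis t) / (of_real r * cis t) ^ m) =
     (\<lambda>t. inverse (of_real r ^ m) * (X (of_real r * cis t) * Y (of_real r * cis t) * cis (- real m * t)))"
    by (intro ext) (simp add: power_mult_distrib Complex.DeMoivre divide_inverse cis_inverse)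
  ultimately have "inverse (of_real r ^ m) * circ_mean (\<lambda>t. X (of_real r * cis t) * Y (of_real r * cis t) * cis (- real m * t)) = circ_mean (\<lambda>t. X (cis t) * Y (cis t) * cis (- real m * t))"
    by (simp only: circ_mean_cmult)
  then show ?thesis by (simp add: divide_inverse mult.commute)
qed

text \<open>Cauchy-Schwarz on the inner circle. \<open>X\<close> stays measured there, where it is
  going to be small, while \<open>Y\<close> returns to the unit circle by
  \<open>disk_alg_l2_dilate\<close>.\<close>

lemma shift_l2_le:
  assumes X: "X holomorphic_on - {0}" and Y: "disk_alg Y" and r: "0 < r" "r < 1"
  shows "norm (circ_mean (\<lambda>t. X (cis t) * Y (cis t) * cis (- real m * t))) \<le>
         circ_l2 (\<lambda>t. X (of_real r * cis t)) * circ_l2 (\<lambda>t. Y (cis t)) / r ^ m"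
proof -
  note cX = cont_punctured_circle[OF X, of r]
  note cY = disk_alg_cont_circle[OF Y, of r]
  have "norm (circ_mean (\<lambda>t. X (of_real r * cis t) * (Y (of_real r * cis t) * cis (- real m * t)))) \<le>
    circ_l2 (\<lambda>t. X (of_real r * cis t)) * circ_l2 (\<lambda>t. Y (of_real r * cis t) * cis (- real m * t))"
    by (intro circ_mean_mult_le continuous_intros cX cY) (use r in auto)
  also have "circ_l2 (\<lambda>t. Y (of_real r * cis t) * cis (- real m * t)) = circ_l2 (\<lambda>t. Y (of_real r * cis t))"
    by (simp add: circ_l2_def norm_mult)
  also have "circ_l2 (\<lambda>t. X (of_real r * cis t)) * \<dots> \<le> circ_l2 (\<lambda>t. X (of_real r * cis t)) * circ_l2 (\<lambda>t. Y (cis t))"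
    by (intro mult_left_mono disk_alg_l2_dilate Y r circ_l2_nonneg cX) (use r in auto)
  finally show ?thesis
    using r by (subst shift_disk_alg[OF X Y r]) (simp add: norm_divide norm_power divide_right_mono mult.assoc)
qed

text \<open>The coefficients of \<open>S\<close> under the regularity of the theorem:
  \<open>sob\<close> is the coefficient form of a square integrable derivative of order
  \<open>k\<close>.\<close>

locale sobolev_coeffs =
  fixes a :: "nat \<Rightarrow> complex" and k :: nat and L :: real
  assumes k2: "2 \<le> k" and a0: "a 0 = 0" and L: "0 \<le> L"
    and sob: "\<And>M. (\<Sum>j<M. (real j ^ k * norm (a j))\<^sup>2) \<le> L\<^sup>2"
begin

lemma summable_1: "summable (\<lambda>j. real j * norm (a j))"
proof -
  have "(\<Sum>j<M. (real (Suc j) * (real (Suc j) * norm (a (Suc j))))\<^sup>2) \<le> L\<^sup>2" for M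
  proof -
    have "(\<Sum>j<M. (real (Suc j) * (real (Suc j) * norm (a (Suc j))))\<^sup>2) \<le> (\<Sum>j<M. (real (Suc j) ^ k * norm (a (Suc j)))\<^sup>2)"
    proof (intro sum_mono power_mono)
      fix j
      have "real (Suc j) * real (Suc j) \<le> real (Suc j) ^ k"
        using power_increasing[OF k2, of "real (Suc j)"] by (simp add: power2_eq_square)
      then show "real (Suc j) * (real (Suc j) * norm (a (Suc j))) \<le> real (Suc j) ^ k * norm (a (Suc j))"
        by (metis mult.assoc mult_right_mono norm_ge_zero)
    qed auto
    also have "\<dots> \<le> (\<Sum>j<Suc M. (real j ^ k * norm (a j))\<^sup>2)"
      by (subst sum.lessThan_Suc_shift) simp
    finally show ?thesis using sob[of "Suc M"] by linarith
  qed
  then have "summable (\<lambda>j. real (Suc j) * norm (a (Suc j)))"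
    by (intro summable_of_square_bound[where B="L\<^sup>2"]) auto
  then show ?thesis by (subst (asm) summable_Suc_iff)
qed

lemma norm_a_le: "norm (a j) \<le> real j * norm (a j)"
  by (cases j) (auto simp: a0 algebra_simps)

lemma summable_0: "summable (\<lambda>j. norm (a j))"
  by (rule summable_comparison_test'[OF summable_1]) (use norm_a_le in auto)

definition S :: "complex \<Rightarrow> complex" where "S z = (\<Sum>j. a j * z ^ j)"

lemma disk_alg_S: "disk_alg S"
  unfolding S_def by (rule disk_alg_power_series[OF summable_0])

lemma S_cis: "S (cis t) = (\<Sum>j. a j * cis (real j * t))"
  by (simp add: S_def Complex.DeMoivre)

end

text \<open>\<open>pos\<close> is \<open>kappa' >= c0\<close>, with \<open>kappa'\<close> written as
  the series of \<open>kappa_deriv\<close>.\<close>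

locale phase = sobolev_coeffs +
  fixes c0 :: real
  assumes c0: "0 < c0" and pos: "\<And>t. c0 \<le> 1 - 2 * (\<Sum>j. real j * Re (a j * cis (real j * t)))"
begin

section \<open>The truncated phase and its decay inside the disk\<close>

definition tail :: "nat \<Rightarrow> real" where "tail T = (\<Sum>j. real (j + T) * norm (a (j + T)))"

lemma summable_tail: "summable (\<lambda>j. real (j + T) * norm (a (j + T)))"
  using summable_1 summable_iff_shift[of "\<lambda>j. real j * norm (a j)" T] by simp


lemma tail_small: "e > 0 \<Longrightarrow> \<exists>N. \<forall>T\<ge>N. tail T \<le> e"
  using suminf_exist_split[OF _ summable_1, of e] unfolding tail_def
  by (metis abs_le_D1 less_imp_le real_norm_def)

text \<open>On the circle this is \<open>cnj S - S\<close> with \<open>S\<close> cut off at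
  \<open>T\<close>. Replacing \<open>cnj z\<close> by \<open>1 / z\<close> and keeping finitely many
  terms makes it holomorphic off the origin, so that \<open>E\<close>, the truncated
  \<open>u\<close>, admits contour shifts.\<close>

definition phi :: "nat \<Rightarrow> complex \<Rightarrow> complex" where
  "phi T z = (\<Sum>j<T. cnj (a j) / z ^ j - a j * z ^ j)"

definition E :: "nat \<Rightarrow> nat \<Rightarrow> complex \<Rightarrow> complex" where
  "E n T z = z ^ n * exp (of_nat n * phi T z)"

definition u :: "nat \<Rightarrow> real \<Rightarrow> complex" where
  "u n t = cis t ^ n * exp (of_nat n * (cnj (S (cis t)) - S (cis t)))"

lemma E_holo: "E n T holomorphic_on - {0}"
  unfolding E_def phi_def by (auto intro!: holomorphic_intros)

lemma norm_u: "norm (u n t) = 1"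
  by (simp add: u_def norm_mult norm_power)

lemma u_cont: "continuous_on A (u n)"
  unfolding u_def by (intro continuous_intros disk_alg_cont[OF disk_alg_S])

definition R :: "nat \<Rightarrow> real \<Rightarrow> complex" where
  "R T t = (\<Sum>j. (if j < T then 0 else a j) * cis (real j * t))"

lemma summable_R: "summable (\<lambda>j. norm (if j < T then 0 else a j))"
  by (rule summable_comparison_test'[OF summable_0]) auto

lemma R_cont: "continuous_on A (R T)"
  unfolding R_def by (rule power_series_circle_cont[OF summable_R])

lemma R_eq: "S (cis t) - (\<Sum>j<T. a j * cis (real j * t)) = R T t"
proof -
  have sm: "summable (\<lambda>j. a j * cis (real j * t))"
    by (rule summable_norm_cancel) (use summable_0 in \<open>simp add: norm_mult\<close>)
  have "(\<lambda>j. (if j < T then a j * cis (real j * t) else 0)) sums (\<Sum>j<T. a j * cis (real j * t))"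
    using sums_If_finite_set[of "{..<T}" "\<lambda>j. a j * cis (real j * t)"] by simp
  then have "(\<lambda>j. a j * cis (real j * t) - (if j < T then a j * cis (real j * t) else 0)) sums (S (cis t) - (\<Sum>j<T. a j * cis (real j * t)))"
    unfolding S_cis by (intro sums_diff summable_sums sm)
  moreover have "(\<lambda>j. a j * cis (real j * t) - (if j < T then a j * cis (real j * t) else 0)) = (\<lambda>j. (if j < T then 0 else a j) * cis (real j * t))"
    by auto
  ultimately show ?thesis unfolding R_def by (simp add: sums_iff)
qed

lemma phi_cis: "phi T (cis t) = cnj (\<Sum>j<T. a j * cis (real j * t)) - (\<Sum>j<T. a j * cis (real j * t))"
  by (simp add: phi_def sum_subtractf Complex.DeMoivre divide_inverse cis_inverse cis_cnj)

text \<open>On the circle both exponents are purely imaginary, where \<open>exp\<close> is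
  1-Lipschitz; their difference is \<open>n (cnj R - R)\<close>.\<close>

lemma u_minus_E: "norm (u n t - E n T (cis t)) \<le> 2 * real n * norm (R T t)"
proof -
  define p where "p = (\<Sum>j<T. a j * cis (real j * t))"
  have e: "u n t - E n T (cis t) = cis t ^ n * (exp (of_nat n * (cnj (S (cis t)) - S (cis t))) - exp (of_nat n * (cnj p - p)))"
    by (simp add: u_def E_def phi_cis p_def right_diff_distrib)
  have "norm (u n t - E n T (cis t)) \<le> 1 * norm (of_nat n * (cnj (S (cis t)) - S (cis t)) - of_nat n * (cnj p - p))"
    unfolding e norm_mult norm_power norm_cis by (simp only: power_one mult_1_left, rule norm_exp_diff_le[where M=1, simplified mult_1_left]) auto
  also have "of_nat n * (cnj (S (cis t)) - S (cis t)) - of_nat n * (cnj p - p) = of_nat n * (cnj (R T t) - R T t)"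
    by (simp add: p_def R_eq[of t T, symmetric] algebra_simps)
  also have "1 * norm \<dots> \<le> real n * (norm (cnj (R T t)) + norm (R T t))"
    by (simp add: norm_mult mult_left_mono norm_triangle_ineq4 del: complex_mod_cnj)
  finally show ?thesis by simp
qed

text \<open>In the remainder \<open>j >= T\<close>, so the factor \<open>T\<close> is absorbed by
  the weight \<open>j\<close>. With \<open>tail_small\<close> the remainder is thus
  \<open>o(1/T)\<close> uniformly.\<close>

lemma R_sup: "real T * norm (R T t) \<le> tail T"
proof -
  have "norm (R T t) \<le> (\<Sum>j. norm (if j < T then 0 else a j))"
    unfolding R_def using summable_norm[of "\<lambda>j. (if j < T then 0 else a j) * cis (real j * t)"] summable_R[of T]
    by (simp add: norm_mult)
  also have "\<dots> = (\<Sum>j. norm (a (j + T)))"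
    by (subst suminf_split_initial_segment[OF summable_R, of T T]) simp
  finally have "real T * norm (R T t) \<le> real T * (\<Sum>j. norm (a (j + T)))" by (intro mult_left_mono) auto
  also have "\<dots> = (\<Sum>j. real T * norm (a (j + T)))"
    by (intro suminf_mult[symmetric]) (use summable_0 in \<open>simp add: summable_iff_shift[of "\<lambda>j. norm (a j)"]\<close>)
  also have "\<dots> \<le> tail T"
    unfolding tail_def
    by (intro suminf_le summable_mult)
       (use summable_tail[of T] in \<open>auto intro!: mult_right_mono simp: summable_0 summable_iff_shift[of "\<lambda>j. norm (a j)"]\<close>)
  finally show ?thesis .
qed

lemma sob_tail:
  assumes T: "T \<ge> 1" and J: "finite J" and JT: "\<And>j. j \<in> J \<Longrightarrow> T \<le> j"
  shows "(\<Sum>j\<in>J. (norm (a j))\<^sup>2) \<le> (L / real T ^ k)\<^sup>2"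
proof -
  have "(\<Sum>j\<in>J. (norm (a j))\<^sup>2) * (real T ^ k)\<^sup>2 = (\<Sum>j\<in>J. (real T ^ k * norm (a j))\<^sup>2)"
    by (simp add: sum_distrib_left power_mult_distrib mult.commute[of _ "(real T ^ k)\<^sup>2"])
  also have "\<dots> \<le> (\<Sum>j\<in>J. (real j ^ k * norm (a j))\<^sup>2)"
    by (intro sum_mono power_mono mult_right_mono) (use JT in auto)
  also have "\<dots> \<le> (\<Sum>j<Suc (Max (insert 0 J)). (real j ^ k * norm (a j))\<^sup>2)"
    by (rule sum_mono2) (use J in \<open>auto simp: less_Suc_eq_le\<close>)
  also have "\<dots> \<le> L\<^sup>2" by (rule sob)
  finally show ?thesis using T by (simp add: power_divide pos_le_divide_eq)
qed

lemma R_l2: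
  assumes T: "T \<ge> 1"
  shows "circ_l2 (R T) \<le> L / real T ^ k"
  unfolding R_def
proof (rule power_series_l2_le[OF summable_R])
  fix M
  have "(\<Sum>j<M. (norm (if j < T then 0 else a j))\<^sup>2) = (\<Sum>j\<in>{j. j < M \<and> T \<le> j}. (norm (a j))\<^sup>2)"
    by (rule sum.mono_neutral_cong_right) auto
  also have "\<dots> \<le> (L / real T ^ k)\<^sup>2" by (rule sob_tail[OF T]) auto
  finally show "(\<Sum>j<M. (norm (if j < T then 0 else a j))\<^sup>2) \<le> (L / real T ^ k)\<^sup>2" .
qed (use L in auto)

text \<open>At radius \<open>exp (- s)\<close>, \<open>ln |E| / n\<close> equals
  \<open>Re phi - s\<close>, and \<open>Re phi\<close> is a sum of
  \<open>2 sinh (j s) Re (a j cis (j t))\<close>. To first order in \<open>s\<close> this is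
  \<open>s (1 - kappa')\<close>, at most \<open>s (1 - c0)\<close>; the restriction
  \<open>s T <= A\<close> and large \<open>T\<close> keep the two errors below half of the gain
  \<open>s c0\<close>.\<close>

lemma decay:
  "\<exists>A T0. 0 < A \<and> A \<le> 1 \<and> 1 \<le> T0 \<and> (\<forall>T\<ge>T0. \<forall>s\<ge>0. s * real T \<le> A \<longrightarrow>
      (\<forall>n t. norm (E n T (of_real (exp (- s)) * cis t)) \<le> exp (- (real n * (c0 / 2) * s))))"
proof -
  define B where "B = (\<Sum>j. real j * norm (a j))"
  have B: "0 \<le> B" unfolding B_def by (intro suminf_nonneg summable_1) auto
  \<comment> \<open>This choice gives \<open>A B <= c0 / 4\<close>, which bounds the quadratic error
    by \<open>s c0 / 4\<close>; \<open>A <= 1\<close> permits \<open>sinh_bounds\<close>.\<close>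
  define A where "A = min 1 (c0 / (4 * (B + 1)))"
  have A: "0 < A" "A \<le> 1" using c0 B by (auto simp: A_def)
  have "A * B \<le> c0 / (4 * (B + 1)) * (B + 1)" using B by (intro mult_mono) (use c0 in \<open>auto simp: A_def\<close>)
  also have "\<dots> = c0 / 4" using B by (simp add: field_simps)
  finally have AB: "A * B \<le> c0 / 4" .
  obtain T1 where T1: "\<And>T. T \<ge> T1 \<Longrightarrow> tail T \<le> c0 / 8" using tail_small[of "c0 / 8"] c0 by auto
  have main: "norm (E n T (of_real (exp (- s)) * cis t)) \<le> exp (- (real n * (c0 / 2) * s))"
    if T: "T \<ge> T1" and s: "s \<ge> 0" "s * real T \<le> A" for T s n t
  proof -
    define x where "x j = Re (a j * cis (real j * t))" for j
    have xa: "\<bar>x j\<bar> \<le> norm (a j)" for j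
      using abs_Re_le_cmod[of "a j * cis (real j * t)"] by (simp add: x_def norm_mult)
    define z where "z = of_real (exp (- s)) * cis t"
    have zj: "z ^ j = of_real (exp (- (real j * s))) * cis (real j * t)" for j
      by (simp add: z_def power_mult_distrib Complex.DeMoivre flip: exp_of_nat_mult of_real_power)
    have Rej: "Re (cnj (a j) / z ^ j - a j * z ^ j) = (exp (real j * s) - exp (- (real j * s))) * x j" for j
    proof -
      have "cnj (a j) / z ^ j = of_real (exp (real j * s)) * cnj (a j * cis (real j * t))"
        by (simp add: zj divide_inverse cis_inverse cis_cnj exp_minus)
      moreover have "a j * z ^ j = of_real (exp (- (real j * s))) * (a j * cis (real j * t))" by (simp add: zj)
      moreover have "Re (of_real p * cnj w - of_real q * w) = (p - q) * Re w" for p q w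
        by (simp add: left_diff_distrib)
      ultimately show ?thesis by (simp only: x_def)
    qed
    have sx: "summable (\<lambda>j. real j * x j)"
      by (rule summable_norm_cancel, rule summable_comparison_test'[OF summable_1])
         (use xa in \<open>auto simp: abs_mult intro!: mult_left_mono\<close>)
    have "Re (phi T z) = (\<Sum>j<T. (exp (real j * s) - exp (- (real j * s))) * x j)"
      unfolding phi_def Re_sum Rej ..
    \<comment> \<open>Linearization of \<open>sinh\<close>: one factor of the quadratic error
      \<open>(j s)^2\<close> is replaced by \<open>A\<close>, leaving a multiple of the summable
      \<open>j |a j|\<close>.\<close>
    also have "\<dots> \<le> (\<Sum>j<T. 2 * s * (real j * x j) + A * s * (real j * norm (a j)))"
    proof (rule sum_mono)
      fix j assume j: "j \<in> {..<T}"
      have js: "0 \<le> real j * s" "real j * s \<le> A"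
      proof -
        have "real j * s \<le> real T * s" using j s by (intro mult_right_mono) auto
        then show "real j * s \<le> A" using s by (simp add: mult.commute)
      qed (use s in auto)
      have "(exp (real j * s) - exp (- (real j * s))) * x j - 2 * (real j * s) * x j = (exp (real j * s) - exp (- (real j * s)) - 2 * (real j * s)) * x j"
        by (simp add: algebra_simps)
      also have "\<dots> \<le> \<bar>exp (real j * s) - exp (- (real j * s)) - 2 * (real j * s)\<bar> * \<bar>x j\<bar>"
        by (metis abs_ge_self abs_mult)
      also have "\<dots> \<le> (real j * s)\<^sup>2 * norm (a j)"
        using js A xa[of j] sinh_bounds[of "real j * s"] by (intro mult_mono) auto
      also have "\<dots> \<le> (A * (real j * s)) * norm (a j)"
        using js by (intro mult_right_mono) (auto simp: power2_eq_square intro!: mult_right_mono)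
      finally show "(exp (real j * s) - exp (- (real j * s))) * x j \<le> 2 * s * (real j * x j) + A * s * (real j * norm (a j))"
        by (simp add: algebra_simps)
    qed
    also have "\<dots> = 2 * s * (\<Sum>j<T. real j * x j) + s * (A * (\<Sum>j<T. real j * norm (a j)))"
      by (simp add: sum.distrib sum_distrib_left mult_ac)
    \<comment> \<open>The full series is at most \<open>(1 - c0) / 2\<close> by \<open>pos\<close>,
      and cutting it at \<open>T\<close> costs at most \<open>tail T <= c0 / 8\<close>.\<close>
    also have "\<dots> \<le> 2 * s * ((1 - c0) / 2 + c0 / 8) + s * (c0 / 4)"
    proof (intro add_mono mult_left_mono)
      have "(\<Sum>j<T. real j * x j) = (\<Sum>j. real j * x j) - (\<Sum>j. real (j + T) * x (j + T))"
        by (simp add: suminf_split_initial_segment[OF sx, of T])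
      also have "- (\<Sum>j. real (j + T) * x (j + T)) \<le> tail T"
      proof -
        have "norm (\<Sum>j. real (j + T) * x (j + T)) \<le> tail T"
          unfolding tail_def
          by (rule norm_suminf_le) (use xa summable_tail[of T] in \<open>auto simp: abs_mult intro!: mult_left_mono\<close>)
        then show ?thesis by simp
      qed
      then have "(\<Sum>j. real j * x j) - (\<Sum>j. real (j + T) * x (j + T)) \<le> (\<Sum>j. real j * x j) + tail T" by simp
      also have "\<dots> \<le> (1 - c0) / 2 + c0 / 8"
        proof -
        have "X + Z \<le> (1 - c0) / 2 + c0 / 8" if "c0 \<le> 1 - 2 * X" "Z \<le> c0 / 8" for X Z :: real
          using that by (simp add: field_simps)
        then show ?thesis using pos[of t, folded x_def] T1[OF T] by blast
      qed
      finally show "(\<Sum>j<T. real j * x j) \<le> (1 - c0) / 2 + c0 / 8" .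
      have "A * (\<Sum>j<T. real j * norm (a j)) \<le> A * B"
        unfolding B_def using A by (intro mult_left_mono sum_le_suminf summable_1) auto
      then show "A * (\<Sum>j<T. real j * norm (a j)) \<le> c0 / 4" using AB by linarith
    qed (use s in auto)
    also have "\<dots> = s * (1 - c0 / 2)" by (simp add: field_simps)
    finally have Re: "Re (phi T z) \<le> s * (1 - c0 / 2)" .
    have "norm (E n T z) = exp (- (real n * s)) * exp (real n * Re (phi T z))"
      by (simp add: E_def norm_mult norm_power z_def flip: exp_of_nat_mult)
    also have "\<dots> = exp (real n * (Re (phi T z) - s))" by (simp add: exp_add[symmetric] algebra_simps)
    also have "\<dots> \<le> exp (real n * (s * (1 - c0 / 2) - s))" using Re by (simp add: mult_left_mono)
    also have "real n * (s * (1 - c0 / 2) - s) = - (real n * (c0 / 2) * s)" by (simp add: algebra_simps)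
    finally show ?thesis by (simp add: z_def)
  qed
  show ?thesis
    by (rule exI[of _ A], rule exI[of _ "max 1 T1"]) (use A main in auto)
qed

end

section \<open>Hankel estimates for the oscillating phase\<close>

lemma divide_exp_minus_power:
  fixes x s :: real
  shows "x / exp (- s) ^ m = x * exp (real m * s)"
proof -
  have "exp (- s) ^ m = exp (- (real m * s))" by (metis exp_of_nat_mult mult_minus_right)
  then show ?thesis by (simp add: exp_minus divide_inverse)
qed

context phase
begin

lemma E_cont_circle: "continuous_on X (\<lambda>t. E n T (cis t))"
  using cont_punctured_circle[OF E_holo, of 1 X] by simp

text \<open>Truncate at \<open>T = n div d\<close> and split \<open>u\<close> into \<open>E\<close>
  and a remainder. Shifted to radius \<open>exp (- A / T)\<close>, \<open>E\<close> is at most 1/4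
  if \<open>d\<close> is large; for this fixed \<open>d\<close> the remainder is at most 1/4 on the
  circle once \<open>T\<close>, hence \<open>n\<close>, is large.\<close>

lemma hankel_contraction:
  "\<exists>n0. \<forall>n\<ge>n0. \<forall>y Y. disk_alg y \<longrightarrow> disk_alg Y \<longrightarrow>
     norm (circ_mean (\<lambda>t. u n t * (y (cis t) * Y (cis t)))) \<le> 1/2 * (circ_l2 (\<lambda>t. y (cis t)) * circ_l2 (\<lambda>t. Y (cis t)))"
proof -
  obtain A T0 where A: "0 < A" "A \<le> 1" and T0: "1 \<le> T0"
    and dec: "\<And>T s n t. T \<ge> T0 \<Longrightarrow> s \<ge> 0 \<Longrightarrow> s * real T \<le> A \<Longrightarrow>
      norm (E n T (of_real (exp (- s)) * cis t)) \<le> exp (- (real n * (c0 / 2) * s))"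
    using decay by blast
  \<comment> \<open>Since \<open>n / T >= d\<close>, the decay exponent
    \<open>n (c0 / 2) A / T\<close> is at least 4, and \<open>exp (- x) <= 1 / x\<close> gives
    1/4.\<close>
  obtain d :: nat where d: "4 / (c0 / 2 * A) < real d" using reals_Archimedean2 by blast
  have d4: "4 \<le> c0 / 2 * A * real d" using d c0 A by (simp add: field_simps)
  have d1: "d \<ge> 1" using d4 c0 A by (cases d) auto
  \<comment> \<open>Since \<open>n <= 2 d T\<close>, the remainder is at most
    \<open>2 n |R| <= 4 d T |R| <= 4 d tail T\<close>, so this threshold yields 1/4.\<close>
  obtain N where N: "\<And>T. T \<ge> N \<Longrightarrow> tail T \<le> 1 / (16 * real d)"
    using tail_small[of "1 / (16 * real d)"] d1 by auto
  define n0 where "n0 = d * (max T0 N + 1)"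
  have "norm (circ_mean (\<lambda>t. u n t * (y (cis t) * Y (cis t)))) \<le> 1/2 * (circ_l2 (\<lambda>t. y (cis t)) * circ_l2 (\<lambda>t. Y (cis t)))"
    if n: "n \<ge> n0" and y: "disk_alg y" and Y: "disk_alg Y" for n y Y
  proof -
    define T where "T = n div d"
    have "n0 div d \<le> T" unfolding T_def by (rule div_le_mono[OF n])
    then have T: "T \<ge> T0" "T \<ge> N" "T \<ge> 1" using d1 T0 by (auto simp: n0_def)
    have nT: "d * T \<le> n" "n \<le> 2 * d * T"
    proof -
      show "d * T \<le> n" by (simp add: T_def)
      have "n < d * T + d" using dividend_less_div_times[of d n] d1 by (simp add: T_def mult.commute)
      moreover have "d * 1 \<le> d * T" using T by (intro mult_le_mono) auto
      ultimately show "n \<le> 2 * d * T" by linarith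
    qed
    have nTr: "real d * real T \<le> real n" "real n \<le> 2 * real d * real T"
      using nT[THEN of_nat_mono[where 'a=real]] by simp_all
    define s where "s = A / real T"
    define r where "r = exp (- s)"
    have s: "s > 0" "s * real T = A" using A T by (auto simp: s_def)
    have r: "0 < r" "r < 1" using s by (auto simp: r_def)
    have Er: "norm (E n T (of_real r * cis t)) \<le> 1 / 4" for t
    proof -
      have "c0 / 2 * (A * real d) \<le> c0 / 2 * (real n * s)"
      proof (intro mult_left_mono)
        have "A * real d = (real d * real T) * s" using s(2) by (simp add: mult_ac)
        also have "\<dots> \<le> real n * s" using nTr s by (intro mult_right_mono) auto
        finally show "A * real d \<le> real n * s" .
      qed (use c0 in auto)
      then have x: "4 \<le> real n * (c0 / 2) * s" using d4 by (simp add: mult_ac)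
      have "norm (E n T (of_real r * cis t)) \<le> exp (- (real n * (c0 / 2) * s))"
        unfolding r_def using s T by (intro dec) auto
      also have "\<dots> \<le> fact 1 / (real n * (c0 / 2) * s) ^ 1" using x by (intro exp_minus_le) auto
      also have "\<dots> \<le> 1 / 4" using x by (simp add: divide_le_eq)
      finally show ?thesis .
    qed
    have ue: "norm (u n t - E n T (cis t)) \<le> 1 / 4" for t
    proof -
      have "norm (u n t - E n T (cis t)) \<le> 2 * real n * norm (R T t)" by (rule u_minus_E)
      also have "\<dots> \<le> 2 * (2 * real d * real T) * norm (R T t)"
        using nTr by (intro mult_right_mono mult_left_mono) auto
      also have "\<dots> = 4 * real d * (real T * norm (R T t))" by simp
      also have "\<dots> \<le> 4 * real d * (1 / (16 * real d))"
        using R_sup[of T t] N[OF T(2)] by (intro mult_left_mono) auto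
      also have "\<dots> = 1 / 4" using d1 by simp
      finally show ?thesis .
    qed
    let ?N = "circ_l2 (\<lambda>t. y (cis t)) * circ_l2 (\<lambda>t. Y (cis t))"
    note ci = continuous_intros u_cont E_cont_circle disk_alg_cont[OF y] disk_alg_cont[OF Y]
    have "circ_mean (\<lambda>t. u n t * (y (cis t) * Y (cis t))) =
       circ_mean (\<lambda>t. (u n t - E n T (cis t)) * (y (cis t) * Y (cis t)) + E n T (cis t) * (y (cis t) * Y (cis t)))"
      by (simp add: algebra_simps)
    also have "\<dots> = circ_mean (\<lambda>t. (u n t - E n T (cis t)) * (y (cis t) * Y (cis t))) + circ_mean (\<lambda>t. E n T (cis t) * (y (cis t) * Y (cis t)))"
      by (intro circ_mean_add ci)
    finally have "norm (circ_mean (\<lambda>t. u n t * (y (cis t) * Y (cis t)))) \<le>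
       norm (circ_mean (\<lambda>t. (u n t - E n T (cis t)) * (y (cis t) * Y (cis t)))) + norm (circ_mean (\<lambda>t. E n T (cis t) * (y (cis t) * Y (cis t))))"
      by (simp add: norm_triangle_ineq)
    also have "norm (circ_mean (\<lambda>t. (u n t - E n T (cis t)) * (y (cis t) * Y (cis t)))) \<le> 1 / 4 * ?N"
      by (intro circ_mean_bounded_mult_le ci ue)
    also have "norm (circ_mean (\<lambda>t. E n T (cis t) * (y (cis t) * Y (cis t)))) \<le> 1 / 4 * ?N"
    proof -
      have "circ_mean (\<lambda>t. E n T (cis t) * (y (cis t) * Y (cis t))) = circ_mean (\<lambda>t. E n T (of_real r * cis t) * (y (of_real r * cis t) * Y (of_real r * cis t)))"
        using shift_disk_alg[OF E_holo disk_alg_mult[OF y Y] r, of n T 0] by simp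
      also have "norm \<dots> \<le> 1 / 4 * (circ_l2 (\<lambda>t. y (of_real r * cis t)) * circ_l2 (\<lambda>t. Y (of_real r * cis t)))"
        by (intro circ_mean_bounded_mult_le cont_punctured_circle[OF E_holo] disk_alg_cont_circle y Y Er) (use r in auto)
      also have "\<dots> \<le> 1 / 4 * ?N"
        using y Y r by (intro mult_left_mono mult_mono disk_alg_l2_dilate circ_l2_nonneg disk_alg_cont_circle disk_alg_cont) auto
      finally show ?thesis .
    qed
    finally show ?thesis by (simp add: mult.commute)
  qed
  then show ?thesis by blast
qed

text \<open>The factor \<open>exp (- c n / T)\<close> gained by the shift is traded for \<open>(T / n) ^ (k + 1)\<close>, so that the steps \<open>T = T\<^sub>0 2\<^sup>i\<close> sum to a
  multiple of the last one.\<close>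
lemma ladder_step:
  assumes A: "0 < A" "A \<le> 1" and T: "T \<ge> T0" "1 \<le> T0"
    and dec: "\<And>T s n t. T \<ge> T0 \<Longrightarrow> s \<ge> 0 \<Longrightarrow> s * real T \<le> A \<Longrightarrow>
      norm (E n T (of_real (exp (- s)) * cis t)) \<le> exp (- (real n * (c0 / 2) * s))"
    and Y: "disk_alg Y" and m: "real m \<le> c0 / 4 * real n" and n: "n \<ge> 1"
  shows "norm (circ_mean (\<lambda>t. (E n (2 * T) (cis t) - E n T (cis t)) * Y (cis t) * cis (- real m * t)))
          \<le> 6 * L * fact (k + 1) / (c0 * A / 8) ^ (k + 1) / real n ^ k * real T * circ_l2 (\<lambda>t. Y (cis t))"
proof -
  \<comment> \<open>The largest \<open>s\<close> for which \<open>dec\<close> covers both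
    truncations, \<open>T\<close> and \<open>2 T\<close>.\<close>
  define s where "s = A / (2 * real T)"
  define r where "r = exp (- s)"
  have T1: "T \<ge> 1" using T by simp
  have s: "s > 0" "s * (2 * real T) = A" "s * real T \<le> A" using A T1 by (auto simp: s_def)
  have r: "0 < r" "r < 1" using s by (auto simp: r_def)
  define X where "X z = E n (2 * T) z - E n T z" for z
  have X: "X holomorphic_on - {0}" unfolding X_def by (intro holomorphic_intros E_holo)
  define M where "M = exp (- (real n * (c0 / 2) * s))"
  have EM: "norm (E n (2 * T) (of_real r * cis t)) \<le> M" "norm (E n T (of_real r * cis t)) \<le> M" for t
    unfolding M_def r_def using s T by (intro dec; simp)+
  \<comment> \<open>The coefficients \<open>T <= j < 2 T\<close> are all that distinguishes the two
    phases. On the smaller circle the negative frequencies (\<open>cnj f1\<close>) grow by at most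
    \<open>exp 1 <= 3\<close>, and the positive ones (\<open>f2\<close>) shrink.\<close>
  define f1 where "f1 t = (\<Sum>j\<in>{T..<2*T}. (a j / of_real r ^ j) * cis (real j * t))" for t
  define f2 where "f2 t = (\<Sum>j\<in>{T..<2*T}. (- a j * of_real r ^ j) * cis (real j * t))" for t
  have fc: "continuous_on B f1" "continuous_on B f2" for B
    unfolding f1_def f2_def by (intro continuous_intros; use r in simp)+
  have pd: "phi (2 * T) (of_real r * cis t) - phi T (of_real r * cis t) = cnj (f1 t) + f2 t" for t
  proof -
    have "{..<2*T} = {..<T} \<union> {T..<2*T}" by auto
    then have "phi (2 * T) z - phi T z = (\<Sum>j\<in>{T..<2*T}. cnj (a j) / z ^ j - a j * z ^ j)" for z
      unfolding phi_def by (simp add: sum.union_disjoint ivl_disj_int)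
    then show ?thesis
      by (simp add: f1_def f2_def power_mult_distrib Complex.DeMoivre divide_inverse cis_inverse cis_cnj mult_ac
          sum_subtractf sum_negf)
  qed
  have rj: "exp (real j * s) \<le> 3" if "j < 2 * T" for j
  proof -
    have "real j * s \<le> real (2 * T) * s" using that s by (intro mult_right_mono) auto
    then have "real j * s \<le> 1" using s(2) A by (simp add: mult_ac)
    then have "exp (real j * s) \<le> exp 1" by simp
    then show ?thesis using exp_le by linarith
  qed
  have fl: "circ_l2 (\<lambda>t. \<Sum>j\<in>{T..<2*T}. b j * cis (real j * t)) \<le> 3 * (L / real T ^ k)"
    if b: "\<And>j. j \<in> {T..<2*T} \<Longrightarrow> norm (b j) \<le> 3 * norm (a j)" for b
  proof (rule power2_le_imp_le)
    have "(circ_l2 (\<lambda>t. \<Sum>j\<in>{T..<2*T}. b j * cis (real j * t)))\<^sup>2 = (\<Sum>j\<in>{T..<2*T}. (norm (b j))\<^sup>2)"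
      using circ_l2_trig_poly[of "int ` {T..<2*T}" "\<lambda>j. b (nat j)"] by (simp add: sum.reindex)
    also have "\<dots> \<le> (\<Sum>j\<in>{T..<2*T}. (3 * norm (a j))\<^sup>2)" using b by (intro sum_mono power_mono) auto
    also have "\<dots> = 9 * (\<Sum>j\<in>{T..<2*T}. (norm (a j))\<^sup>2)" by (simp add: sum_distrib_left power_mult_distrib)
    also have "\<dots> \<le> 9 * (L / real T ^ k)\<^sup>2" by (intro mult_left_mono sob_tail T1) auto
    finally show "(circ_l2 (\<lambda>t. \<Sum>j\<in>{T..<2*T}. b j * cis (real j * t)))\<^sup>2 \<le> (3 * (L / real T ^ k))\<^sup>2"
      by (simp only: power_mult_distrib) simp
  qed (use L in auto)
  have f1l: "circ_l2 f1 \<le> 3 * (L / real T ^ k)" unfolding f1_def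
  proof (rule fl)
    fix j assume j: "j \<in> {T..<2*T}"
    have "norm (a j / of_real r ^ j) = norm (a j) * exp (real j * s)"
      using divide_exp_minus_power[of "norm (a j)" s j] by (simp add: norm_divide norm_power r_def)
    also have "\<dots> \<le> norm (a j) * 3" using rj[of j] j by (intro mult_left_mono) auto
    finally show "norm (a j / of_real r ^ j) \<le> 3 * norm (a j)" by simp
  qed
  have f2l: "circ_l2 f2 \<le> 3 * (L / real T ^ k)" unfolding f2_def
  proof (rule fl)
    fix j
    have "norm (- a j * of_real r ^ j) = norm (a j) * r ^ j" using r by (simp add: norm_mult norm_power)
    also have "\<dots> \<le> norm (a j) * 1" using r by (intro mult_left_mono power_le_one) auto
    also have "\<dots> \<le> 3 * norm (a j)" by simp
    finally show "norm (- a j * of_real r ^ j) \<le> 3 * norm (a j)" .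
  qed
  have Xb: "norm (X (of_real r * cis t)) \<le> norm (of_real (M * real n) * (cnj (f1 t) + f2 t))" for t
  proof -
    define z where "z = of_real r * cis t"
    have nz: "norm z = r" using r by (simp add: z_def norm_mult)
    \<comment> \<open>Dividing out \<open>|z ^ n| = r ^ n\<close> turns the bound \<open>M\<close>
      on \<open>E\<close> into one on the exponentials alone, as required by
      \<open>norm_exp_diff_le\<close>; the factor cancels afterwards.\<close>
    have e: "exp (Re (of_nat n * phi T' z)) \<le> M / r ^ n" if "norm (E n T' z) \<le> M" for T'
      using that r by (simp add: E_def norm_mult norm_power nz field_simps)
    have "X z = z ^ n * (exp (of_nat n * phi (2 * T) z) - exp (of_nat n * phi T z))"
      by (simp add: X_def E_def algebra_simps)
    then have "norm (X z) = r ^ n * norm (exp (of_nat n * phi (2 * T) z) - exp (of_nat n * phi T z))"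
      by (simp add: norm_mult norm_power nz)
    also have "\<dots> \<le> r ^ n * (M / r ^ n * norm (of_nat n * phi (2 * T) z - of_nat n * phi T z))"
      using r EM[of t] by (intro mult_left_mono norm_exp_diff_le e) (auto simp: z_def)
    also have "\<dots> = M * norm (of_nat n * (phi (2 * T) z - phi T z))" using r by (simp add: right_diff_distrib)
    also have "\<dots> = norm (of_real (M * real n) * (cnj (f1 t) + f2 t))"
      unfolding z_def pd by (simp add: norm_mult M_def)
    finally show ?thesis by (simp add: z_def)
  qed
  have Xl: "circ_l2 (\<lambda>t. X (of_real r * cis t)) \<le> M * real n * (6 * (L / real T ^ k))"
  proof -
    have "circ_l2 (\<lambda>t. X (of_real r * cis t)) \<le> circ_l2 (\<lambda>t. of_real (M * real n) * (cnj (f1 t) + f2 t))"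
      by (intro circ_l2_mono continuous_intros fc Xb cont_punctured_circle X) (use r in auto)
    also have "\<dots> = M * real n * circ_l2 (\<lambda>t. cnj (f1 t) + f2 t)"
      by (subst circ_l2_cmult) (simp add: norm_mult M_def)
    also have "\<dots> \<le> M * real n * (circ_l2 (\<lambda>t. cnj (f1 t)) + circ_l2 f2)"
      by (intro mult_left_mono circ_l2_triangle continuous_intros fc) (auto simp: M_def)
    also have "circ_l2 (\<lambda>t. cnj (f1 t)) = circ_l2 f1" by (simp add: circ_l2_def)
    also have "M * real n * (circ_l2 f1 + circ_l2 f2) \<le> M * real n * (6 * (L / real T ^ k))"
      using f1l f2l by (intro mult_left_mono) (auto simp: M_def)
    finally show ?thesis .
  qed
  define al where "al = c0 * A / 8"
  have al: "al > 0" using c0 A by (simp add: al_def)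
  have yn: "0 \<le> circ_l2 (\<lambda>t. Y (cis t))" by (intro circ_l2_nonneg disk_alg_cont Y)
  \<comment> \<open>By \<open>m <= c0 n / 4\<close>, half of the exponent
    \<open>n (c0 / 2) s\<close> pays for \<open>r ^ m\<close>. The other half is
    \<open>al n / T\<close>, and the power \<open>k + 1\<close> leaves one factor \<open>T\<close>
    after the loss \<open>n / T ^ k\<close>.\<close>
  have Mr: "M / r ^ m \<le> fact (k + 1) * (real T / (al * real n)) ^ (k + 1)"
  proof -
    have "M / r ^ m = exp (real m * s - real n * (c0 / 2) * s)"
      unfolding r_def divide_exp_minus_power by (simp only: M_def diff_conv_add_uminus exp_add mult_ac)
    also have "\<dots> \<le> exp (- (al * real n / real T))"
    proof -
      have "real m * s \<le> (c0 / 4 * real n) * s" using m s by (intro mult_right_mono) auto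
      moreover have "al * real n / real T = real n * (c0 / 4) * s" by (simp add: al_def s_def)
      moreover have "real n * (c0 / 2) * s = 2 * (real n * (c0 / 4) * s)" "c0 / 4 * real n * s = real n * (c0 / 4) * s" by simp_all
      ultimately have "real m * s - real n * (c0 / 2) * s \<le> - (al * real n / real T)" by linarith
      then show ?thesis by (simp only: exp_le_cancel_iff)
    qed
    also have "\<dots> \<le> fact (k + 1) / (al * real n / real T) ^ (k + 1)"
      using al n T1 by (intro exp_minus_le) auto
    also have "\<dots> = fact (k + 1) * (real T / (al * real n)) ^ (k + 1)"
      by (simp add: power_divide)
    finally show ?thesis .
  qed
  have "norm (circ_mean (\<lambda>t. X (cis t) * Y (cis t) * cis (- real m * t))) \<le>
      circ_l2 (\<lambda>t. X (of_real r * cis t)) * circ_l2 (\<lambda>t. Y (cis t)) / r ^ m"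
    by (rule shift_l2_le[OF X Y r])
  also have "\<dots> \<le> (M * real n * (6 * (L / real T ^ k))) * circ_l2 (\<lambda>t. Y (cis t)) / r ^ m"
    using r by (intro divide_right_mono mult_right_mono Xl yn) auto
  also have "\<dots> = (M / r ^ m) * (real n * (6 * (L / real T ^ k)) * circ_l2 (\<lambda>t. Y (cis t)))"
    by (simp only: divide_inverse mult_ac)
  also have "\<dots> \<le> (fact (k + 1) * (real T / (al * real n)) ^ (k + 1)) * (real n * (6 * (L / real T ^ k)) * circ_l2 (\<lambda>t. Y (cis t)))"
    using L yn by (intro mult_right_mono Mr) auto
  also have "\<dots> = 6 * L * fact (k + 1) / al ^ (k + 1) / real n ^ k * real T * circ_l2 (\<lambda>t. Y (cis t))"
    using T1 n al by (simp add: power_divide power_mult_distrib field_simps)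
  finally show ?thesis by (simp add: X_def al_def)
qed

text \<open>Telescope \<open>u\<close> along \<open>T0 2^i\<close> up to about \<open>n\<close>: the
  first truncation is exponentially small, the steps form a geometric sum dominated by
  \<open>T = n\<close>, and the last remainder is \<open>O(n n^(-k))\<close> in square mean. Each
  part is \<open>O(n^(1-k))\<close>.\<close>

lemma hankel_decay:
  "\<exists>C n0. C \<ge> 0 \<and> (\<forall>n\<ge>n0. \<forall>m Y. real m \<le> c0 / 4 * real n \<longrightarrow> disk_alg Y \<longrightarrow>
     norm (circ_mean (\<lambda>t. u n t * Y (cis t) * cis (- real m * t))) \<le> C / real n ^ (k - 1) * circ_l2 (\<lambda>t. Y (cis t)))"
proof -
  obtain A T0 where A: "0 < A" "A \<le> 1" and T0: "1 \<le> T0"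
    and dec: "\<And>T s n t. T \<ge> T0 \<Longrightarrow> s \<ge> 0 \<Longrightarrow> s * real T \<le> A \<Longrightarrow>
      norm (E n T (of_real (exp (- s)) * cis t)) \<le> exp (- (real n * (c0 / 2) * s))"
    using decay by blast
  define C1 where "C1 = 6 * L * fact (k + 1) / (c0 * A / 8) ^ (k + 1)"
  define be where "be = c0 / 4 * (A / real T0)"
  define C2 where "C2 = fact (k - 1) / be ^ (k - 1)"
  define C3 where "C3 = 2 * L * 2 ^ k"
  have be: "be > 0" using c0 A T0 by (simp add: be_def)
  have C: "0 \<le> C1" "0 \<le> C2" "0 \<le> C3" using L c0 A be by (auto simp: C1_def C2_def C3_def)
  have "norm (circ_mean (\<lambda>t. u n t * Y (cis t) * cis (- real m * t))) \<le> (C1 + C2 + C3) / real n ^ (k - 1) * circ_l2 (\<lambda>t. Y (cis t))"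
    if n: "n \<ge> T0" and m: "real m \<le> c0 / 4 * real n" and Y: "disk_alg Y" for n m Y
  proof -
    have n1: "n \<ge> 1" using n T0 by simp
    define D where "D = circ_l2 (\<lambda>t. Y (cis t))"
    have D: "0 \<le> D" unfolding D_def by (intro circ_l2_nonneg disk_alg_cont Y)
    \<comment> \<open>The last dyadic level not above \<open>n\<close>, hence above
      \<open>n / 2\<close>.\<close>
    obtain q where q: "T0 * 2 ^ q \<le> n" "n < T0 * 2 ^ Suc q"
    proof -
      have "\<exists>q. n < T0 * 2 ^ q"
        by (rule exI[of _ n]) (metis T0 less_exp less_le_trans mult.left_neutral mult_le_mono1)
      define q where "q = (LEAST q. n < T0 * 2 ^ q)"
      have q: "n < T0 * 2 ^ q" "\<And>i. i < q \<Longrightarrow> \<not> n < T0 * 2 ^ i"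
        using LeastI_ex[OF \<open>\<exists>q. n < T0 * 2 ^ q\<close>] not_less_Least unfolding q_def by blast+
      have "q \<noteq> 0" using q(1) n by (cases q) auto
      then obtain q' where "q = Suc q'" by (cases q) auto
      then show ?thesis using that[of q'] q(1) q(2)[of q'] by auto
    qed
    define b where "b i = circ_mean (\<lambda>t. E n (T0 * 2 ^ i) (cis t) * Y (cis t) * cis (- real m * t))" for i
    note ci = continuous_intros u_cont E_cont_circle disk_alg_cont[OF Y]
    have step: "norm (b (Suc i)) \<le> norm (b i) + C1 / real n ^ k * real (T0 * 2 ^ i) * D" for i
    proof -
      have "b (Suc i) = b i + circ_mean (\<lambda>t. (E n (2 * (T0 * 2 ^ i)) (cis t) - E n (T0 * 2 ^ i) (cis t)) * Y (cis t) * cis (- real m * t))"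
        unfolding b_def by (subst circ_mean_add[symmetric], (intro ci)+) (simp add: algebra_simps)
      then have "norm (b (Suc i)) \<le> norm (b i) + norm (circ_mean (\<lambda>t. (E n (2 * (T0 * 2 ^ i)) (cis t) - E n (T0 * 2 ^ i) (cis t)) * Y (cis t) * cis (- real m * t)))"
        by (simp add: norm_triangle_ineq)
      also have "norm (circ_mean (\<lambda>t. (E n (2 * (T0 * 2 ^ i)) (cis t) - E n (T0 * 2 ^ i) (cis t)) * Y (cis t) * cis (- real m * t))) \<le> C1 / real n ^ k * real (T0 * 2 ^ i) * D"
        unfolding C1_def D_def by (rule ladder_step[OF A _ T0 dec Y m n1]) auto
      finally show ?thesis by simp
    qed
    \<comment> \<open>The increments up to level \<open>i\<close> add up to less than the next one,
      so the bound for level \<open>i\<close> keeps the form of a single increment.\<close>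
    have sumb: "norm (b i) \<le> norm (b 0) + C1 / real n ^ k * real (T0 * 2 ^ i) * D" for i
    proof (induction i)
      case 0 then show ?case using C D by simp
    next
      case (Suc i)
      have "norm (b (Suc i)) \<le> norm (b 0) + C1 / real n ^ k * real (T0 * 2 ^ i) * D + C1 / real n ^ k * real (T0 * 2 ^ i) * D"
        using step[of i] Suc by linarith
      also have "\<dots> = norm (b 0) + C1 / real n ^ k * real (T0 * 2 ^ Suc i) * D" by simp
      finally show ?case .
    qed
    have kk: "real n ^ k = real n * real n ^ (k - 1)" using k2 by (cases k) auto
    have t1: "C1 / real n ^ k * real (T0 * 2 ^ q) * D \<le> C1 / real n ^ (k - 1) * D"
    proof -
      have "real (T0 * 2 ^ q) \<le> real n" using q(1) by (simp only: of_nat_le_iff)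
      then have "C1 / real n ^ k * real (T0 * 2 ^ q) * D \<le> C1 / real n ^ k * real n * D"
        using C D by (intro mult_right_mono mult_left_mono) auto
      also have "\<dots> = C1 / real n ^ (k - 1) * D" using n1 by (simp add: kk)
      finally show ?thesis .
    qed
    \<comment> \<open>For the fixed truncation \<open>T0\<close> the radius does not depend on
      \<open>n\<close>, so the decay is \<open>exp (- be n)\<close>, traded for the power
      \<open>k - 1\<close>.\<close>
    have t2: "norm (b 0) \<le> C2 / real n ^ (k - 1) * D"
    proof -
      define s where "s = A / real T0"
      define r where "r = exp (- s)"
      have s: "s > 0" "s * real T0 = A" using A T0 by (auto simp: s_def)
      have r: "0 < r" "r < 1" using s by (auto simp: r_def)
      have "norm (b 0) \<le> circ_l2 (\<lambda>t. E n T0 (of_real r * cis t)) * D / r ^ m"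
        unfolding b_def D_def using shift_l2_le[OF E_holo Y r, of n T0 m] by simp
      also have "\<dots> \<le> exp (- (real n * (c0 / 2) * s)) * D / r ^ m"
      proof (intro divide_right_mono mult_right_mono D)
        show "circ_l2 (\<lambda>t. E n T0 (of_real r * cis t)) \<le> exp (- (real n * (c0 / 2) * s))"
          unfolding r_def using s by (intro circ_l2_bound cont_punctured_circle E_holo dec) auto
      qed (use r in auto)
      also have "\<dots> = exp (real m * s - real n * (c0 / 2) * s) * D"
        unfolding r_def divide_exp_minus_power by (simp only: diff_conv_add_uminus exp_add mult_ac)
      also have "\<dots> \<le> exp (- (be * real n)) * D"
      proof (intro mult_right_mono D)
        have "real m * s \<le> (c0 / 4 * real n) * s" using m s by (intro mult_right_mono) auto
        moreover have "be * real n = real n * (c0 / 4) * s" by (simp add: be_def s_def)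
        moreover have "real n * (c0 / 2) * s = 2 * (real n * (c0 / 4) * s)" "c0 / 4 * real n * s = real n * (c0 / 4) * s" by simp_all
        ultimately have "real m * s - real n * (c0 / 2) * s \<le> - (be * real n)" by linarith
        then show "exp (real m * s - real n * (c0 / 2) * s) \<le> exp (- (be * real n))" by (simp only: exp_le_cancel_iff)
      qed
      also have "\<dots> \<le> (fact (k - 1) / (be * real n) ^ (k - 1)) * D"
        using be n1 D by (intro mult_right_mono exp_minus_le) auto
      also have "\<dots> = C2 / real n ^ (k - 1) * D" by (simp add: C2_def power_mult_distrib)
      finally show ?thesis .
    qed
    let ?T = "T0 * 2 ^ q"
    have t3: "norm (circ_mean (\<lambda>t. (u n t - E n ?T (cis t)) * (Y (cis t) * cis (- real m * t)))) \<le> C3 / real n ^ (k - 1) * D"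
    proof -
      have T: "?T \<ge> 1" "real n \<le> 2 * real ?T"
      proof -
        show "?T \<ge> 1" using T0 by simp
        have "n \<le> 2 * ?T" using q(2) by simp
        then have "real n \<le> real (2 * ?T)" by (simp only: of_nat_le_iff)
        then show "real n \<le> 2 * real ?T" by simp
      qed
      have "norm (circ_mean (\<lambda>t. (u n t - E n ?T (cis t)) * (Y (cis t) * cis (- real m * t)))) \<le>
         circ_l2 (\<lambda>t. u n t - E n ?T (cis t)) * circ_l2 (\<lambda>t. Y (cis t) * cis (- real m * t))"
        by (intro circ_mean_mult_le ci)
      also have "circ_l2 (\<lambda>t. Y (cis t) * cis (- real m * t)) = D" by (simp add: D_def circ_l2_def norm_mult)
      also have "circ_l2 (\<lambda>t. u n t - E n ?T (cis t)) * D \<le> C3 / real n ^ (k - 1) * D"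
      proof (intro mult_right_mono D)
        have "circ_l2 (\<lambda>t. u n t - E n ?T (cis t)) \<le> circ_l2 (\<lambda>t. of_real (2 * real n) * R ?T t)"
          by (intro circ_l2_mono ci R_cont) (use u_minus_E[of n _ ?T] in \<open>simp add: norm_mult\<close>)
        also have "\<dots> = 2 * real n * circ_l2 (R ?T)" by (subst circ_l2_cmult) (simp add: norm_mult)
        also have "\<dots> \<le> 2 * real n * (L / real ?T ^ k)" by (intro mult_left_mono R_l2 T) auto
        also have "\<dots> \<le> 2 * real n * (L * 2 ^ k / real n ^ k)"
        proof (intro mult_left_mono)
          have "real n ^ k \<le> (2 * real ?T) ^ k" using T by (intro power_mono) auto
          then have "L * real n ^ k \<le> L * (2 ^ k * real ?T ^ k)" using L by (intro mult_left_mono) (auto simp: power_mult_distrib)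
          then show "L / real ?T ^ k \<le> L * 2 ^ k / real n ^ k"
            using T n1 T0 by (simp add: divide_le_eq le_divide_eq field_simps)
        qed auto
        also have "\<dots> = C3 / real n ^ (k - 1)" using n1 by (simp add: kk C3_def)
        finally show "circ_l2 (\<lambda>t. u n t - E n ?T (cis t)) \<le> C3 / real n ^ (k - 1)" .
      qed
      finally show ?thesis .
    qed
    have "circ_mean (\<lambda>t. u n t * Y (cis t) * cis (- real m * t)) = 
      circ_mean (\<lambda>t. (u n t - E n ?T (cis t)) * (Y (cis t) * cis (- real m * t))) + b q"
      unfolding b_def by (subst circ_mean_add[symmetric], (intro ci)+) (simp add: algebra_simps)
    then have "norm (circ_mean (\<lambda>t. u n t * Y (cis t) * cis (- real m * t))) \<le>
       norm (circ_mean (\<lambda>t. (u n t - E n ?T (cis t)) * (Y (cis t) * cis (- real m * t)))) + norm (b q)"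
      by (simp add: norm_triangle_ineq)
    also have "\<dots> \<le> C3 / real n ^ (k - 1) * D + (C2 / real n ^ (k - 1) * D + C1 / real n ^ (k - 1) * D)"
      using t1 t2 t3 sumb[of q] by linarith
    also have "\<dots> = (C1 + C2 + C3) / real n ^ (k - 1) * D" by (simp add: add_divide_distrib algebra_simps)
    finally show ?thesis by (simp add: D_def)
  qed
  then show ?thesis using C by (intro exI[of _ "C1 + C2 + C3"] exI[of _ T0]) auto
qed

end

section \<open>The Hardy space system\<close>

context phase
begin

text \<open>As \<open>u\<close> is unimodular, the second circle equation is \<open>u\<close> times
  the first, with \<open>Q = u cnj G\<close>. Analyticity of \<open>G\<close> and of
  \<open>Q\<close> supplies one vanishing mean for each equation.\<close>

definition hardy_system :: "nat \<Rightarrow> (complex \<Rightarrow> complex) \<Rightarrow> (complex \<Rightarrow> complex) \<Rightarrow> (complex \<Rightarrow> complex) \<Rightarrow> (complex \<Rightarrow> complex) \<Rightarrow> bool" where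
  "hardy_system n G v W Q \<longleftrightarrow> disk_alg G \<and> disk_alg v \<and> disk_alg W \<and> disk_alg Q \<and> G 0 = 1 \<and> W 0 = 0 \<and>
     (\<forall>t. cnj (G (cis t)) = v (cis t) + cnj (u n t * W (cis t))) \<and>
     (\<forall>t. u n t * v (cis t) + cnj (W (cis t)) = Q (cis t))"

text \<open>An energy estimate: pair the first equation, less 1, with \<open>v - 1\<close> and the
  second with \<open>W\<close>. Both produce the coupling term \<open>u (v - 1) W\<close>, which
  \<open>con\<close> makes small enough to absorb.\<close>

lemma hardy_system_l2_le:
  assumes sys: "hardy_system n G v W Q"
    and con: "\<And>y Y. disk_alg y \<Longrightarrow> disk_alg Y \<Longrightarrow>
      norm (circ_mean (\<lambda>t. u n t * (y (cis t) * Y (cis t)))) \<le> 1/2 * (circ_l2 (\<lambda>t. y (cis t)) * circ_l2 (\<lambda>t. Y (cis t)))"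
    and eps: "norm (circ_mean (\<lambda>t. u n t * W (cis t))) \<le> e * circ_l2 (\<lambda>t. W (cis t))" and e: "0 \<le> e"
  shows "circ_l2 (\<lambda>t. W (cis t)) \<le> 2 * e"
proof -
  have G: "disk_alg G" and v: "disk_alg v" and W: "disk_alg W" and Q: "disk_alg Q" and G0: "G 0 = 1" and W0: "W 0 = 0"
    and i: "\<And>t. cnj (G (cis t)) = v (cis t) + cnj (u n t * W (cis t))"
    and ii: "\<And>t. u n t * v (cis t) + cnj (W (cis t)) = Q (cis t)"
    using sys by (auto simp: hardy_system_def)
  note ci = continuous_intros u_cont disk_alg_cont[OF G] disk_alg_cont[OF v] disk_alg_cont[OF W] disk_alg_cont[OF Q]
  define w where "w = circ_l2 (\<lambda>t. W (cis t))"
  define x where "x = circ_l2 (\<lambda>t. v (cis t) - 1)"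
  have wx: "0 \<le> w" "0 \<le> x" unfolding w_def x_def by (intro circ_l2_nonneg ci)+
  have v1: "disk_alg (\<lambda>z. v z - 1)" by (intro disk_alg_intros v)
  have vW: "norm (circ_mean (\<lambda>t. u n t * ((v (cis t) - 1) * W (cis t)))) \<le> 1/2 * (x * w)"
    unfolding x_def w_def by (rule con[OF v1 W])
  \<comment> \<open>The part containing \<open>G - 1\<close> has mean zero because
    \<open>G 0 = 1\<close>; the coupling term alone is left, whence
    \<open>x <= w / 2\<close>.\<close>
  have "(v (cis t) - 1) * cnj (v (cis t) - 1) = cnj ((G (cis t) - 1) * (v (cis t) - 1)) - cnj (u n t * ((v (cis t) - 1) * W (cis t)))" for t
  proof -
    have "v (cis t) - 1 = cnj (G (cis t) - 1) - cnj (u n t * W (cis t))" by (simp add: i)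
    then have "(v (cis t) - 1) * cnj (v (cis t) - 1) = (cnj (G (cis t) - 1) - cnj (u n t * W (cis t))) * cnj (v (cis t) - 1)" by simp
    then show ?thesis by (simp add: algebra_simps)
  qed
  then have "complex_of_real (x\<^sup>2) = circ_mean (\<lambda>t. cnj ((G (cis t) - 1) * (v (cis t) - 1)) - cnj (u n t * ((v (cis t) - 1) * W (cis t))))"
    unfolding x_def by (subst circ_l2_square_eq_mean[symmetric]) (auto intro!: ci)
  also have "\<dots> = circ_mean (\<lambda>t. cnj ((G (cis t) - 1) * (v (cis t) - 1))) - circ_mean (\<lambda>t. cnj (u n t * ((v (cis t) - 1) * W (cis t))))"
    by (intro circ_mean_diff ci)
  also have "circ_mean (\<lambda>t. cnj ((G (cis t) - 1) * (v (cis t) - 1))) = 0"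
    using disk_alg_mean[of "\<lambda>z. (G z - 1) * (v z - 1)"] by (simp only: circ_mean_cnj) (simp add: disk_alg_intros G v G0)
  finally have "x\<^sup>2 = norm (circ_mean (\<lambda>t. u n t * ((v (cis t) - 1) * W (cis t))))"
    by (simp only: circ_mean_cnj diff_0) (metis abs_of_nonneg complex_mod_cnj norm_minus_cancel norm_of_real zero_le_power2)
  then have "x * x \<le> x * (w / 2)" using vW by (simp add: power2_eq_square)
  then have xw: "x \<le> w / 2" using wx by (cases "x = 0") (auto simp: mult_le_cancel_left)
  \<comment> \<open>Here \<open>W Q\<close> has mean zero because \<open>W 0 = 0\<close>.\<close>
  have "W (cis t) * cnj (W (cis t)) = W (cis t) * Q (cis t) - (u n t * W (cis t) + u n t * ((v (cis t) - 1) * W (cis t)))" for t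
    by (simp add: ii[of t, symmetric] algebra_simps)
  then have "complex_of_real (w\<^sup>2) = circ_mean (\<lambda>t. W (cis t) * Q (cis t) - (u n t * W (cis t) + u n t * ((v (cis t) - 1) * W (cis t))))"
    unfolding w_def by (subst circ_l2_square_eq_mean[symmetric]) (auto intro!: ci)
  also have "\<dots> = circ_mean (\<lambda>t. W (cis t) * Q (cis t)) - (circ_mean (\<lambda>t. u n t * W (cis t)) + circ_mean (\<lambda>t. u n t * ((v (cis t) - 1) * W (cis t))))"
    by (subst circ_mean_diff, (intro ci)+, subst circ_mean_add, (intro ci)+) simp
  also have "circ_mean (\<lambda>t. W (cis t) * Q (cis t)) = 0"
    using disk_alg_mean[of "\<lambda>z. W z * Q z"] by (simp add: disk_alg_intros W Q W0)
  finally have "norm (complex_of_real (w\<^sup>2)) = norm (circ_mean (\<lambda>t. u n t * W (cis t)) + circ_mean (\<lambda>t. u n t * ((v (cis t) - 1) * W (cis t))))"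
    by (simp only: diff_0 norm_minus_cancel)
  then have "w\<^sup>2 \<le> norm (circ_mean (\<lambda>t. u n t * W (cis t))) + norm (circ_mean (\<lambda>t. u n t * ((v (cis t) - 1) * W (cis t))))"
    by (simp add: norm_triangle_ineq norm_power)
  also have "\<dots> \<le> e * w + 1/2 * (x * w)" using eps vW by (simp add: w_def)
  also have "\<dots> \<le> e * w + 1/2 * (w / 2 * w)" using xw wx by (intro add_left_mono mult_left_mono mult_right_mono) auto
  \<comment> \<open>The coupling contributes at most \<open>w^2 / 4\<close>, which is moved to the
    left-hand side.\<close>
  finally have "w * (3/4 * w) \<le> w * e" by (simp add: power2_eq_square algebra_simps)
  then have "3/4 * w \<le> e" using wx e by (cases "w = 0") (auto simp: mult_le_cancel_left)
  then show ?thesis using e wx by (simp add: w_def)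
qed

text \<open>Paired with \<open>cis (m t)\<close>, \<open>m >= 1\<close>, the analytic
  \<open>v\<close> has mean zero, so the negative frequencies of \<open>cnj G\<close> come from
  \<open>cnj (u W)\<close> alone.\<close>

lemma hardy_system_coeff:
  assumes sys: "hardy_system n G v W Q" and m: "m \<ge> 1"
  shows "norm (fourier_c (\<lambda>t. G (cis t)) (int m)) = norm (circ_mean (\<lambda>t. u n t * W (cis t) * cis (- real m * t)))"
proof -
  have G: "disk_alg G" and v: "disk_alg v" and W: "disk_alg W"
    and i: "\<And>t. cnj (G (cis t)) = v (cis t) + cnj (u n t * W (cis t))"
    using sys by (auto simp: hardy_system_def)
  note ci = continuous_intros u_cont disk_alg_cont[OF G] disk_alg_cont[OF v] disk_alg_cont[OF W]
  have "cnj (fourier_c (\<lambda>t. G (cis t)) (int m)) = circ_mean (\<lambda>t. v (cis t) * cis (real m * t) + cnj (u n t * W (cis t) * cis (- real m * t)))"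
    unfolding fourier_c_def circ_mean_cnj[symmetric] by (simp add: i cis_cnj algebra_simps)
  also have "\<dots> = circ_mean (\<lambda>t. v (cis t) * cis (real m * t)) + circ_mean (\<lambda>t. cnj (u n t * W (cis t) * cis (- real m * t)))"
    by (intro circ_mean_add ci)
  also have "circ_mean (\<lambda>t. v (cis t) * cis (real m * t)) = 0" by (rule disk_alg_mean_cis[OF v m])
  finally show ?thesis by (metis add_0 circ_mean_cnj complex_mod_cnj)
qed

text \<open>Sum the Taylor series of \<open>G - 1\<close>. For \<open>m <= c0 n / 4\<close> the
  coefficient is \<open>O(n^(1-k) w)\<close> by \<open>hankel_decay\<close>; for larger
  \<open>m\<close> it is at most \<open>w\<close>, but \<open>|z|^m\<close> is exponentially small.
  Since \<open>w = O(n^(1-k))\<close> itself, both ranges are of second order.\<close>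

lemma hardy_system_bound:
  assumes x: "0 < x" "x < 1"
  shows "\<exists>K n0. K \<ge> 0 \<and> (\<forall>n\<ge>n0. \<forall>G v W Q z. hardy_system n G v W Q \<longrightarrow> norm z \<le> x \<longrightarrow>
           norm (G z - 1) \<le> K / real n ^ (2 * (k - 1)))"
proof -
  obtain n1 where con: "\<And>n y Y. n \<ge> n1 \<Longrightarrow> disk_alg y \<Longrightarrow> disk_alg Y \<Longrightarrow>
     norm (circ_mean (\<lambda>t. u n t * (y (cis t) * Y (cis t)))) \<le> 1/2 * (circ_l2 (\<lambda>t. y (cis t)) * circ_l2 (\<lambda>t. Y (cis t)))"
    using hankel_contraction by blast
  obtain C n2 where C: "C \<ge> 0" and dec: "\<And>n m Y. n \<ge> n2 \<Longrightarrow> real m \<le> c0 / 4 * real n \<Longrightarrow> disk_alg Y \<Longrightarrow>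
     norm (circ_mean (\<lambda>t. u n t * Y (cis t) * cis (- real m * t))) \<le> C / real n ^ (k - 1) * circ_l2 (\<lambda>t. Y (cis t))"
    using hankel_decay by blast
  \<comment> \<open>Splitting \<open>|z|^m <= y^m y^m\<close> leaves one factor for the smallness at
    high frequencies and one for the geometric series.\<close>
  define y where "y = sqrt x"
  have y: "0 < y" "y < 1" "y * y = x" using x by (auto simp: y_def)
  \<comment> \<open>Then \<open>y ^ m <= exp (- la n)\<close> as soon as
    \<open>m > c0 n / 4\<close>.\<close>
  define la where "la = - ln y * (c0 / 4)"
  have la: "la > 0" using y c0 by (simp add: la_def mult_neg_pos)
  define C' where "C' = fact (k - 1) / la ^ (k - 1)"
  have C': "C' \<ge> 0" using la by (simp add: C'_def)
  define K where "K = (C * (2 * C) + 2 * C * C') * (1 / (1 - y))"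
  have K: "K \<ge> 0" using C C' y by (simp add: K_def)
  have "norm (G z - 1) \<le> K / real n ^ (2 * (k - 1))"
    if n: "n \<ge> max 1 (max n1 n2)" and sys: "hardy_system n G v W Q" and z: "norm z \<le> x" for n G v W Q z
  proof -
    have G: "disk_alg G" and W: "disk_alg W" and G0: "G 0 = 1" using sys by (auto simp: hardy_system_def)
    have n': "n \<ge> 1" "n \<ge> n1" "n \<ge> n2" using n by auto
    define N where "N = real n ^ (k - 1)"
    have N: "N > 0" using n' by (simp add: N_def)
    define w where "w = circ_l2 (\<lambda>t. W (cis t))"
    have w0: "0 \<le> w" unfolding w_def by (intro circ_l2_nonneg disk_alg_cont W)
    have w: "w \<le> 2 * (C / N)"
      unfolding w_def N_def
      by (rule hardy_system_l2_le[OF sys con]) (use n' C c0 dec[of n 0 W] W in auto)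
    define c where "c m = fourier_c (\<lambda>t. G (cis t)) (int m)" for m
    have zx: "norm z < 1" using z x by simp
    have sums: "(\<lambda>m. c m * z ^ m) sums G z"
      unfolding c_def by (rule disk_alg_taylor_coeffs(1)[OF G x zx])
    have c0': "c 0 = 1"
      using disk_alg_mean[OF G] G0 by (simp add: c_def fourier_c_def)
    define D where "D = C / N * w + w * (C' / N)"
    have D: "D \<ge> 0" using C C' N w0 by (simp add: D_def)
    have tm: "norm (c (Suc m) * z ^ Suc m) \<le> D * y ^ m" for m
    proof -
      have eq: "norm (c (Suc m)) = norm (circ_mean (\<lambda>t. u n t * W (cis t) * cis (- real (Suc m) * t)))"
        unfolding c_def by (rule hardy_system_coeff[OF sys]) simp
      have zp: "norm z ^ Suc m \<le> y ^ Suc m * y ^ Suc m"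
        using z by (simp only: power_mult_distrib[symmetric] y(3)) (intro power_mono, auto)
      have ym: "y ^ Suc m \<le> y ^ m" "y ^ Suc m \<le> 1" using y by (intro power_decreasing power_le_one; simp)+
      have cD: "norm (c (Suc m)) * y ^ Suc m \<le> D"
      proof (cases "real (Suc m) \<le> c0 / 4 * real n")
        case True
        have "norm (c (Suc m)) \<le> C / N * w" unfolding eq N_def w_def by (rule dec[OF n'(3) True W])
        then have "norm (c (Suc m)) * y ^ Suc m \<le> C / N * w * 1"
          using ym C N w0 y by (intro mult_mono) auto
        also have "\<dots> \<le> D" using w0 C' N by (simp add: D_def)
        finally show ?thesis .
      next
        case False
        have "norm (c (Suc m)) \<le> circ_l2 (\<lambda>t. u n t * W (cis t)) * circ_l2 (\<lambda>t. cis (- real (Suc m) * t))"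
          unfolding eq by (intro circ_mean_mult_le continuous_intros u_cont disk_alg_cont W)
        also have "\<dots> = w" by (simp add: circ_l2_def norm_mult norm_u w_def)
        finally have cw: "norm (c (Suc m)) \<le> w" .
        have "y ^ Suc m = exp (real (Suc m) * ln y)" using y by (simp add: exp_of_nat_mult del: of_nat_Suc)
        also have "\<dots> \<le> exp (- (la * real n))"
        proof -
          have "(- ln y) * (c0 / 4 * real n) \<le> (- ln y) * real (Suc m)"
            using False y by (intro mult_left_mono) auto
          then show ?thesis by (simp only: exp_le_cancel_iff) (simp add: la_def algebra_simps)
        qed
        also have "\<dots> \<le> fact (k - 1) / (la * real n) ^ (k - 1)" using la n' by (intro exp_minus_le) auto
        also have "\<dots> = C' / N" by (simp add: C'_def N_def power_mult_distrib)
        finally have "norm (c (Suc m)) * y ^ Suc m \<le> w * (C' / N)" using cw w0 y by (intro mult_mono) auto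
        also have "\<dots> \<le> D" using w0 C N by (simp add: D_def)
        finally show ?thesis .
      qed
      have "norm (c (Suc m) * z ^ Suc m) = norm (c (Suc m)) * norm z ^ Suc m" by (simp only: norm_mult norm_power)
      also have "\<dots> \<le> norm (c (Suc m)) * (y ^ Suc m * y ^ Suc m)" by (intro mult_left_mono zp) auto
      also have "\<dots> = (norm (c (Suc m)) * y ^ Suc m) * y ^ Suc m" by (simp only: mult.assoc)
      also have "\<dots> \<le> D * y ^ m" using cD ym D y by (intro mult_mono) auto
      finally show ?thesis .
    qed
    have geo: "(\<lambda>m. D * y ^ m) sums (D * (1 / (1 - y)))" using y by (intro sums_mult geometric_sums) auto
    have "(\<lambda>m. c (Suc m) * z ^ Suc m) sums (G z - 1)"
      using sums c0' by (subst sums_Suc_iff) simp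
    then have "G z - 1 = (\<Sum>m. c (Suc m) * z ^ Suc m)" by (rule sums_unique)
    also have "norm \<dots> \<le> (\<Sum>m. D * y ^ m)" by (intro norm_suminf_le tm sums_summable[OF geo])
    also have "\<dots> = D * (1 / (1 - y))" by (rule sums_unique[OF geo, symmetric])
    finally have "norm (G z - 1) \<le> D * (1 / (1 - y))" .
    also have "\<dots> \<le> (C / N * (2 * (C / N)) + 2 * (C / N) * (C' / N)) * (1 / (1 - y))"
      unfolding D_def using w C C' N y by (intro mult_right_mono add_mono mult_left_mono) auto
    also have "\<dots> = K / (N * N)" using N by (simp add: K_def field_simps)
    also have "N * N = real n ^ (2 * (k - 1))" by (simp add: N_def mult_2 power_add)
    finally show ?thesis .
  qed
  then show ?thesis using K by (intro exI[of _ K] exI[of _ "max 1 (max n1 n2)"]) auto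
qed

end

section \<open>Regularity of the potential\<close>

text \<open>Boundedness is included because it makes the class closed under products and
  exponentials.\<close>

definition lip_bounded :: "(real \<Rightarrow> complex) \<Rightarrow> bool" where
  "lip_bounded f \<longleftrightarrow> (\<exists>B. \<forall>x. norm (f x) \<le> B) \<and> (\<exists>L. \<forall>x y. norm (f x - f y) \<le> L * \<bar>x - y\<bar>)"

lemma lip_bounded_const: "lip_bounded (\<lambda>x. c)"
  unfolding lip_bounded_def by (intro conjI exI[of _ "norm c"]) auto

lemma lip_bounded_mult:
  assumes "lip_bounded f" "lip_bounded g"
  shows "lip_bounded (\<lambda>x. f x * g x)"
proof -
  obtain B1 L1 B2 L2 where B1: "\<And>x. norm (f x) \<le> B1" and L1: "\<And>x y. norm (f x - f y) \<le> L1 * \<bar>x - y\<bar>"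
    and B2: "\<And>x. norm (g x) \<le> B2" and L2: "\<And>x y. norm (g x - g y) \<le> L2 * \<bar>x - y\<bar>"
    using assms unfolding lip_bounded_def by blast
  have B0: "0 \<le> B1" "0 \<le> B2" using B1[of 0] B2[of 0] norm_ge_zero order_trans by blast+
  have "norm (f x * g x) \<le> B1 * B2" for x
    unfolding norm_mult using B0 by (intro mult_mono B1 B2) auto
  moreover have "norm (f x * g x - f y * g y) \<le> (B1 * L2 + L1 * B2) * \<bar>x - y\<bar>" for x y
  proof -
    have "f x * g x - f y * g y = f x * (g x - g y) + (f x - f y) * g y" by (simp add: algebra_simps)
    then have "norm (f x * g x - f y * g y) \<le> norm (f x) * norm (g x - g y) + norm (f x - f y) * norm (g y)"
      by (metis norm_mult norm_triangle_ineq)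
    also have "\<dots> \<le> B1 * (L2 * \<bar>x - y\<bar>) + (L1 * \<bar>x - y\<bar>) * B2"
      using B0 order_trans[OF norm_ge_zero L1[of x y]] by (intro add_mono mult_mono B1 B2 L1 L2) auto
    finally show ?thesis by (simp add: algebra_simps)
  qed
  ultimately show ?thesis unfolding lip_bounded_def by blast
qed

lemma lip_bounded_add:
  assumes "lip_bounded f" "lip_bounded g"
  shows "lip_bounded (\<lambda>x. f x + g x)"
proof -
  obtain B1 L1 B2 L2 where B1: "\<And>x. norm (f x) \<le> B1" and L1: "\<And>x y. norm (f x - f y) \<le> L1 * \<bar>x - y\<bar>"
    and B2: "\<And>x. norm (g x) \<le> B2" and L2: "\<And>x y. norm (g x - g y) \<le> L2 * \<bar>x - y\<bar>"
    using assms unfolding lip_bounded_def by blast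
  have "norm (f x + g x) \<le> B1 + B2" for x using B1[of x] B2[of x] norm_triangle_ineq[of "f x" "g x"] by linarith
  moreover have "norm ((f x + g x) - (f y + g y)) \<le> (L1 + L2) * \<bar>x - y\<bar>" for x y
    using L1[of x y] L2[of x y] norm_triangle_ineq[of "f x - f y" "g x - g y"] by (simp add: algebra_simps)
  ultimately show ?thesis unfolding lip_bounded_def by blast
qed

lemma lip_bounded_exp:
  assumes "lip_bounded f"
  shows "lip_bounded (\<lambda>x. exp (f x))"
proof -
  obtain B L where B: "\<And>x. norm (f x) \<le> B" and L: "\<And>x y. norm (f x - f y) \<le> L * \<bar>x - y\<bar>"
    using assms unfolding lip_bounded_def by blast
  have eB: "exp (Re (f x)) \<le> exp B" for x using B[of x] complex_Re_le_cmod[of "f x"] by simp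
  have "norm (exp (f x) - exp (f y)) \<le> (exp B * L) * \<bar>x - y\<bar>" for x y
    using norm_exp_diff_le[OF eB[of x] eB[of y]] mult_left_mono[OF L[of x y], of "exp B"] by (simp only: mult.assoc exp_ge_zero) (metis order_trans)
  moreover have "norm (exp (f x)) \<le> exp B" for x using eB by simp
  ultimately show ?thesis unfolding lip_bounded_def by blast
qed

lemma lip_bounded_cis: "lip_bounded (\<lambda>x. cis (c * x))"
proof -
  have "norm (cis (c * x) - cis (c * y)) \<le> \<bar>c\<bar> * \<bar>x - y\<bar>" for x y
  proof -
    have "norm (exp (\<i> * of_real (c * x)) - exp (\<i> * of_real (c * y))) \<le> 1 * norm (\<i> * of_real (c * x) - \<i> * of_real (c * y))"
      by (rule norm_exp_diff_le) auto
    also have "\<i> * of_real (c * x) - \<i> * of_real (c * y) = \<i> * complex_of_real (c * (x - y))" by (simp add: algebra_simps)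
    finally show ?thesis by (simp only: cis_conv_exp norm_mult norm_of_real) (simp add: abs_mult)
  qed
  moreover have "norm (cis (c * x)) \<le> 1" for x by simp
  ultimately show ?thesis unfolding lip_bounded_def by blast
qed

lemma lip_bounded_poly: "lip_bounded (\<lambda>x. poly P (cis x))"
proof (induction P)
  case 0 then show ?case by (simp add: lip_bounded_const)
next
  case (pCons c P)
  then show ?case using lip_bounded_cis[of 1] by (simp add: lip_bounded_add lip_bounded_mult lip_bounded_const)
qed

lemma periodic_reduce:
  fixes x :: real
  shows "\<exists>l::int. x + 2 * pi * of_int l \<in> {-pi..pi}"
proof -
  define l where "l = round (x / (2 * pi))"
  have "\<bar>of_int l - x / (2 * pi)\<bar> \<le> 1 / 2" unfolding l_def by (rule of_int_round_abs_le)
  then have "2 * pi * \<bar>of_int l - x / (2 * pi)\<bar> \<le> 2 * pi * (1 / 2)" by (intro mult_left_mono) auto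
  moreover have "2 * pi * \<bar>of_int l - x / (2 * pi)\<bar> = \<bar>2 * pi * (of_int l - x / (2 * pi))\<bar>" by (simp add: abs_mult)
  moreover have "2 * pi * (of_int l - x / (2 * pi)) = 2 * pi * of_int l - x" by (simp add: field_simps)
  ultimately have "\<bar>2 * pi * of_int l - x\<bar> \<le> pi" by simp
  then show ?thesis by (intro exI[of _ "- l"]) auto
qed

lemma periodic_attains_inf:
  fixes f :: "real \<Rightarrow> real"
  assumes per: "\<And>x. f (x + 2 * pi) = f x" and cont: "continuous_on {-pi..pi} f"
  shows "\<exists>y. \<forall>x. f y \<le> f x"
proof -
  have "\<exists>y\<in>{-pi..pi}. \<forall>x\<in>{-pi..pi}. f y \<le> f x"
    by (rule continuous_attains_inf[OF compact_Icc _ cont]) simp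
  then obtain y where y: "\<And>x. x \<in> {-pi..pi} \<Longrightarrow> f y \<le> f x" by blast
  have "f y \<le> f x" for x
  proof -
    obtain l :: int where "x + 2 * pi * of_int l \<in> {-pi..pi}" using periodic_reduce by blast
    from y[OF this] show ?thesis by (simp add: periodic_int[of f, OF per])
  qed
  then show ?thesis by blast
qed

text \<open>Integrating by parts \<open>M\<close> times turns the weight \<open>|j| ^ M\<close> into
  the coefficients of the Lipschitz function \<open>D M\<close>, for which
  \<open>lipschitz_fourier_bound\<close> supplies one further power.\<close>

lemma C_lip_circle_fourier:
  assumes V: "C_lip_circle M V" and M: "M \<ge> 1"
  shows "lip_bounded (\<lambda>t. of_real (V t))" and "\<And>x. V (x + 2 * pi) = V x"
    and "\<exists>L\<ge>0. \<forall>J. finite J \<longrightarrow> (\<Sum>j\<in>J. (\<bar>of_int j\<bar> ^ Suc M * norm (fourier_coeff V j))\<^sup>2) \<le> L\<^sup>2"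
proof -
  show per0: "\<And>x. V (x + 2 * pi) = V x" using V by (simp add: C_lip_circle_def)
  obtain D L where D0: "D 0 = V" and D: "\<And>i x. i < M \<Longrightarrow> (D i has_real_derivative D (Suc i) x) (at x)"
    and L: "\<And>x y. \<bar>D M x - D M y\<bar> \<le> L * \<bar>x - y\<bar>"
    using V unfolding C_lip_circle_def by blast
  have L0: "0 \<le> L" using order_trans[OF abs_ge_zero L[of 0 1]] by simp
  \<comment> \<open>Derivatives of a periodic function are periodic, by uniqueness of the
    derivative; the boundary terms below cancel for this reason.\<close>
  have per: "D i (x + 2 * pi) = D i x" if "i \<le> M" for i x using that
  proof (induction i arbitrary: x)
    case 0 then show ?case using per0 D0 by simp
  next
    case (Suc i)
    have "((\<lambda>x. D i (x + 2 * pi)) has_real_derivative D (Suc i) (x + 2 * pi)) (at x)"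
      using D[of i "x + 2 * pi"] Suc.prems by (subst DERIV_shift[symmetric]) (simp_all add: add.commute)
    moreover have "(\<lambda>x. D i (x + 2 * pi)) = D i" using Suc by auto
    ultimately show ?case using D[of i x] Suc.prems DERIV_unique by fastforce
  qed
  have cM: "continuous_on S (D M)" for S
  proof -
    have "L-lipschitz_on S (D M)" by (rule lipschitz_onI) (use L L0 in \<open>auto simp: dist_real_def\<close>)
    then show ?thesis by (rule lipschitz_on_continuous_on)
  qed
  have cont: "continuous_on S (D i)" if "i \<le> M" for i S
  proof (cases "i = M")
    case False
    then show ?thesis using that D[of i] by (intro continuous_at_imp_continuous_on ballI DERIV_isCont[of "D i" "D (Suc i) _"]) auto
  qed (use cM in simp)
  have bd: "\<exists>B. \<forall>x. \<bar>D i x\<bar> \<le> B" if i: "i \<le> M" for i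
  proof -
    have "\<exists>y. \<forall>x. - \<bar>D i y\<bar> \<le> - \<bar>D i x\<bar>"
      by (rule periodic_attains_inf) (auto intro!: continuous_intros cont i simp: per[OF i])
    then show ?thesis by auto
  qed
  show "lip_bounded (\<lambda>t. of_real (V t))"
  proof -
    obtain B0 B1 where B0: "\<And>x. \<bar>V x\<bar> \<le> B0" and B1: "\<And>x. \<bar>D 1 x\<bar> \<le> B1"
      using bd[of 0] bd[of 1] M D0 by auto
    have "\<bar>V x - V y\<bar> \<le> B1 * \<bar>x - y\<bar>" for x y
      using field_differentiable_bound[of UNIV V "D 1" B1 x y] D[of 0] D0 B1 M by auto
    then have "norm (complex_of_real (V x) - complex_of_real (V y)) \<le> B1 * \<bar>x - y\<bar>" for x y
      by (simp only: of_real_diff[symmetric] norm_of_real)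
    then show ?thesis unfolding lip_bounded_def using B0 by auto
  qed
  \<comment> \<open>Integration by parts: the mean of the derivative of
    \<open>D i t * cis (- j t)\<close> is zero.\<close>
  have fc: "fourier_c (\<lambda>t. of_real (D (Suc i) t)) j = \<i> * of_int j * fourier_c (\<lambda>t. of_real (D i t)) j" if i: "i < M" for i j
  proof -
    have d: "((\<lambda>t. complex_of_real (D i t) * cis (- of_int j * t)) has_vector_derivative
        (of_real (D i t) * (\<i> * of_real (- of_int j) * cis (- of_int j * t)) + of_real (D (Suc i) t) * cis (- of_int j * t))) (at t within {-pi..pi})" for t
    proof -
      have "((\<lambda>t. complex_of_real (D i t)) has_vector_derivative of_real (D (Suc i) t)) (at t within {-pi..pi})"
        by (rule has_vector_derivative_of_real)
           (use D[OF i, of t] in \<open>auto simp: has_real_derivative_iff_has_vector_derivative intro: has_vector_derivative_at_within\<close>)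
      from has_vector_derivative_mult[OF this has_vector_derivative_cis_mult[of "- of_int j"]] show ?thesis .
    qed
    have "((\<lambda>t. of_real (D i t) * (\<i> * of_real (- of_int j) * cis (- of_int j * t)) + of_real (D (Suc i) t) * cis (- of_int j * t)) has_integral
       complex_of_real (D i pi) * cis (- of_int j * pi) - complex_of_real (D i (-pi)) * cis (- of_int j * (-pi))) {-pi..pi}"
      by (rule fundamental_theorem_of_calculus[OF _ d]) simp
    moreover have "D i pi = D i (-pi)" using per[of i "-pi"] i by simp
    moreover have "cis (- of_int j * pi) = cis (- of_int j * (-pi))"
    proof -
      have "cis (- of_int j * pi) = cis (- of_int j * (-pi)) * cis (2 * pi * of_int (- j))"
        by (simp only: cis_mult) (simp add: algebra_simps)
      then show ?thesis by (simp add: cis_multiple_2pi del: of_int_minus)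
    qed
    ultimately have "circ_mean (\<lambda>t. of_real (D i t) * (\<i> * of_real (- of_int j) * cis (- of_int j * t)) + of_real (D (Suc i) t) * cis (- of_int j * t)) = 0"
      by (simp add: circ_mean_def integral_unique)
    also have "(\<lambda>t. of_real (D i t) * (\<i> * of_real (- of_int j) * cis (- of_int j * t)) + of_real (D (Suc i) t) * cis (- of_int j * t)) =
       (\<lambda>t. (- \<i> * of_int j) * (of_real (D i t) * cis (- of_int j * t)) + of_real (D (Suc i) t) * cis (- of_int j * t))"
      by (intro ext) (simp add: algebra_simps)
    also have "circ_mean \<dots> = circ_mean (\<lambda>t. (- \<i> * of_int j) * (of_real (D i t) * cis (- of_int j * t))) + circ_mean (\<lambda>t. of_real (D (Suc i) t) * cis (- of_int j * t))"
      by (intro circ_mean_add continuous_intros cont) (use i in auto)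
    finally have "0 = (- \<i> * of_int j) * fourier_c (\<lambda>t. of_real (D i t)) j + fourier_c (\<lambda>t. of_real (D (Suc i) t)) j"
      unfolding circ_mean_cmult fourier_c_def ..
    then show ?thesis by (simp add: algebra_simps eq_neg_iff_add_eq_0)
  qed
  have fcn: "norm (fourier_c (\<lambda>t. of_real (D i t)) j) = \<bar>of_int j\<bar> ^ i * norm (fourier_coeff V j)" if "i \<le> M" for i j
    using that
  proof (induction i)
    case 0 then show ?case by (simp add: D0 fourier_c_def circ_mean_def fourier_coeff_def)
  next
    case (Suc i) then show ?case by (simp add: fc norm_mult)
  qed
  have "(\<Sum>j\<in>J. (\<bar>of_int j\<bar> ^ Suc M * norm (fourier_coeff V j))\<^sup>2) \<le> L\<^sup>2" if J: "finite J" for J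
  proof -
    have "(\<Sum>j\<in>J. (\<bar>of_int j\<bar> * norm (fourier_c (\<lambda>t. of_real (D M t)) j))\<^sup>2) \<le> L\<^sup>2"
    proof (rule lipschitz_fourier_bound[OF _ _ J])
      show "norm (complex_of_real (D M x) - complex_of_real (D M y)) \<le> L * \<bar>x - y\<bar>" for x y
        using L[of x y] by (simp only: of_real_diff[symmetric] norm_of_real)
    qed (simp add: per)
    then show ?thesis by (simp add: fcn mult.assoc)
  qed
  then show "\<exists>L\<ge>0. \<forall>J. finite J \<longrightarrow> (\<Sum>j\<in>J. (\<bar>of_int j\<bar> ^ Suc M * norm (fourier_coeff V j))\<^sup>2) \<le> L\<^sup>2"
    using L0 by blast
qed

section \<open>Orthogonal polynomials\<close>

text \<open>The value 0 at index 0 splits off the mean of \<open>V\<close> and makes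
  \<open>S 0 = 0\<close>.\<close>

definition potential_coeff :: "(real \<Rightarrow> real) \<Rightarrow> nat \<Rightarrow> complex" where
  "potential_coeff V j = (if j = 0 then 0 else fourier_coeff V (int j))"

lemma fourier_coeff_minus: "fourier_coeff V (- j) = cnj (fourier_coeff V j)"
  by (simp add: fourier_coeff_def integral_cnj cis_cnj)

lemma fourier_c_of_real: "fourier_c (\<lambda>t. of_real (V t)) j = fourier_coeff V j"
  by (simp add: fourier_c_def circ_mean_def fourier_coeff_def)

lemma cnj_inverse_cis: "cnj (inverse (cis t)) = cis t"
  by (simp add: cis_cnj cis_inverse)

lemma sobolev_coeffs_potential:
  assumes "k \<ge> 2" "C_lip_circle (k - 1) V"
  shows "\<exists>L. sobolev_coeffs (potential_coeff V) k L"
proof -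
  have k1: "k - 1 \<ge> 1" using assms(1) by simp
  obtain L where L: "L \<ge> 0" and J: "\<And>J. finite J \<Longrightarrow> (\<Sum>j\<in>J. (\<bar>of_int j\<bar> ^ Suc (k - 1) * norm (fourier_coeff V j))\<^sup>2) \<le> L\<^sup>2"
    using C_lip_circle_fourier(3)[OF assms(2) k1] by blast
  have "(\<Sum>j<M. (real j ^ k * norm (potential_coeff V j))\<^sup>2) \<le> L\<^sup>2" for M
  proof -
    have "(\<Sum>j<M. (real j ^ k * norm (potential_coeff V j))\<^sup>2) \<le> (\<Sum>j<M. (real j ^ k * norm (fourier_coeff V (int j)))\<^sup>2)"
      by (intro sum_mono power_mono) (auto simp: potential_coeff_def)
    also have "\<dots> = (\<Sum>j\<in>int ` {..<M}. (\<bar>of_int j\<bar> ^ Suc (k - 1) * norm (fourier_coeff V j))\<^sup>2)"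
      using assms(1) by (simp add: sum.reindex del: power_Suc)
    also have "\<dots> \<le> L\<^sup>2" by (rule J) auto
    finally show ?thesis .
  qed
  then show ?thesis using assms(1) L by (intro exI[of _ L]) (unfold_locales, auto simp: potential_coeff_def)
qed

section \<open>The potential, \<open>N\<close> and \<open>kappa\<close> in terms of
  \<open>S\<close>\<close>

context sobolev_coeffs
begin

lemma summable_S: "norm z \<le> 1 \<Longrightarrow> summable (\<lambda>j. a j * z ^ j)"
  by (rule summable_comparison_test'[OF summable_0, of 0]) (simp add: norm_mult norm_power mult_left_le power_le_one)

lemma cnj_S: "norm z \<le> 1 \<Longrightarrow> cnj (S (cnj z)) = (\<Sum>j. cnj (a j) * z ^ j)"
  unfolding S_def using bounded_linear.suminf[OF bounded_linear_cnj summable_S[of "cnj z"]] by simp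

text \<open>\<open>V\<close> is real, so \<open>V_{-j}\<close> is the conjugate of
  \<open>V_j\<close>, and \<open>N\<close> is the reflection of \<open>S\<close> in the unit
  circle.\<close>

lemma Nfun_eq:
  assumes a: "a = potential_coeff V" and z: "norm z \<ge> 1"
  shows "Nfun V z = cnj (S (cnj (inverse z)))"
proof -
  define w where "w = inverse z"
  have w: "norm w \<le> 1" using z by (simp add: w_def norm_inverse inverse_le_1_iff)
  have sm: "summable (\<lambda>j. cnj (a j) * w ^ j)"
    using summable_comparison_test'[OF summable_0, of 0 "\<lambda>j. cnj (a j) * w ^ j"] w
    by (simp add: norm_mult norm_power mult_left_le power_le_one)
  have "cnj (S (cnj w)) = (\<Sum>j. cnj (a j) * w ^ j)" by (rule cnj_S[OF w])
  also have "\<dots> = (\<Sum>j. cnj (a (Suc j)) * w ^ Suc j)" using suminf_split_head[OF sm] by (simp add: a0)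
  also have "(\<lambda>j. cnj (a (Suc j)) * w ^ Suc j) = (\<lambda>j. fourier_coeff V (- int (Suc j)) / z ^ Suc j)"
    by (intro ext) (simp only: a potential_coeff_def fourier_coeff_minus w_def divide_inverse power_inverse nat.distinct if_False)
  finally show ?thesis by (simp add: Nfun_def w_def)
qed

lemma kappa_eq:
  assumes a: "a = potential_coeff V"
  shows "kappa V t = t - 2 * (\<Sum>j. Im (a j * cis (real j * t)))"
proof -
  have "Nfun V (cis t) = cnj (S (cis t))" using Nfun_eq[OF a, of "cis t"] by (simp only: cnj_inverse_cis norm_cis)
  moreover have "Im (S (cis t)) = (\<Sum>j. Im (a j * cis (real j * t)))"
    unfolding S_def Complex.DeMoivre[symmetric]
    by (rule bounded_linear.suminf[OF bounded_linear_Im]) (rule summable_S, simp)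
  ultimately show ?thesis by (simp add: kappa_def Omega_def)
qed

text \<open>Termwise differentiation; \<open>summable_1\<close> is the majorant of the
  differentiated series.\<close>

lemma kappa_deriv:
  assumes a: "a = potential_coeff V"
  shows "(kappa V has_real_derivative 1 - 2 * (\<Sum>j. real j * Re (a j * cis (real j * t)))) (at t)"
proof -
  have "((\<lambda>t. \<Sum>j. Im (a j * cis (real j * t))) has_field_derivative (\<Sum>j. real j * Re (a j * cis (real j * t)))) (at t)"
  proof (rule has_field_derivative_series'(2)[of UNIV _ _ 0])
    show "((\<lambda>t. Im (a j * cis (real j * t))) has_field_derivative real j * Re (a j * cis (real j * x))) (at x within UNIV)" for j x
      by (auto intro!: derivative_eq_intros simp: algebra_simps)
    show "uniformly_convergent_on UNIV (\<lambda>n x. \<Sum>i<n. real i * Re (a i * cis (real i * x)))"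
    proof (rule Weierstrass_m_test'[OF _ summable_1])
      show "norm (real i * Re (a i * cis (real i * x))) \<le> real i * norm (a i)" for i x
        using abs_Re_le_cmod[of "a i * cis (real i * x)"] by (simp only: real_norm_def abs_mult norm_mult norm_cis) (simp add: mult_left_mono)
    qed
    show "summable (\<lambda>n. Im (a n * cis (real n * 0)))"
      by (rule summable_comparison_test'[OF summable_0, of 0]) (use abs_Im_le_cmod in auto)
  qed auto
  then have "((\<lambda>t. t - 2 * (\<Sum>j. Im (a j * cis (real j * t)))) has_field_derivative 1 - 2 * (\<Sum>j. real j * Re (a j * cis (real j * t)))) (at t)"
    by (intro derivative_intros DERIV_cmult)
  moreover have "kappa V = (\<lambda>t. t - 2 * (\<Sum>j. Im (a j * cis (real j * t))))" by (rule ext) (rule kappa_eq[OF a])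
  ultimately show ?thesis by simp
qed

text \<open>The series for \<open>kappa'\<close> is continuous and periodic, so it attains its
  minimum; this positive value is \<open>c0\<close>.\<close>

lemma phase_if_kappa_increasing:
  assumes a: "a = potential_coeff V" and kap: "\<forall>t. \<exists>d>0. (kappa V has_real_derivative d) (at t)"
  shows "\<exists>c0. phase a k L c0"
proof -
  define f where "f t = 1 - 2 * (\<Sum>j. real j * Re (a j * cis (real j * t)))" for t
  have fpos: "f t > 0" for t
    using kap kappa_deriv[OF a, of t] DERIV_unique unfolding f_def by metis
  have sm: "summable (\<lambda>j. norm (of_nat j * a j))" using summable_1 by (simp add: norm_mult)
  have f_eq: "f t = 1 - 2 * Re (\<Sum>j. of_nat j * a j * cis (real j * t))" for t
  proof -
    have "summable (\<lambda>j. of_nat j * a j * cis (real j * t))"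
      by (rule summable_norm_cancel) (use sm in \<open>simp add: norm_mult\<close>)
    from bounded_linear.suminf[OF bounded_linear_Re this] show ?thesis
      unfolding f_def by (simp add: right_diff_distrib mult.assoc)
  qed
  have cont: "continuous_on X f" for X
    unfolding f_eq[abs_def] by (intro continuous_intros power_series_circle_cont[OF sm])
  have "cis (real j * (t + 2 * pi)) = cis (real j * t)" for j t
  proof -
    have "cis (real j * (t + 2 * pi)) = cis (real j * t) * cis (2 * pi * real j)" by (simp only: cis_mult) (simp add: algebra_simps)
    then show ?thesis by (simp add: cis_multiple_2pi)
  qed
  then have "f (t + 2 * pi) = f t" for t by (simp only: f_def)
  then obtain y where "\<And>t. f y \<le> f t" using periodic_attains_inf[OF _ cont] by blast
  then show ?thesis using fpos[of y] unfolding f_def by (intro exI[of _ "f y"]) (unfold_locales, auto simp: f_def)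
qed

text \<open>The Fourier series of \<open>V\<close>, split by the sign of the frequency.\<close>

lemma potential_eq:
  assumes a: "a = potential_coeff V" and lip: "lip_bounded (\<lambda>t. of_real (V t))" and per: "\<And>x. V (x + 2 * pi) = V x"
  shows "complex_of_real (V t) = fourier_coeff V 0 + S (cis t) + cnj (S (cis t))"
proof -
  obtain L where L: "\<And>x y. norm (complex_of_real (V x) - of_real (V y)) \<le> L * \<bar>x - y\<bar>"
    using lip unfolding lip_bounded_def by blast
  define f where "f t = complex_of_real (V t)" for t
  have fper: "f (x + 2 * pi) = f x" and fL: "norm (f x - f y) \<le> L * \<bar>x - y\<bar>" for x y
    using per L by (simp_all add: f_def)
  have fc: "fourier_c f j = fourier_coeff V j" for j using fourier_c_of_real[of V j] by (simp add: f_def[abs_def])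
  have sum0: "summable (\<lambda>j. fourier_c f (int j) * cis (real j * t))"
    by (rule summable_norm_cancel) (use lipschitz_fourier_summable(1)[OF fper fL] in \<open>simp add: norm_mult\<close>)
  have sm: "summable (\<lambda>j. a j * cis (real j * t))"
    by (rule summable_norm_cancel) (use summable_0 in \<open>simp add: norm_mult\<close>)
  have S1: "S (cis t) = (\<Sum>j. a (Suc j) * cis (real (Suc j) * t))"
    using suminf_split_head[OF sm] by (simp add: S_cis a0)
  have "(\<Sum>j. fourier_c f (int j) * cis (real j * t)) = fourier_coeff V 0 + (\<Sum>j. fourier_c f (int (Suc j)) * cis (real (Suc j) * t))"
    using suminf_split_head[OF sum0] by (simp add: fc)
  also have "(\<Sum>j. fourier_c f (int (Suc j)) * cis (real (Suc j) * t)) = S (cis t)"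
    unfolding S1 by (simp only: fc a potential_coeff_def nat.distinct if_False)
  finally have 1: "(\<Sum>j. fourier_c f (int j) * cis (real j * t)) = fourier_coeff V 0 + S (cis t)" .
  have "(\<Sum>j. fourier_c f (- int (Suc j)) * cis (- real (Suc j) * t)) = (\<Sum>j. cnj (a (Suc j) * cis (real (Suc j) * t)))"
    by (simp only: fc a potential_coeff_def nat.distinct if_False fourier_coeff_minus complex_cnj_mult cis_cnj mult_minus_left)
  also have "\<dots> = cnj (S (cis t))"
    unfolding S1 by (rule bounded_linear.suminf[OF bounded_linear_cnj, symmetric])
       (use sm in \<open>simp only: summable_Suc_iff[of "\<lambda>j. a j * cis (real j * t)"]\<close>)
  finally have 2: "(\<Sum>j. fourier_c f (- int (Suc j)) * cis (- real (Suc j) * t)) = cnj (S (cis t))" .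
  have "f t = fourier_coeff V 0 + S (cis t) + cnj (S (cis t))"
    using lipschitz_fourier_sum[OF fper fL, of t] by (simp only: 1 2)
  then show ?thesis by (simp only: f_def)
qed

end

section \<open>From orthogonality to the Hardy space system\<close>

context phase
begin

lemma OPUC_hardy_system:
  assumes a: "a = potential_coeff V" and lip: "lip_bounded (\<lambda>t. of_real (V t))" and per: "\<And>x. V (x + 2 * pi) = V x"
    and P: "is_OPUC V n P"
  shows "\<exists>v W Q. hardy_system n (\<lambda>z. poly (reflect_poly (map_poly cnj P)) z * exp (- of_nat n * S z)) v W Q"
proof -
  have deg: "degree P = n" and lead: "lead_coeff P = 1" and
    orth: "\<And>j. j < n \<Longrightarrow> inner_phi (\<lambda>\<theta>. exp (- real n * V \<theta>)) (poly P) (\<lambda>z. z ^ j) = 0"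
    using P by (auto simp: is_OPUC_def)
  have "fourier_coeff V 0 = cnj (fourier_coeff V 0)" using fourier_coeff_minus[of V 0] by simp
  then have "fourier_coeff V 0 \<in> \<real>" by (metis Reals_cnj_iff)
  then obtain v0 where v0: "fourier_coeff V 0 = of_real v0" by (auto elim: Reals_cases)
  \<comment> \<open>Subtracting the mean \<open>v0\<close> leaves exactly \<open>S + cnj S\<close>
    in the exponent and only rescales the weight by a constant.\<close>
  define F where "F t = poly P (cis t) * cis (- real n * t) * exp (of_real (- real n * (V t - v0)))" for t
  have Fexp: "exp (complex_of_real (- real n * (V t - v0))) = exp (- of_nat n * S (cis t)) * exp (- of_nat n * cnj (S (cis t)))" for t
  proof -
    have "complex_of_real (- real n * (V t - v0)) = - of_nat n * (complex_of_real (V t) - fourier_coeff V 0)" by (simp add: v0)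
    also have "\<dots> = - of_nat n * S (cis t) + (- of_nat n * cnj (S (cis t)))"
      by (subst potential_eq[OF a lip per]) (simp add: algebra_simps)
    finally show ?thesis by (simp only: exp_add)
  qed
  have "lip_bounded F"
  proof -
    have "lip_bounded (\<lambda>t. (- of_nat n) * of_real (V t) + of_nat n * of_real v0)"
      by (intro lip_bounded_add lip_bounded_mult lip_bounded_const lip)
    then have "lip_bounded (\<lambda>t. exp (of_real (- real n * (V t - v0))))"
      by (intro lip_bounded_exp) (simp add: algebra_simps)
    then show ?thesis unfolding F_def by (intro lip_bounded_mult lip_bounded_poly lip_bounded_cis)
  qed
  then obtain LF where FL: "\<And>x y. norm (F x - F y) \<le> LF * \<bar>x - y\<bar>" unfolding lip_bounded_def by blast
  have cisp: "cis (- real n * (t + 2 * pi)) = cis (- real n * t)" "cis (t + 2 * pi) = cis t" for t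
  proof -
    have "cis (- real n * (t + 2 * pi)) = cis (- real n * t) * cis (2 * pi * of_int (- int n))"
      by (simp only: cis_mult) (simp add: algebra_simps)
    then show "cis (- real n * (t + 2 * pi)) = cis (- real n * t)" by (simp add: cis_multiple_2pi del: of_int_minus)
  qed (simp add: complex_eq_iff)
  have Fper: "F (x + 2 * pi) = F x" for x unfolding F_def cisp per ..
  have Fsum: "summable (\<lambda>j. norm (fourier_c F (int j)))" "summable (\<lambda>j. norm (fourier_c F (- int (Suc j))))"
    using lipschitz_fourier_summable[OF Fper FL] by auto
  \<comment> \<open>The coefficient of \<open>F\<close> at \<open>-(j + 1)\<close> is a multiple of
    the inner product with \<open>z ^ (n - 1 - j)\<close>, whose degree is below
    \<open>n\<close>.\<close>
  have Fzero: "fourier_c F (- int (Suc j)) = 0" if j: "j < n" for j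
  proof -
    have "F t * cis (- of_int (- int (Suc j)) * t) = of_real (exp (real n * v0)) *
        (poly P (cis t) * cnj (cis t ^ (n - Suc j)) * of_real (exp (- real n * V t)))" for t
    proof -
      have "cis (- real n * t) * cis (- of_int (- int (Suc j)) * t) = cnj (cis t ^ (n - Suc j))"
        using j by (simp add: cis_mult Complex.DeMoivre cis_cnj of_nat_diff algebra_simps)
      moreover have "exp (complex_of_real (- real n * (V t - v0))) = of_real (exp (real n * v0)) * of_real (exp (- real n * V t))"
        by (simp only: exp_of_real of_real_mult[symmetric] exp_add[symmetric]) (simp add: algebra_simps)
      moreover have "F t * cis (- of_int (- int (Suc j)) * t) = poly P (cis t) * (cis (- real n * t) * cis (- of_int (- int (Suc j)) * t)) * exp (complex_of_real (- real n * (V t - v0)))"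
        unfolding F_def by (simp only: mult_ac)
      ultimately show ?thesis by (simp only: mult_ac)
    qed
    then have "fourier_c F (- int (Suc j)) = of_real (exp (real n * v0)) * inner_phi (\<lambda>\<theta>. exp (- real n * V \<theta>)) (poly P) (\<lambda>z. z ^ (n - Suc j))"
      unfolding fourier_c_def inner_phi_def by (simp only: circ_mean_cmult) (simp only: circ_mean_def)
    then show ?thesis using orth[of "n - Suc j"] j by simp
  qed
  \<comment> \<open>\<open>Fp\<close> collects the frequencies from 0 upwards. The first one
    surviving below zero is \<open>-(n + 1)\<close>, so the rest is the conjugate of
    \<open>z ^ (n + 1) * B z\<close>.\<close>
  define Fp where "Fp z = (\<Sum>j. fourier_c F (int j) * z ^ j)" for z
  define B where "B z = (\<Sum>j. cnj (fourier_c F (- int (Suc (j + n)))) * z ^ j)" for z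
  have sB: "summable (\<lambda>j. norm (cnj (fourier_c F (- int (Suc (j + n))))))"
    using Fsum(2) summable_iff_shift[of "\<lambda>j. norm (fourier_c F (- int (Suc j)))" n] by simp
  have dFp: "disk_alg Fp" unfolding Fp_def by (rule disk_alg_power_series[OF Fsum(1)])
  have dB: "disk_alg B" unfolding B_def by (rule disk_alg_power_series[OF sB])
  have Feq: "F t = Fp (cis t) + cnj (cis t ^ Suc n * B (cis t))" for t
  proof -
    have s2: "summable (\<lambda>j. fourier_c F (- int (Suc j)) * cis (- real (Suc j) * t))"
      by (rule summable_norm_cancel) (use Fsum(2) in \<open>simp add: norm_mult\<close>)
    have sB': "summable (\<lambda>j. cnj (fourier_c F (- int (Suc (j + n)))) * cis t ^ j)"
      by (rule summable_norm_cancel) (use sB in \<open>simp add: norm_mult norm_power\<close>)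
    have "(\<Sum>j. fourier_c F (- int (Suc j)) * cis (- real (Suc j) * t)) =
      (\<Sum>j. fourier_c F (- int (Suc (j + n))) * cis (- real (Suc (j + n)) * t))"
      by (subst suminf_split_initial_segment[OF s2, of n]) (simp add: Fzero del: of_nat_Suc)
    also have "\<dots> = (\<Sum>j. cnj (cis t ^ Suc n * (cnj (fourier_c F (- int (Suc (j + n)))) * cis t ^ j)))"
    proof -
      have "cis (- real (Suc (j + n)) * t) = cnj (cis t ^ Suc n * cis t ^ j)" for j
        by (simp only: Complex.DeMoivre cis_mult cis_cnj) (simp add: algebra_simps)
      then show ?thesis by (simp only: complex_cnj_mult complex_cnj_cnj mult_ac)
    qed
    also have "\<dots> = cnj (cis t ^ Suc n * B (cis t))"
      unfolding B_def
      by (simp only: suminf_mult[OF sB', symmetric] bounded_linear.suminf[OF bounded_linear_cnj summable_mult[OF sB'], symmetric])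
    finally show ?thesis
      using lipschitz_fourier_sum[OF Fper FL, of t] by (simp add: Fp_def Complex.DeMoivre del: power_Suc)
  qed
  define G where "G z = poly (reflect_poly (map_poly cnj P)) z * exp (- of_nat n * S z)" for z
  \<comment> \<open>Multiplying the splitting of \<open>F\<close> by \<open>exp (n S)\<close>
    cancels \<open>exp (- n S)\<close> and leaves \<open>cnj G\<close> on the left. \<open>W\<close>
    is chosen so that \<open>u W = z ^ (n + 1) B exp (n cnj S)\<close> on the circle.\<close>
  define v where "v z = exp (of_nat n * S z) * Fp z" for z
  define W where "W z = z * exp (of_nat n * S z) * B z" for z
  define Q where "Q z = poly P z * exp (- of_nat n * S z)" for z
  have degc: "degree (map_poly cnj P) = n" using deg by (simp add: degree_map_poly)
  have S0: "S 0 = 0" unfolding S_def using a0 by (simp add: powser_zero)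
  have cG: "cnj (G (cis t)) = poly P (cis t) * cis (- real n * t) * exp (- of_nat n * cnj (S (cis t)))" for t
  proof -
    have "poly (reflect_poly (map_poly cnj P)) (cis t) = cis t ^ n * cnj (poly P (cis t))"
      using poly_reflect_poly_nz[of "cis t" "map_poly cnj P"] by (simp add: degc cis_cnj)
    then have "cnj (poly (reflect_poly (map_poly cnj P)) (cis t)) = poly P (cis t) * cis (- real n * t)"
      by (simp add: Complex.DeMoivre cis_cnj)
    then show ?thesis by (simp add: G_def exp_cnj)
  qed
  have i: "cnj (G (cis t)) = v (cis t) + cnj (u n t * W (cis t))" for t
  proof -
    define s where "s = S (cis t)"
    have uW: "u n t * W (cis t) = cis t ^ Suc n * B (cis t) * exp (of_nat n * cnj s)"
    proof -
      have "u n t * W (cis t) = cis t ^ Suc n * B (cis t) * (exp (of_nat n * (cnj s - s)) * exp (of_nat n * s))"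
        by (simp add: u_def W_def s_def)
      also have "exp (of_nat n * (cnj s - s)) * exp (of_nat n * s) = exp (of_nat n * cnj s)"
        by (simp only: exp_add[symmetric]) (simp add: algebra_simps)
      finally show ?thesis .
    qed
    have "v (cis t) + cnj (u n t * W (cis t)) = exp (of_nat n * s) * (Fp (cis t) + cnj (cis t ^ Suc n * B (cis t)))"
      unfolding uW v_def s_def[symmetric] by (simp add: exp_cnj algebra_simps)
    also have "\<dots> = exp (of_nat n * s) * F t" by (simp only: Feq)
    also have "\<dots> = poly P (cis t) * cis (- real n * t) * exp (- of_nat n * cnj s) * (exp (of_nat n * s) * exp (- of_nat n * s))"
      unfolding F_def Fexp s_def by (simp only: mult_ac)
    also have "exp (of_nat n * s) * exp (- of_nat n * s) = 1" by (simp only: exp_add[symmetric]) simp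
    finally show ?thesis by (simp add: cG s_def)
  qed
  have ii: "u n t * v (cis t) + cnj (W (cis t)) = Q (cis t)" for t
  proof -
    define s where "s = S (cis t)"
    have uu: "u n t * cnj (u n t) = 1" using norm_u[of n t] by (simp add: complex_norm_square[symmetric])
    have "u n t * v (cis t) + cnj (W (cis t)) = u n t * v (cis t) + (u n t * cnj (u n t)) * cnj (W (cis t))"
      by (simp only: uu mult_1_left)
    also have "\<dots> = u n t * cnj (G (cis t))" unfolding i by (simp add: algebra_simps)
    also have "\<dots> = poly P (cis t) * (cis t ^ n * cis (- real n * t)) * (exp (of_nat n * (cnj s - s)) * exp (- of_nat n * cnj s))"
      by (simp add: cG u_def s_def)
    also have "cis t ^ n * cis (- real n * t) = 1" by (simp add: Complex.DeMoivre cis_mult)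
    also have "exp (of_nat n * (cnj s - s)) * exp (- of_nat n * cnj s) = exp (- of_nat n * s)"
      by (simp only: exp_add[symmetric]) (simp add: algebra_simps)
    finally show ?thesis by (simp add: Q_def s_def)
  qed
  \<comment> \<open>The reversed polynomial takes at 0 the leading coefficient, so monicity
    normalizes \<open>G\<close>.\<close>
  have "lead_coeff (map_poly cnj P) = 1" using lead by (simp add: degc deg coeff_map_poly)
  then have G0: "G 0 = 1" by (simp add: G_def S0)
  have "disk_alg G" "disk_alg v" "disk_alg W" "disk_alg Q"
    unfolding G_def v_def W_def Q_def by (intro disk_alg_intros disk_alg_S dFp dB)+
  moreover have "W 0 = 0" by (simp add: W_def)
  ultimately have "hardy_system n G v W Q"
    unfolding hardy_system_def using i ii G0 by blast
  then show ?thesis unfolding G_def by blast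
qed

text \<open>The reflection \<open>z -> 1 / cnj z\<close> carries the exterior expression to the
  conjugate of \<open>G\<close>, so bounds for \<open>G\<close> inside the disk become bounds
  outside.\<close>

lemma OPUC_exterior_eq:
  assumes a: "a = potential_coeff V" and P: "degree P = n" and z: "norm z \<ge> 1"
  shows "poly P z / z ^ n * exp (- of_nat n * Nfun V z) =
         cnj (poly (reflect_poly (map_poly cnj P)) (cnj (inverse z)) * exp (- of_nat n * S (cnj (inverse z))))"
proof -
  have z0: "z \<noteq> 0" using z by auto
  have d: "degree (map_poly cnj P) = n" using P by (simp add: degree_map_poly)
  have "poly (reflect_poly (map_poly cnj P)) (cnj (inverse z)) = cnj (inverse z) ^ n * cnj (poly P z)"
    using poly_reflect_poly_nz[of "cnj (inverse z)" "map_poly cnj P"] z0 by (simp add: d)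
  then show ?thesis
    by (simp add: Nfun_eq[OF a z] exp_cnj divide_inverse power_inverse mult_ac)
qed

text \<open>With conjugated coefficients \<open>N\<close> is a power series in \<open>1 / z\<close>,
  which avoids the conjugations in \<open>Nfun_eq\<close>.\<close>

lemma Nfun_holomorphic:
  assumes a: "a = potential_coeff V"
  shows "Nfun V holomorphic_on {z. 1 < norm z}"
proof -
  define T where "T z = (\<Sum>j. cnj (a j) * z ^ j)" for z
  have "disk_alg T" unfolding T_def by (rule disk_alg_power_series) (use summable_0 in simp)
  then have T: "T holomorphic_on ball 0 1" by (simp add: disk_alg_def)
  have "(T \<circ> inverse) holomorphic_on {z. 1 < norm z}"
    by (rule holomorphic_on_compose_gen[OF _ T])
       (auto intro!: holomorphic_intros simp: norm_inverse inverse_less_1_iff)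
  moreover have "Nfun V z = (T \<circ> inverse) z" if "z \<in> {z. 1 < norm z}" for z
    using that Nfun_eq[OF a, of z] cnj_S[of "inverse z"]
    by (simp add: T_def norm_inverse inverse_le_1_iff)
  ultimately show ?thesis using holomorphic_transform by (metis (lifting))
qed

end

section \<open>Derivatives in the exterior domain by Cauchy's inequality\<close>

theorem theorem4p1:
  fixes p k :: nat and V :: "real \<Rightarrow> real"
  assumes "k \<ge> 2 * p + 2"
    and "C_lip_circle (k - 1) V"
    and "\<forall>\<theta>. \<exists>d>0. (kappa V has_real_derivative d) (at \<theta>)"
  shows "\<forall>\<rho>>1. \<exists>K>0. \<forall>\<^sub>F n in sequentially. \<forall>P. is_OPUC V n P \<longrightarrow>
           (\<forall>z. \<rho> \<le> norm z \<longrightarrow>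
              norm ((deriv ^^ p) (\<lambda>w. poly P w / w ^ n * exp (- of_nat n * Nfun V w) - 1) z)
                \<le> K * ln (real n) / real n ^ (2 * (k - 1)))"
proof (intro allI impI)
  fix \<rho> :: real assume \<rho>: "\<rho> > 1"
  have k2: "k \<ge> 2" "k - 1 \<ge> 1" using assms(1) by auto
  note lip = C_lip_circle_fourier(1,2)[OF assms(2) k2(2)]
  obtain L where sc: "sobolev_coeffs (potential_coeff V) k L"
    using sobolev_coeffs_potential[OF k2(1) assms(2)] by blast
  obtain c0 where ph: "phase (potential_coeff V) k L c0"
    using sobolev_coeffs.phase_if_kappa_increasing[OF sc refl assms(3)] by blast
  interpret phase "potential_coeff V" k L c0 by (rule ph)
  \<comment> \<open>\<open>1 / x = (1 + rho) / 2\<close> lies midway between 1 and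
    \<open>rho\<close>, and \<open>r\<close> is the remaining distance: a disk of radius
    \<open>r\<close> about \<open>z\<close> with \<open>|z| >= rho\<close> stays in
    \<open>|w| >= 1 / x\<close>, uniformly in \<open>z\<close>.\<close>
  define x where "x = 2 / (1 + \<rho>)"
  have x: "0 < x" "x < 1" using \<rho> by (auto simp: x_def)
  define r where "r = (\<rho> - 1) / 2"
  have r: "r > 0" using \<rho> by (simp add: r_def)
  obtain K n0 where K: "K \<ge> 0" and bd: "\<And>n G v W Q z. n \<ge> n0 \<Longrightarrow> hardy_system n G v W Q \<Longrightarrow> norm z \<le> x \<Longrightarrow>
           norm (G z - 1) \<le> K / real n ^ (2 * (k - 1))"
    using hardy_system_bound[OF x] by blast
  \<comment> \<open>The factor from Cauchy's inequality; \<open>K + 1\<close> ensures positivity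
    even if \<open>K = 0\<close>.\<close>
  define K' where "K' = fact p * (K + 1) / r ^ p"
  have K': "K' > 0" using K r by (simp add: K'_def)
  have "norm ((deriv ^^ p) (\<lambda>w. poly P w / w ^ n * exp (- of_nat n * Nfun V w) - 1) z) \<le> K' * ln (real n) / real n ^ (2 * (k - 1))"
    if n: "n \<ge> max 3 n0" and P: "is_OPUC V n P" and z: "\<rho> \<le> norm z" for n P z
  proof -
    define f where "f w = poly P w / w ^ n * exp (- of_nat n * Nfun V w) - 1" for w
    define G where "G z = poly (reflect_poly (map_poly cnj P)) z * exp (- of_nat n * S z)" for z
    obtain v W Q where sys: "hardy_system n G v W Q"
      using OPUC_hardy_system[OF refl lip P] unfolding G_def by blast
    have deg: "degree P = n" using P by (simp add: is_OPUC_def)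
    have sub: "cball z r \<subseteq> {w. 1 / x \<le> norm w}"
    proof
      fix w assume "w \<in> cball z r"
      then have "norm z - norm w \<le> r" using norm_triangle_ineq2[of z w] by (simp add: dist_norm)
      then show "w \<in> {w. 1 / x \<le> norm w}" using z \<rho> by (simp add: x_def r_def field_simps)
    qed
    have x1: "1 < 1 / x" using x by simp
    have fb: "norm (f w) \<le> K / real n ^ (2 * (k - 1))" if w: "1 / x \<le> norm w" for w
    proof -
      have fw: "f w = cnj (G (cnj (inverse w)) - 1)"
        using OPUC_exterior_eq[OF refl deg, of w] w x1 unfolding f_def G_def by simp
      have "norm w > 0" using w x1 by linarith
      then have "inverse (norm w) \<le> x" using w x by (simp add: field_simps)
      then have "norm (cnj (inverse w)) \<le> x" by (simp only: complex_mod_cnj norm_inverse)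
      then show ?thesis using bd[OF _ sys, of "cnj (inverse w)"] n unfolding fw complex_mod_cnj by simp
    qed
    have hol: "f holomorphic_on {w. 1 < norm w}"
      unfolding f_def by (intro holomorphic_intros Nfun_holomorphic[OF refl]) auto
    have sub1: "cball z r \<subseteq> {w. 1 < norm w}" using sub x1 by auto
    have "norm ((deriv ^^ p) f z) \<le> fact p * (K / real n ^ (2 * (k - 1))) / r ^ p"
    proof (rule Cauchy_inequality[OF _ _ r])
      show "f holomorphic_on ball z r"
        by (rule holomorphic_on_subset[OF hol]) (use sub1 ball_subset_cball in blast)
      show "continuous_on (cball z r) f"
        by (rule continuous_on_subset[OF holomorphic_on_imp_continuous_on[OF hol] sub1])
      show "norm (f w) \<le> K / real n ^ (2 * (k - 1))" if "norm (z - w) = r" for w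
        by (rule fb) (use sub that in \<open>auto simp: dist_norm\<close>)
    qed
    also have "\<dots> = fact p * K / r ^ p * 1 / real n ^ (2 * (k - 1))" by simp
    also have "\<dots> \<le> K' * ln (real n) / real n ^ (2 * (k - 1))"
    proof (intro divide_right_mono mult_mono)
      show "fact p * K / r ^ p \<le> K'" using r by (simp add: K'_def divide_right_mono)
      \<comment> \<open>From \<open>n >= 3\<close> on, \<open>ln n >= 1\<close>, so the logarithm
        can be inserted as a factor.\<close>
      have "exp 1 \<le> real n" using exp_le n by (meson le_trans max.boundedE numeral_le_real_of_nat_iff order_trans)
      then show "1 \<le> ln (real n)" using n by (subst ln_ge_iff) auto
    qed (use K' in auto)
    finally show ?thesis by (simp only: f_def[abs_def])
  qed
  then show "\<exists>K>0. \<forall>\<^sub>F n in sequentially. \<forall>P. is_OPUC V n P \<longrightarrow>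
           (\<forall>z. \<rho> \<le> norm z \<longrightarrow>
              norm ((deriv ^^ p) (\<lambda>w. poly P w / w ^ n * exp (- of_nat n * Nfun V w) - 1) z)
                \<le> K * ln (real n) / real n ^ (2 * (k - 1)))"
    using K' by (intro exI[of _ K'] conjI eventually_sequentiallyI[of "max 3 n0"]) blast+
qed

end
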